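(* Let $K=\mathbb Q(\sqrt2)$ with $\mathcal O_K=\mathbb Z[\sqrt2]$, and in $\left(\frac{-1,-1}{K}\right)$ let $$\mathcal G=\mathcal O_K\oplus\mathcal O_K2\sqrt2\mathbf i\oplus\mathcal O_K\Big(2\mathbf i+\tfrac{\mathbf i+\mathbf j}{\sqrt2}\Big)\oplus\mathcal O_K\tfrac{(1+\sqrt2)+(3+\sqrt2)\mathbf i+\mathbf j+\mathbf k}{2}.$$ Let $\alpha\in\mathcal O_K$ be totally positive with $\alpha\in(\sqrt2)^e\mathcal O_K\setminus(\sqrt2)^{e+1}\mathcal O_K$. Then $$r_{\mathcal G}(\alpha)=2\sum_{\substack{\delta\mathcal O_K\mid\alpha\mathcal O_K\\ \sqrt2\mathcal O_K\nmid\delta\mathcal O_K}}\operatorname{Nm}(\delta\mathcal O_K)\cdot\begin{cases}1,&e=0,\\2\cdot2,&e=1,\\3\cdot2^2,&e=2,\\4\cdot2^3,&e=3,\\2(2^3+\dots+2^e)+3\cdot2^e-2^3,&e\ge4.\end{cases}$$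
   Context: $\left(\frac{-1,-1}{K}\right)$ has $K$-basis $1,\mathbf i,\mathbf j,\mathbf k$ with $\mathbf i^2=\mathbf j^2=-1$, $\mathbf k=\mathbf i\mathbf j=-\mathbf j\mathbf i$, reduced norm $\operatorname{nrd}(t+x\mathbf i+y\mathbf j+z\mathbf k)=t^2+x^2+y^2+z^2$. $r_{\mathcal G}(\alpha)=\#\{\mathbf q\in\mathcal G:\operatorname{nrd}\mathbf q=\alpha\}$; the sum runs over ideals of $\mathcal O_K$ dividing $\alpha\mathcal O_K$ not divisible by $\sqrt2\mathcal O_K$; $\operatorname{Nm}$ absolute norm. *)

theory Defs
  imports Complex_Main "HOL-Algebra.Ideal_Product" "HOL-Algebra.QuotRing" "HOL-Algebra.Divisibility"
begin

typedef qsqrt2 = "{a + b * sqrt 2 | a b :: real. a \<in> \<rat> \<and> b \<in> \<rat>}"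
  by (rule exI[of _ "0 + 0 * sqrt 2"]) (use Rats_0 in blast)

setup_lifting type_definition_qsqrt2

instantiation qsqrt2 :: field
begin

lift_definition zero_qsqrt2 :: qsqrt2 is 0
  by (rule exI[of _ 0], rule exI[of _ 0]) simp

lift_definition one_qsqrt2 :: qsqrt2 is 1
  by (rule exI[of _ 1], rule exI[of _ 0]) simp

lift_definition plus_qsqrt2 :: "qsqrt2 \<Rightarrow> qsqrt2 \<Rightarrow> qsqrt2" is "(+)"
proof clarify
  fix a b c d :: real
  assume "a \<in> \<rat>" "b \<in> \<rat>" "c \<in> \<rat>" "d \<in> \<rat>"
  then show "\<exists>a' b'. a + b * sqrt 2 + (c + d * sqrt 2) = a' + b' * sqrt 2 \<and> a' \<in> \<rat> \<and> b' \<in> \<rat>"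
    by (intro exI[of _ "a + c"] exI[of _ "b + d"]) (simp add: algebra_simps)
qed

lift_definition uminus_qsqrt2 :: "qsqrt2 \<Rightarrow> qsqrt2" is uminus
proof clarify
  fix a b :: real
  assume "a \<in> \<rat>" "b \<in> \<rat>"
  then show "\<exists>a' b'. - (a + b * sqrt 2) = a' + b' * sqrt 2 \<and> a' \<in> \<rat> \<and> b' \<in> \<rat>"
    by (intro exI[of _ "- a"] exI[of _ "- b"]) simp
qed

lift_definition minus_qsqrt2 :: "qsqrt2 \<Rightarrow> qsqrt2 \<Rightarrow> qsqrt2" is "(-)"
proof clarify
  fix a b c d :: real
  assume "a \<in> \<rat>" "b \<in> \<rat>" "c \<in> \<rat>" "d \<in> \<rat>"
  then show "\<exists>a' b'. a + b * sqrt 2 - (c + d * sqrt 2) = a' + b' * sqrt 2 \<and> a' \<in> \<rat> \<and> b' \<in> \<rat>"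
    by (intro exI[of _ "a - c"] exI[of _ "b - d"]) (simp add: algebra_simps)
qed

lift_definition times_qsqrt2 :: "qsqrt2 \<Rightarrow> qsqrt2 \<Rightarrow> qsqrt2" is "(*)"
proof clarify
  fix a b c d :: real
  assume "a \<in> \<rat>" "b \<in> \<rat>" "c \<in> \<rat>" "d \<in> \<rat>"
  then show "\<exists>a' b'. (a + b * sqrt 2) * (c + d * sqrt 2) = a' + b' * sqrt 2 \<and> a' \<in> \<rat> \<and> b' \<in> \<rat>"
    by (intro exI[of _ "a * c + 2 * (b * d)"] exI[of _ "a * d + b * c"])
       (simp add: algebra_simps)
qed

lift_definition inverse_qsqrt2 :: "qsqrt2 \<Rightarrow> qsqrt2" is inverse
proof clarify
  fix a b :: real
  assume ab: "a \<in> \<rat>" "b \<in> \<rat>"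
  show "\<exists>a' b'. inverse (a + b * sqrt 2) = a' + b' * sqrt 2 \<and> a' \<in> \<rat> \<and> b' \<in> \<rat>"
  proof (cases "a - b * sqrt 2 = 0")
    case True
    then have "inverse (a + b * sqrt 2) = inverse (2 * a) + 0 * sqrt 2" by simp
    with ab show ?thesis by (metis Rats_0 Rats_inverse Rats_mult Rats_number_of)
  next
    case False
    have "inverse (a + b * sqrt 2) = (a - b * sqrt 2) / ((a + b * sqrt 2) * (a - b * sqrt 2))"
      using False by (simp add: inverse_eq_divide)
    also have "(a + b * sqrt 2) * (a - b * sqrt 2) = a * a - 2 * (b * b)"
      by (simp add: algebra_simps)
    finally have "inverse (a + b * sqrt 2)
        = a / (a * a - 2 * (b * b)) + (- b / (a * a - 2 * (b * b))) * sqrt 2"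
      by (simp add: diff_divide_distrib)
    moreover have "a / (a * a - 2 * (b * b)) \<in> \<rat>" "- b / (a * a - 2 * (b * b)) \<in> \<rat>"
      using ab by (auto intro!: Rats_divide Rats_diff Rats_mult Rats_minus_iff[THEN iffD2])
    ultimately show ?thesis by blast
  qed
qed

definition divide_qsqrt2 :: "qsqrt2 \<Rightarrow> qsqrt2 \<Rightarrow> qsqrt2" where
  "divide_qsqrt2 x y = x * inverse y"

instance
  by standard (unfold divide_qsqrt2_def, (transfer, simp add: algebra_simps)+)

end

instance qsqrt2 :: field_char_0
proof
  have "Rep_qsqrt2 (of_nat n) = of_nat n" for n
    by (induction n) (simp_all add: zero_qsqrt2.rep_eq one_qsqrt2.rep_eq plus_qsqrt2.rep_eq)
  then show "inj (of_nat :: nat \<Rightarrow> qsqrt2)"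
    by (metis injI of_nat_eq_iff)
qed

lift_definition sqrt2 :: qsqrt2 is "sqrt 2"
  by (rule exI[of _ 0], rule exI[of _ 1]) simp

lemma sqrt2_squared: "sqrt2 * sqrt2 = 2"
proof -
  have "sqrt2 * sqrt2 = 1 + 1" by transfer simp
  then show ?thesis by simp
qed

lemma sqrt2_nonzero: "sqrt2 \<noteq> 0"
  by transfer simp

text \<open>The ring of integers Z[sqrt 2] of K. The field name \<open>mult\<close> is qualified because
  the multiset order of the same name hides it.\<close>

definition OK :: "qsqrt2 ring" where
  "OK = \<lparr>carrier = {of_int a + of_int b * sqrt2 | a b. True},
         monoid.mult = (*), one = 1, zero = 0, add = (+)\<rparr>"

lemma cring_OK: "cring OK"
proof (rule cringI)
  have closed: "x + y \<in> carrier OK" "x * y \<in> carrier OK" "- x \<in> carrier OK"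
    if "x \<in> carrier OK" "y \<in> carrier OK" for x y
  proof -
    from that obtain a b c d :: int
      where x: "x = of_int a + of_int b * sqrt2" and y: "y = of_int c + of_int d * sqrt2"
      by (auto simp: OK_def)
    have "x + y = of_int (a + c) + of_int (b + d) * sqrt2"
      by (simp add: x y algebra_simps)
    then show "x + y \<in> carrier OK" by (auto simp: OK_def simp del: of_int_add)
    have "x * y = of_int a * of_int c + of_int b * of_int d * (sqrt2 * sqrt2)
        + (of_int a * of_int d + of_int b * of_int c) * sqrt2"
      by (simp add: x y algebra_simps)
    also have "\<dots> = of_int (a * c + 2 * (b * d)) + of_int (a * d + b * c) * sqrt2"
      by (simp add: sqrt2_squared)
    finally show "x * y \<in> carrier OK" unfolding OK_def partial_object.simps by blast
    have "- x = of_int (- a) + of_int (- b) * sqrt2" by (simp add: x)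
    then show "- x \<in> carrier OK" by (auto simp: OK_def simp del: of_int_minus)
  qed
  have "0 = of_int 0 + of_int 0 * sqrt2" "1 = of_int 1 + of_int 0 * sqrt2" by simp_all
  then have zero_one: "0 \<in> carrier OK" "1 \<in> carrier OK" unfolding OK_def partial_object.simps by blast+
  have ops: "x \<oplus>\<^bsub>OK\<^esub> y = x + y" "x \<otimes>\<^bsub>OK\<^esub> y = x * y" "\<zero>\<^bsub>OK\<^esub> = 0" "\<one>\<^bsub>OK\<^esub> = 1" for x y
    by (simp_all add: OK_def)
  show "abelian_group OK"
  proof (rule abelian_groupI)
    show "\<exists>y\<in>carrier OK. y \<oplus>\<^bsub>OK\<^esub> x = \<zero>\<^bsub>OK\<^esub>" if "x \<in> carrier OK" for x
      using closed(3)[OF that that] by (auto simp: ops intro!: bexI[of _ "- x"])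
  qed (simp_all add: ops closed zero_one algebra_simps)
  show "Group.comm_monoid OK"
    by (rule comm_monoidI) (simp_all add: ops closed zero_one algebra_simps)
qed (simp add: OK_def algebra_simps)

text \<open>Both embeddings of K into the complex numbers are real, so the following are all the embeddings.\<close>

definition real_embeddings :: "(qsqrt2 \<Rightarrow> real) set" where
  "real_embeddings = {\<sigma>. \<sigma> 1 = 1 \<and> (\<forall>x y. \<sigma> (x + y) = \<sigma> x + \<sigma> y) \<and> (\<forall>x y. \<sigma> (x * y) = \<sigma> x * \<sigma> y)}"

definition totally_positive :: "qsqrt2 \<Rightarrow> bool" where
  "totally_positive \<alpha> \<longleftrightarrow> (\<forall>\<sigma>\<in>real_embeddings. \<sigma> \<alpha> > 0)"

definition absolute_norm :: "qsqrt2 set \<Rightarrow> nat" where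
  "absolute_norm I = order (OK Quot I)"

text \<open>The algebra (-1,-1 / F): \<open>Quat t x y z\<close> stands for \<open>t + x i + y j + z k\<close>.\<close>

datatype 'a quat = Quat 'a 'a 'a 'a

instantiation quat :: (comm_ring_1) ring_1
begin

definition "0 = Quat 0 0 0 0"

definition "1 = Quat 1 0 0 0"

fun plus_quat :: "'a quat \<Rightarrow> 'a quat \<Rightarrow> 'a quat" where
  "Quat t x y z + Quat t' x' y' z' = Quat (t + t') (x + x') (y + y') (z + z')"

fun uminus_quat :: "'a quat \<Rightarrow> 'a quat" where
  "- Quat t x y z = Quat (- t) (- x) (- y) (- z)"

definition minus_quat :: "'a quat \<Rightarrow> 'a quat \<Rightarrow> 'a quat" where
  "p - q = p + - (q :: 'a quat)"

fun times_quat :: "'a quat \<Rightarrow> 'a quat \<Rightarrow> 'a quat" where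
  "Quat t x y z * Quat t' x' y' z' =
     Quat (t * t' - x * x' - y * y' - z * z')
          (t * x' + x * t' + y * z' - z * y')
          (t * y' - x * z' + y * t' + z * x')
          (t * z' + x * y' - y * x' + z * t')"

instance
proof
  fix a b c :: "'a quat"
  show "a + b + c = a + (b + c)" by (cases a; cases b; cases c) (simp add: algebra_simps)
  show "a + b = b + a" by (cases a; cases b) (simp add: algebra_simps)
  show "0 + a = a" by (cases a) (simp add: zero_quat_def)
  show "- a + a = 0" by (cases a) (simp add: zero_quat_def)
  show "a - b = a + - b" by (simp add: minus_quat_def)
  show "a * b * c = a * (b * c)" by (cases a; cases b; cases c) (simp add: algebra_simps)
  show "1 * a = a" by (cases a) (simp add: one_quat_def)
  show "a * 1 = a" by (cases a) (simp add: one_quat_def)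
  show "(a + b) * c = a * c + b * c" by (cases a; cases b; cases c) (simp add: algebra_simps)
  show "a * (b + c) = a * b + a * c" by (cases a; cases b; cases c) (simp add: algebra_simps)
  show "(0 :: 'a quat) \<noteq> 1" by (simp add: zero_quat_def one_quat_def)
qed

end

definition quat_i :: "'a::comm_ring_1 quat" where "quat_i = Quat 0 1 0 0"
definition quat_j :: "'a::comm_ring_1 quat" where "quat_j = Quat 0 0 1 0"
definition quat_k :: "'a::comm_ring_1 quat" where "quat_k = Quat 0 0 0 1"

fun quat_scale :: "'a::comm_ring_1 \<Rightarrow> 'a quat \<Rightarrow> 'a quat"  (infixr "*\<^sub>q" 75) where
  "c *\<^sub>q Quat t x y z = Quat (c * t) (c * x) (c * y) (c * z)"

fun nrd :: "'a::comm_ring_1 quat \<Rightarrow> 'a" where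
  "nrd (Quat t x y z) = t^2 + x^2 + y^2 + z^2"

lemma quat_relations:
  "quat_i * quat_i = - (1 :: 'a::comm_ring_1 quat)"
  "quat_j * quat_j = - (1 :: 'a quat)"
  "quat_i * quat_j = (quat_k :: 'a quat)"
  "quat_j * quat_i = - (quat_k :: 'a quat)"
  by (simp_all add: quat_i_def quat_j_def quat_k_def one_quat_def)

lemma quat_basis:
  "Quat t x y z = t *\<^sub>q 1 + x *\<^sub>q quat_i + y *\<^sub>q quat_j + z *\<^sub>q quat_k"
  by (simp add: quat_i_def quat_j_def quat_k_def one_quat_def)

lemma nrd_conj:
  "Quat t x y z * Quat t (- x) (- y) (- z) = nrd (Quat t x y z) *\<^sub>q 1"
  by (simp add: one_quat_def power2_eq_square algebra_simps)

definition G :: "qsqrt2 quat set" where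
  "G = {a *\<^sub>q 1
        + b *\<^sub>q (2 * sqrt2) *\<^sub>q quat_i
        + c *\<^sub>q (2 *\<^sub>q quat_i + (1 / sqrt2) *\<^sub>q (quat_i + quat_j))
        + d *\<^sub>q (1 / 2) *\<^sub>q ((1 + sqrt2) *\<^sub>q 1 + (3 + sqrt2) *\<^sub>q quat_i + quat_j + quat_k)
       | a b c d. a \<in> carrier OK \<and> b \<in> carrier OK \<and> c \<in> carrier OK \<and> d \<in> carrier OK}"

lemma G_direct:
  assumes "a *\<^sub>q 1 + b *\<^sub>q (2 * sqrt2) *\<^sub>q quat_i
        + c *\<^sub>q (2 *\<^sub>q quat_i + (1 / sqrt2) *\<^sub>q (quat_i + quat_j))
        + d *\<^sub>q (1 / 2) *\<^sub>q ((1 + sqrt2) *\<^sub>q 1 + (3 + sqrt2) *\<^sub>q quat_i + quat_j + quat_k) = 0"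
  shows "a = 0 \<and> b = 0 \<and> c = 0 \<and> d = 0"
  using assms sqrt2_nonzero
  by (auto simp: quat_i_def quat_j_def quat_k_def one_quat_def zero_quat_def)

definition r_G :: "qsqrt2 \<Rightarrow> nat" where
  "r_G \<alpha> = card {q \<in> G. nrd q = \<alpha>}"

end

theory Submission
  imports Defs "HOL-Computational_Algebra.Primes"
begin

text \<open>
  The order \<open>G\<close> is conjugate to an order that lies in a maximal order \<open>O\<close> and contains \<open>2 O\<close>; modulo 2 it is the diagonal
  subring of \<open>O / 2 O \<cong> M\<^sub>2(O\<^sub>K / 2)\<close>. Since \<open>O\<close> is norm-Euclidean, its right ideals are principal. For a prime \<open>p\<close>,
  the \<open>Nm p + 1\<close> right ideals between \<open>p O\<close> and \<open>O\<close> are therefore generated by elements of norm \<open>p\<close>, which gives the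
  Hecke relation \<open>(Nm p + 1) r(x) = r(p x) + Nm p r(x / p)\<close>, where \<open>r\<close> counts the elements of \<open>O\<close> of given norm. The
  divisor sum satisfies the same recursion, so \<open>r(x) = 48 \<sigma>(x)\<close> for odd \<open>x\<close>.

  An element of odd norm is moved into the diagonal order by exactly one of 24 units modulo sign. An element of even norm of
  the diagonal order is divisible by \<open>sqrt 2\<close>, or it has exactly one diagonal entry that is a unit modulo \<open>sqrt 2\<close>. In the
  latter case it has a left factor of norm \<open>2 + sqrt 2\<close> in exactly one of two classes, so that the number of such elements
  doubles whenever the norm is multiplied by \<open>2 + sqrt 2\<close>.
\<close>
section \<open>The ring of integers\<close>

text \<open>The order of the theorem is not maximal, so its one-sided ideals need not be principal,
  and the Hecke argument is run in \<open>Omax\<close> instead. The result is carried down the chain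
  \<open>Omax\<close>, \<open>Eichler2\<close>, \<open>Eichler4\<close>. Multiplication by
  \<open>sqrt2\<close> sends \<open>Omax\<close> into \<open>Eichler2\<close> and
  \<open>Eichler2\<close> into \<open>Eichler4\<close>, so the elements of one order that are
  divisible by \<open>sqrt2\<close> at exponent e are those of the next larger order at exponent e -
  2. Two such steps reach \<open>Omax\<close>; this is why the formula has separate values for e < 4
  and one pattern from e = 4 on. The other obstacle is positivity: nonzero reduced norms are totally
  positive, while \<open>sqrt2\<close> has norm -2. Primes are replaced by totally positive
  associates, and generators of ideals are rescaled to have exactly the required norm. Both rest on
  the unit 1 + sqrt 2 of norm -1. The constant 48 is the number of elements of norm 1 in
  \<open>Omax\<close>: the two in the diagonal order times 24 translates.\<close>

lemma rat_square_neq_2: "(r::rat)^2 \<noteq> 2"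
proof
  assume r2: "r^2 = 2"
  obtain p q where r: "r = of_int p / of_int q" and q: "q > 0" and cop: "coprime p q"
    by (metis quotient_of_div surj_pair quotient_of_denom_pos quotient_of_coprime)
  have "of_int (p^2) = (of_int (2 * q^2) :: rat)"
    using r2 q by (simp add: r power_divide field_simps)
  then have pq: "p^2 = 2 * q^2" unfolding of_int_eq_iff .
  then have "even p" by (metis dvd_triv_left even_power pos2)
  then obtain p' where p': "p = 2 * p'" by blast
  with pq have "q^2 = 2 * p'^2" by (simp add: power2_eq_square)
  then have "even q" by (metis dvd_triv_left even_power pos2)
  with \<open>even p\<close> cop show False by (metis coprime_common_divisor odd_one)
qed

text \<open>Rational coordinates turn identities in K into polynomial identities over the rationals,
  which the simplifier can check.\<close>

definition qs :: "rat \<Rightarrow> rat \<Rightarrow> qsqrt2" where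
  "qs a b = of_rat a + of_rat b * sqrt2"

lemma Rep_of_int: "Rep_qsqrt2 (of_int n) = of_int n"
proof -
  have nat: "Rep_qsqrt2 (of_nat n) = of_nat n" for n
    by (induction n) (simp_all add: zero_qsqrt2.rep_eq one_qsqrt2.rep_eq plus_qsqrt2.rep_eq)
  show ?thesis
    by (cases n) (simp_all add: nat uminus_qsqrt2.rep_eq one_qsqrt2.rep_eq minus_qsqrt2.rep_eq)
qed

lemma Rep_of_rat: "Rep_qsqrt2 (of_rat r) = of_rat r"
proof (cases r)
  case (Fract a b)
  then show ?thesis
    by (simp add: of_rat_rat divide_qsqrt2_def times_qsqrt2.rep_eq inverse_qsqrt2.rep_eq
        Rep_of_int divide_inverse)
qed

lemma Rep_qs: "Rep_qsqrt2 (qs a b) = of_rat a + of_rat b * sqrt 2"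
  by (simp add: qs_def plus_qsqrt2.rep_eq times_qsqrt2.rep_eq sqrt2.rep_eq Rep_of_rat)

lemma qs_add [simp]: "qs a b + qs c d = qs (a + c) (b + d)"
  by (simp add: qs_def of_rat_add algebra_simps)

lemma qs_uminus [simp]: "- qs a b = qs (- a) (- b)"
  by (simp add: qs_def of_rat_minus)

lemma qs_diff [simp]: "qs a b - qs c d = qs (a - c) (b - d)"
  by (simp add: qs_def of_rat_diff algebra_simps)

lemma qs_mult [simp]: "qs a b * qs c d = qs (a * c + 2 * (b * d)) (a * d + b * c)"
proof -
  have "qs a b * qs c d = of_rat a * of_rat c + of_rat b * of_rat d * (sqrt2 * sqrt2)
      + (of_rat a * of_rat d + of_rat b * of_rat c) * sqrt2"
    by (simp add: qs_def algebra_simps)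
  then show ?thesis
    by (simp add: qs_def of_rat_add of_rat_mult sqrt2_squared algebra_simps)
qed

lemma qs_of_int: "of_int m = qs (of_int m) 0" and qs_numeral: "numeral k = qs (numeral k) 0"
  and qs_zero: "0 = qs 0 0" and qs_one: "1 = qs 1 0" and qs_sqrt2: "sqrt2 = qs 0 1"
  by (simp_all add: qs_def)

lemmas qs_consts = qs_of_int qs_numeral qs_zero qs_one qs_sqrt2

text \<open>The product with the conjugate is \<open>a^2 - 2 * b^2\<close>, and its vanishing with
  \<open>b \<noteq> 0\<close> would make 2 a rational square. Uniqueness of the coordinates
  follows.\<close>

lemma qs_eq_zero: "qs a b = 0 \<longleftrightarrow> a = 0 \<and> b = 0"
proof
  assume h: "qs a b = 0"
  have "qs a b * qs a (- b) = 0" by (simp add: h)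
  then have "qs (a^2 - 2 * b^2) 0 = 0" by (simp add: power2_eq_square)
  then have ab: "a^2 = 2 * b^2" by (simp add: qs_def)
  have "b = 0"
  proof (rule ccontr)
    assume "b \<noteq> 0"
    with ab have "(a / b)^2 = 2" by (simp add: power_divide)
    then show False using rat_square_neq_2 by blast
  qed
  with ab show "a = 0 \<and> b = 0" by simp
qed (simp add: qs_def)

lemma qs_inject [simp]: "qs a b = qs c d \<longleftrightarrow> a = c \<and> b = d"
  using qs_eq_zero[of "a - c" "b - d"] by (metis eq_iff_diff_eq_0 qs_diff)

lemma qs_surj: "\<exists>a b. x = qs a b"
proof -
  obtain a b where "Rep_qsqrt2 x = a + b * sqrt 2" "a \<in> \<rat>" "b \<in> \<rat>"
    using Rep_qsqrt2[of x] by auto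
  then obtain a' b' where "Rep_qsqrt2 x = Rep_qsqrt2 (qs a' b')"
    by (auto simp: Rep_qs elim!: Rats_cases)
  then show ?thesis by (metis Rep_qsqrt2_inject)
qed

lemma qs_cases: obtains a b where "x = qs a b"
  using qs_surj by blast

definition ra :: "qsqrt2 \<Rightarrow> rat" where "ra x = (THE a. \<exists>b. x = qs a b)"
definition rb :: "qsqrt2 \<Rightarrow> rat" where "rb x = (THE b. \<exists>a. x = qs a b)"

lemma ra_qs [simp]: "ra (qs a b) = a" and rb_qs [simp]: "rb (qs a b) = b"
  by (simp_all add: ra_def rb_def)

definition conj2 :: "qsqrt2 \<Rightarrow> qsqrt2" where "conj2 x = qs (ra x) (- rb x)"
definition nm :: "qsqrt2 \<Rightarrow> rat" where "nm x = (ra x)^2 - 2 * (rb x)^2"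

lemma conj2_qs [simp]: "conj2 (qs a b) = qs a (- b)" by (simp add: conj2_def)
lemma nm_qs: "nm (qs a b) = a^2 - 2 * b^2" by (simp add: nm_def)

lemma conj2_mult: "conj2 (x * y) = conj2 x * conj2 y"
  by (rule qs_cases[of x]; rule qs_cases[of y]) simp
lemma conj2_add: "conj2 (x + y) = conj2 x + conj2 y"
  by (rule qs_cases[of x]; rule qs_cases[of y]) simp
lemma conj2_conj2 [simp]: "conj2 (conj2 x) = x"
  by (rule qs_cases[of x]) simp
lemma nm_mult: "nm (x * y) = nm x * nm y"
  by (rule qs_cases[of x]; rule qs_cases[of y]) (simp add: nm_qs power2_eq_square algebra_simps)
lemma nm_one [simp]: "nm 1 = 1" by (simp add: qs_one nm_qs)
lemma mult_conj2: "x * conj2 x = of_rat (nm x)"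
  by (rule qs_cases[of x]) (simp add: nm_qs power2_eq_square qs_def[of _ 0, symmetric, simplified])

lemma nm_eq_zero: "nm x = 0 \<longleftrightarrow> x = 0"
proof -
  have "conj2 x = 0 \<longleftrightarrow> x = 0"
    by (rule qs_cases[of x]) (auto simp: qs_eq_zero)
  then have "x * conj2 x = 0 \<longleftrightarrow> x = 0" by simp
  then show ?thesis by (simp add: mult_conj2)
qed

section \<open>Integrality, norms and divisibility in Z[sqrt 2]\<close>

abbreviation Z2 :: "qsqrt2 set" where "Z2 \<equiv> carrier OK"

lemma Z2_iff: "x \<in> Z2 \<longleftrightarrow> (\<exists>a b :: int. x = qs (of_int a) (of_int b))"
  by (auto simp: OK_def qs_def)

lemma Z2_qs [simp]: "qs (of_int a) (of_int b) \<in> Z2" by (auto simp: Z2_iff)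

lemma OK_ops [simp]: "x \<oplus>\<^bsub>OK\<^esub> y = x + y" "x \<otimes>\<^bsub>OK\<^esub> y = x * y" "\<zero>\<^bsub>OK\<^esub> = 0" "\<one>\<^bsub>OK\<^esub> = 1"
  by (simp_all add: OK_def)

lemma Z2_cases:
  assumes "x \<in> Z2" obtains a b :: int where "x = qs (of_int a) (of_int b)"
  using assms by (auto simp: Z2_iff)

lemma Z2_closed [simp]:
  assumes "x \<in> Z2" "y \<in> Z2"
  shows "x + y \<in> Z2" "x * y \<in> Z2" "x - y \<in> Z2"
proof -
  obtain a b c d :: int where "x = qs (of_int a) (of_int b)" "y = qs (of_int c) (of_int d)"
    using assms by (metis Z2_iff)
  moreover have "of_int a * of_int c + 2 * (of_int b * of_int d) = (of_int (a*c+2*(b*d)) :: rat)"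
    "of_int a * of_int d + of_int b * of_int c = (of_int (a*d+b*c) :: rat)" by simp_all
  ultimately show "x + y \<in> Z2" "x * y \<in> Z2" "x - y \<in> Z2"
    by (simp_all flip: of_int_add of_int_diff del: of_int_mult)
qed

lemma Z2_uminus [simp]: "x \<in> Z2 \<Longrightarrow> - x \<in> Z2"
  and Z2_conj2 [simp]: "x \<in> Z2 \<Longrightarrow> conj2 x \<in> Z2"
  by (auto simp: Z2_iff simp flip: of_int_minus)

lemma Z2_consts [simp]: "0 \<in> Z2" "1 \<in> Z2" "sqrt2 \<in> Z2" "of_int n \<in> Z2" "numeral k \<in> Z2"
  using Z2_qs[of 0 0] Z2_qs[of 1 0] Z2_qs[of 0 1] Z2_qs[of n 0] Z2_qs[of "numeral k" 0]
  by (simp_all add: qs_consts)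

lemma Z2_power [simp]: "x \<in> Z2 \<Longrightarrow> x ^ k \<in> Z2"
  by (induction k) auto

text \<open>On \<open>Z2\<close> the norm is an integer, so the floor is exact there
  (\<open>inm_Z2\<close>). The value serves as Euclidean function and as induction measure.\<close>

definition inm :: "qsqrt2 \<Rightarrow> nat" where "inm x = nat \<lfloor>\<bar>nm x\<bar>\<rfloor>"

lemma nm_Z2: assumes "x \<in> Z2" shows "\<exists>k::int. nm x = of_int k"
proof -
  obtain a b where "x = qs (of_int a) (of_int b)" using assms by (rule Z2_cases)
  then have "nm x = of_int (a^2 - 2 * b^2)" by (simp add: nm_qs)
  then show ?thesis by blast
qed

lemma inm_Z2: assumes "x \<in> Z2" shows "of_nat (inm x) = \<bar>nm x\<bar>"
  using nm_Z2[OF assms] by (auto simp: inm_def simp flip: of_int_abs)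

lemma inm_mult: assumes "x \<in> Z2" "y \<in> Z2" shows "inm (x * y) = inm x * inm y"
proof -
  have "of_nat (inm (x * y)) = (of_nat (inm x * inm y) :: rat)"
    using assms by (simp add: inm_Z2 nm_mult abs_mult)
  then show ?thesis by (simp only: of_nat_eq_iff)
qed

lemma inm_eq_zero: "x \<in> Z2 \<Longrightarrow> inm x = 0 \<longleftrightarrow> x = 0"
  using inm_Z2[of x] nm_eq_zero[of x] by (metis abs_eq_0 of_nat_eq_0_iff)

text \<open>The type is a field, in which \<open>dvd\<close> carries no information, so divisibility
  with an integral cofactor needs a relation of its own.\<close>

definition zdvd :: "qsqrt2 \<Rightarrow> qsqrt2 \<Rightarrow> bool"  (infix "zdvd" 50) where
  "d zdvd x \<longleftrightarrow> (\<exists>c\<in>Z2. x = d * c)"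

lemma zdvdI: "c \<in> Z2 \<Longrightarrow> x = d * c \<Longrightarrow> d zdvd x" by (auto simp: zdvd_def)
lemma zdvd_refl [simp]: "x zdvd x" by (rule zdvdI[of 1]) simp_all
lemma zdvd_0 [simp]: "x zdvd 0" by (rule zdvdI[of 0]) simp_all
lemma one_zdvd: "x \<in> Z2 \<Longrightarrow> 1 zdvd x" by (rule zdvdI[of x]) simp_all
lemma zdvd_trans: "a zdvd b \<Longrightarrow> b zdvd c \<Longrightarrow> a zdvd c"
  by (metis (no_types, lifting) zdvd_def mult.assoc Z2_closed(2))
lemma zdvd_add: "a zdvd b \<Longrightarrow> a zdvd c \<Longrightarrow> a zdvd (b + c)"
  by (metis (no_types, lifting) zdvd_def distrib_left Z2_closed(1))
lemma zdvd_diff: "a zdvd b \<Longrightarrow> a zdvd c \<Longrightarrow> a zdvd (b - c)"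
  by (metis (no_types, lifting) zdvd_def right_diff_distrib Z2_closed(3))
lemma zdvd_uminus: "a zdvd b \<Longrightarrow> a zdvd (- b)"
  using zdvd_diff[of a 0 b] by simp
lemma zdvd_mult: "a zdvd b \<Longrightarrow> c \<in> Z2 \<Longrightarrow> a zdvd (b * c)"
  by (metis (no_types, lifting) zdvd_def mult.assoc Z2_closed(2))
lemma zdvd_mult2: "a zdvd b \<Longrightarrow> c \<in> Z2 \<Longrightarrow> a zdvd (c * b)"
  using zdvd_mult by (simp add: mult.commute)
lemma zdvd_triv [simp]: "c \<in> Z2 \<Longrightarrow> a zdvd (a * c)" "c \<in> Z2 \<Longrightarrow> a zdvd (c * a)"
  by (auto simp: zdvd_def)
lemma zdvd_mult_cancel: "c \<noteq> 0 \<Longrightarrow> c * a zdvd c * b \<longleftrightarrow> a zdvd b"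
  by (auto simp: zdvd_def mult.assoc)
lemma zdvd_Z2: "a \<in> Z2 \<Longrightarrow> a zdvd b \<Longrightarrow> b \<in> Z2"
  by (auto simp: zdvd_def)

lemma zdvd_inm: "a \<in> Z2 \<Longrightarrow> a zdvd b \<Longrightarrow> inm a dvd inm b"
  by (auto simp: zdvd_def inm_mult)

lemma unit_iff_inm: assumes "x \<in> Z2" shows "x zdvd 1 \<longleftrightarrow> inm x = 1"
proof
  assume "x zdvd 1"
  then show "inm x = 1" using zdvd_inm[OF assms, of 1] by (simp add: inm_def[of 1])
next
  assume "inm x = 1"
  then have "\<bar>nm x\<bar> = 1" using inm_Z2[OF assms] by simp
  then have "nm x = 1 \<or> nm x = - 1" by linarith
  then have "x * conj2 x = 1 \<or> x * (- conj2 x) = 1" by (auto simp: mult_conj2)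
  then show "x zdvd 1" using assms unfolding zdvd_def by (metis Z2_uminus Z2_conj2)
qed

text \<open>Rounding both coordinates leaves errors u, v of size at most 1/2, and then
  \<open>u^2 - 2 * v^2\<close> lies between -1/2 and 1/4.\<close>

lemma Z2_approx: "\<exists>c\<in>Z2. \<bar>nm (x - c)\<bar> < 1"
proof -
  obtain a b where x: "x = qs a b" by (rule qs_cases)
  define c where "c = qs (of_int (round a)) (of_int (round b))"
  let ?u = "a - of_int (round a)" and ?v = "b - of_int (round b)"
  have "\<bar>?u\<bar> \<le> 1/2" "\<bar>?v\<bar> \<le> 1/2"
    using of_int_round_abs_le[of a] of_int_round_abs_le[of b] by (simp_all add: abs_minus_commute)
  then have "?u^2 \<le> (1/2)^2" "?v^2 \<le> (1/2)^2" by (simp_all add: abs_le_square_iff[symmetric] del: power_divide)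
  moreover have "?u^2 \<ge> 0" "?v^2 \<ge> 0" by simp_all
  ultimately have "\<bar>?u^2 - 2 * ?v^2\<bar> < 1"
    unfolding abs_less_iff power_divide by (simp; linarith)
  moreover have "c \<in> Z2" by (simp add: c_def)
  ultimately show ?thesis by (auto simp: x c_def nm_qs intro!: bexI[of _ c])
qed

lemma Z2_division:
  assumes "x \<in> Z2" "g \<in> Z2" "g \<noteq> 0"
  shows "\<exists>c\<in>Z2. inm (x - g * c) < inm g"
proof -
  obtain c where c: "c \<in> Z2" "\<bar>nm (x / g - c)\<bar> < 1" using Z2_approx by blast
  have "x - g * c = g * (x / g - c)" using assms(3) by (simp add: field_simps)
  then have "\<bar>nm (x - g * c)\<bar> = \<bar>nm g\<bar> * \<bar>nm (x / g - c)\<bar>" by (simp add: nm_mult abs_mult)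
  also have "\<dots> < \<bar>nm g\<bar> * 1"
    using c(2) assms(3) by (intro mult_strict_left_mono) (simp_all add: nm_eq_zero)
  finally have "(of_nat (inm (x - g * c)) :: rat) < of_nat (inm g)"
    using assms c by (simp add: inm_Z2)
  then show ?thesis using c(1) by (auto simp only: of_nat_less_iff)
qed

text \<open>Stated for plain sets so that it serves both the linear combinations in Bezout's
  identity and the ideals of \<open>OK\<close>.\<close>

lemma Z2_principal:
  assumes I: "I \<subseteq> Z2" "\<And>x y. x \<in> I \<Longrightarrow> y \<in> I \<Longrightarrow> x - y \<in> I"
    "\<And>x c. x \<in> I \<Longrightarrow> c \<in> Z2 \<Longrightarrow> x * c \<in> I" and ne: "I \<noteq> {}"
  shows "\<exists>g\<in>I. \<forall>x\<in>I. g zdvd x"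
proof (cases "I \<subseteq> {0}")
  case True
  then show ?thesis using ne by (intro bexI[of _ 0]) auto
next
  case False
  define P where "P g \<longleftrightarrow> g \<in> I \<and> g \<noteq> 0" for g
  obtain g0 where "P g0" using False by (auto simp: P_def)
  then obtain g where g: "P g" and min: "\<And>h. P h \<Longrightarrow> inm g \<le> inm h"
    using ex_has_least_nat[of P g0 inm] by blast
  have "g zdvd x" if x: "x \<in> I" for x
  proof -
    obtain c where c: "c \<in> Z2" "inm (x - g * c) < inm g"
      using Z2_division[of x g] g x I(1) by (auto simp: P_def)
    have "x - g * c \<in> I" using g x c I by (auto simp: P_def)
    then have "x - g * c = 0" using min[of "x - g * c"] c by (auto simp: P_def)
    then show ?thesis using c by (auto simp: zdvd_def)
  qed
  then show ?thesis using g by (auto simp: P_def)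
qed

lemma Z2_bezout:
  assumes "x \<in> Z2" "y \<in> Z2"
  shows "\<exists>g\<in>Z2. \<exists>u\<in>Z2. \<exists>v\<in>Z2. g = x * u + y * v \<and> g zdvd x \<and> g zdvd y"
proof -
  define I where "I = {x * u + y * v | u v. u \<in> Z2 \<and> v \<in> Z2}"
  have "\<exists>g\<in>I. \<forall>x\<in>I. g zdvd x"
  proof (rule Z2_principal)
    show "I \<subseteq> Z2" using assms by (auto simp: I_def)
    show "a - b \<in> I" if "a \<in> I" "b \<in> I" for a b
    proof -
      obtain u v u' v' where uv: "u \<in> Z2" "v \<in> Z2" "u' \<in> Z2" "v' \<in> Z2"
        and ab: "a = x * u + y * v" "b = x * u' + y * v'" using \<open>a \<in> I\<close> \<open>b \<in> I\<close> unfolding I_def mem_Collect_eq by metis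
      have "a - b = x * (u - u') + y * (v - v')" by (simp add: ab algebra_simps)
      then show ?thesis
        using uv unfolding I_def by (intro CollectI exI[of _ "u - u'"] exI[of _ "v - v'"]) simp
    qed
    show "a * c \<in> I" if aI: "a \<in> I" and cZ: "c \<in> Z2" for a c
    proof -
      obtain u v where uv: "u \<in> Z2" "v \<in> Z2" "a = x * u + y * v"
        using aI unfolding I_def mem_Collect_eq by metis
      have "a * c = x * (u * c) + y * (v * c)" unfolding uv(3) by (simp add: algebra_simps)
      then show ?thesis
        using uv(1,2) cZ unfolding I_def by (intro CollectI exI[of _ "u * c"] exI[of _ "v * c"]) simp
    qed
    show "I \<noteq> {}" unfolding I_def using Z2_consts by blast
  qed
  then obtain g u v where g: "u \<in> Z2" "v \<in> Z2" "g = x * u + y * v" "\<forall>x\<in>I. g zdvd x"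
    by (auto simp: I_def)
  have "x * 1 + y * 0 \<in> I" "x * 0 + y * 1 \<in> I" unfolding I_def using Z2_consts by blast+
  then show ?thesis using g assms by (intro bexI[of _ g] bexI[of _ u] bexI[of _ v]) auto
qed

section \<open>Prime elements of Z[sqrt 2]\<close>

definition zprime :: "qsqrt2 \<Rightarrow> bool" where
  "zprime p \<longleftrightarrow> p \<in> Z2 \<and> p \<noteq> 0 \<and> \<not> p zdvd 1 \<and>
     (\<forall>x\<in>Z2. \<forall>y\<in>Z2. p zdvd x * y \<longrightarrow> p zdvd x \<or> p zdvd y)"

lemma zprime_mult: "zprime p \<Longrightarrow> x \<in> Z2 \<Longrightarrow> y \<in> Z2 \<Longrightarrow> p zdvd x * y \<longleftrightarrow> p zdvd x \<or> p zdvd y"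
  using zdvd_mult zdvd_mult2 unfolding zprime_def by metis

text \<open>A nonunit divisor p of least norm is prime. The gcd of p and a is either a unit, and
  Bezout yields that p divides b, or it is a nonunit divisor, which by minimality is associated to
  p, so that p divides a.\<close>

lemma zprime_divisor_ex:
  assumes "x \<in> Z2" "\<not> x zdvd 1"
  shows "x = 0 \<or> (\<exists>p. zprime p \<and> p zdvd x)"
proof (cases "x = 0")
  case False
  define P where "P p \<longleftrightarrow> p \<in> Z2 \<and> p zdvd x \<and> \<not> p zdvd 1" for p
  have "P x" using assms by (simp add: P_def)
  then obtain p where p: "P p" and min: "\<And>q. P q \<Longrightarrow> inm p \<le> inm q"
    using ex_has_least_nat[of P x inm] by blast
  have p0: "p \<noteq> 0" using p False by (auto simp: P_def zdvd_def)
  have "p zdvd b" if ab: "a \<in> Z2" "b \<in> Z2" "p zdvd a * b" "\<not> p zdvd a" for a b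
  proof -
    obtain g u v where g: "g \<in> Z2" "u \<in> Z2" "v \<in> Z2" "g = p * u + a * v" "g zdvd p" "g zdvd a"
      using Z2_bezout[of p a] p ab by (auto simp: P_def)
    have "g zdvd 1"
    proof (rule ccontr)
      assume "\<not> g zdvd 1"
      then have "P g" using g p zdvd_trans by (auto simp: P_def)
      then have le: "inm p \<le> inm g" by (rule min)
      obtain c where c: "c \<in> Z2" "p = g * c" using g(5) unfolding zdvd_def by blast
      have gn: "inm g > 0" using p0 c(2) inm_eq_zero[OF g(1)] by auto
      have "inm g * inm c \<le> inm g * 1" using le c g(1) by (simp add: inm_mult)
      then have "inm c \<le> 1" using gn by simp
      moreover have "inm c \<noteq> 0" using p0 c inm_eq_zero[of c] by auto
      ultimately have "inm c = 1" by linarith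
      then obtain d where d: "d \<in> Z2" "1 = c * d" using unit_iff_inm[of c] c by (auto simp: zdvd_def)
      have "g = p * d" using d c by (simp add: mult.assoc)
      then have "p zdvd a" using g(6) d zdvd_trans zdvd_triv by metis
      then show False using ab by simp
    qed
    then obtain d where d: "d \<in> Z2" "1 = g * d" by (auto simp: zdvd_def)
    have "p * (u * b * d) + (a * b) * (v * d) = g * d * b" unfolding g(4) by (simp add: algebra_simps)
    also have "\<dots> = b" unfolding d(2)[symmetric] by simp
    finally have e: "p * (u * b * d) + (a * b) * (v * d) = b" .
    have "p zdvd p * (u * b * d)" "p zdvd (a * b) * (v * d)"
      using ab(1-3) d(1) g(2,3) by (simp_all add: zdvd_mult)
    from zdvd_add[OF this] show ?thesis unfolding e .
  qed
  then have "zprime p" using p p0 unfolding zprime_def P_def by blast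
  then show ?thesis using p by (auto simp: P_def)
qed simp

lemma zprime_inverse:
  assumes "zprime p" "x \<in> Z2" "\<not> p zdvd x"
  shows "\<exists>y\<in>Z2. p zdvd x * y - 1"
proof -
  have pZ: "p \<in> Z2" using assms by (simp add: zprime_def)
  obtain g u v where g: "g \<in> Z2" "u \<in> Z2" "v \<in> Z2" "g = p * u + x * v" "g zdvd p" "g zdvd x"
    using Z2_bezout[of p x] pZ assms by blast
  obtain c where c: "c \<in> Z2" "p = g * c" using g(5) unfolding zdvd_def by blast
  have "\<not> p zdvd g" using g assms zdvd_trans by blast
  then have "p zdvd c" using zprime_mult[OF assms(1) g(1) c(1)] c(2) zdvd_refl by metis
  then obtain d where d: "d \<in> Z2" "c = p * d" by (auto simp: zdvd_def)
  then have "p * 1 = p * (g * d)" by (metis c(2) mult.left_commute mult_1_right)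
  then have gd: "1 = g * d" using assms(1) unfolding zprime_def mult_cancel_left by blast
  have "x * (v * d) - 1 = p * (- (u * d))" by (subst gd) (simp add: g(4) algebra_simps)
  then have "p zdvd x * (v * d) - 1" using g(2) d(1) by (intro zdvdI[of "- (u * d)"]) simp_all
  then show ?thesis using g(3) d(1) Z2_closed(2) by blast
qed

section \<open>Residue systems and divisor sums\<close>

interpretation OK: cring OK by (rule cring_OK)

abbreviation zideal :: "qsqrt2 \<Rightarrow> qsqrt2 set" where
  "zideal d \<equiv> PIdl\<^bsub>OK\<^esub> d"

definition residue_class :: "qsqrt2 \<Rightarrow> qsqrt2 \<Rightarrow> qsqrt2 set" where
  "residue_class d x = {y \<in> Z2. d zdvd y - x}"

definition zindex :: "qsqrt2 \<Rightarrow> nat" where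
  "zindex d = card (residue_class d ` Z2)"

text \<open>Representatives of the residue classes. They compute the index of an ideal and later
  list the points of a projective line over a residue field.\<close>

definition residue_system :: "qsqrt2 \<Rightarrow> qsqrt2 set \<Rightarrow> bool" where
  "residue_system d D \<longleftrightarrow> D \<subseteq> Z2 \<and> (\<forall>x\<in>Z2. \<exists>!c. c \<in> D \<and> d zdvd x - c)"

lemma residue_class_eq_iff:
  assumes "x \<in> Z2" "y \<in> Z2"
  shows "residue_class d x = residue_class d y \<longleftrightarrow> d zdvd x - y"
proof
  assume "residue_class d x = residue_class d y"
  moreover have "x \<in> residue_class d x" using assms by (simp add: residue_class_def)
  ultimately show "d zdvd x - y" by (simp add: residue_class_def)
next
  assume h: "d zdvd x - y"
  have "d zdvd z - x \<longleftrightarrow> d zdvd z - y" for z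
    using zdvd_add[of d "z - x" "x - y"] zdvd_diff[of d "z - y" "x - y"] h by auto
  then show "residue_class d x = residue_class d y" by (auto simp: residue_class_def)
qed

lemma residue_system_unique:
  assumes "residue_system d D" "a \<in> D" "b \<in> D" "d zdvd a - b"
  shows "a = b"
proof -
  have "\<exists>!c. c \<in> D \<and> d zdvd a - c" using assms(1,2) by (auto simp: residue_system_def)
  moreover have "d zdvd a - a" by simp
  ultimately show ?thesis using assms by blast
qed

lemma residue_system_cases:
  assumes "residue_system d D" "x \<in> Z2"
  obtains c where "c \<in> D" "d zdvd x - c"
  using assms by (auto simp: residue_system_def)

lemma residue_systemI:
  assumes "D \<subseteq> Z2" "\<And>x. x \<in> Z2 \<Longrightarrow> \<exists>c\<in>D. d zdvd x - c"
    "\<And>a b. a \<in> D \<Longrightarrow> b \<in> D \<Longrightarrow> d zdvd a - b \<Longrightarrow> a = b"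
  shows "residue_system d D"
  unfolding residue_system_def
proof (intro conjI ballI)
  fix x assume "x \<in> Z2"
  then obtain c where c: "c \<in> D" "d zdvd x - c" using assms(2) by blast
  show "\<exists>!c. c \<in> D \<and> d zdvd x - c"
  proof (rule ex1I[of _ c])
    fix b assume "b \<in> D \<and> d zdvd x - b"
    then show "b = c" using assms(3)[of b c] c zdvd_diff[of d "x - c" "x - b"] by simp
  qed (use c in blast)
qed (rule assms(1))

lemma residue_system_bij:
  assumes "residue_system d D"
  shows "bij_betw (residue_class d) D (residue_class d ` Z2)"
  unfolding bij_betw_def
proof
  have D: "D \<subseteq> Z2" using assms by (auto simp: residue_system_def)
  show "inj_on (residue_class d) D"
    using D residue_system_unique[OF assms] residue_class_eq_iff by (intro inj_onI) blast
  show "residue_class d ` D = residue_class d ` Z2"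
  proof
    show "residue_class d ` Z2 \<subseteq> residue_class d ` D"
    proof (rule image_subsetI)
      fix x assume x: "x \<in> Z2"
      then obtain c where "c \<in> D" "d zdvd x - c" using residue_system_cases[OF assms] by blast
      then show "residue_class d x \<in> residue_class d ` D"
        using x D residue_class_eq_iff[of x c d] by auto
    qed
  qed (use D in blast)
qed

lemma residue_system_card: "residue_system d D \<Longrightarrow> card D = zindex d"
  unfolding zindex_def by (rule bij_betw_same_card[OF residue_system_bij])

lemma residue_system_ex: "\<exists>D. residue_system d D"
proof -
  define r where "r C = (SOME x. x \<in> C)" for C :: "qsqrt2 set"
  have r: "r (residue_class d x) \<in> Z2 \<and> d zdvd r (residue_class d x) - x" if "x \<in> Z2" for x
  proof -
    have "x \<in> residue_class d x" using that by (simp add: residue_class_def)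
    then have "r (residue_class d x) \<in> residue_class d x" unfolding r_def by (rule someI)
    then show ?thesis by (simp add: residue_class_def)
  qed
  have "residue_system d (r ` residue_class d ` Z2)"
    unfolding residue_system_def
  proof (intro conjI ballI)
    show "r ` residue_class d ` Z2 \<subseteq> Z2" using r by blast
    fix x assume x: "x \<in> Z2"
    show "\<exists>!c. c \<in> r ` residue_class d ` Z2 \<and> d zdvd x - c"
    proof (rule ex1I[of _ "r (residue_class d x)"])
      show "r (residue_class d x) \<in> r ` residue_class d ` Z2 \<and> d zdvd x - r (residue_class d x)"
        using x r[OF x] zdvd_uminus[of d "r (residue_class d x) - x"] by simp
      fix c assume c: "c \<in> r ` residue_class d ` Z2 \<and> d zdvd x - c"
      then obtain y where y: "y \<in> Z2" "c = r (residue_class d y)" by blast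
      have "d zdvd (x - c) + (c - y)" using c r[OF y(1)] y(2) by (intro zdvd_add) simp_all
      then have "residue_class d x = residue_class d y" using x y by (simp add: residue_class_eq_iff)
      then show "c = r (residue_class d x)" using y by simp
    qed
  qed
  then show ?thesis ..
qed

text \<open>Two-digit expansion: a residue modulo \<open>d * e\<close> has a last digit modulo
  \<open>d\<close> and a leading digit modulo \<open>e\<close>. The index is therefore
  multiplicative.\<close>

lemma residue_system_mult:
  assumes D: "residue_system d D" and E: "residue_system e E" and d: "d \<in> Z2" "d \<noteq> 0" and e: "e \<in> Z2"
  shows "residue_system (d * e) ((\<lambda>(a, b). a + d * b) ` (D \<times> E))"
    and "inj_on (\<lambda>(a, b). a + d * b) (D \<times> E)"
proof -
  have DZ: "D \<subseteq> Z2" and EZ: "E \<subseteq> Z2" using D E by (auto simp: residue_system_def)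
  have uniq: "a = a' \<and> b = b'"
    if ab: "a \<in> D" "b \<in> E" "a' \<in> D" "b' \<in> E" and h: "d * e zdvd (a + d * b) - (a' + d * b')"
    for a b a' b'
  proof -
    have bZ: "b \<in> Z2" "b' \<in> Z2" using ab EZ by auto
    have "d zdvd (a + d * b) - (a' + d * b')" using h zdvd_trans zdvd_triv(1) e by blast
    moreover have "d zdvd d * (b - b')" using bZ by simp
    ultimately have "d zdvd ((a + d * b) - (a' + d * b')) - d * (b - b')" by (rule zdvd_diff)
    then have "d zdvd a - a'" by (simp add: algebra_simps)
    then have aa: "a = a'" using residue_system_unique[OF D] ab by blast
    then have "d * e zdvd d * (b - b')" using h by (simp add: algebra_simps)
    then have "e zdvd b - b'" using d by (simp add: zdvd_mult_cancel)
    then show ?thesis using residue_system_unique[OF E] ab aa by blast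
  qed
  show "inj_on (\<lambda>(a, b). a + d * b) (D \<times> E)"
    using uniq by (intro inj_onI) fastforce
  show "residue_system (d * e) ((\<lambda>(a, b). a + d * b) ` (D \<times> E))"
  proof (rule residue_systemI)
    show "(\<lambda>(a, b). a + d * b) ` (D \<times> E) \<subseteq> Z2" using DZ EZ d(1) by (force dest: subsetD)
    fix x assume x: "x \<in> Z2"
    obtain a where a: "a \<in> D" "d zdvd x - a" using residue_system_cases[OF D x] .
    then obtain y where y: "y \<in> Z2" "x - a = d * y" by (auto simp: zdvd_def)
    obtain b where b: "b \<in> E" "e zdvd y - b" using residue_system_cases[OF E y(1)] .
    then obtain z where z: "z \<in> Z2" "y - b = e * z" by (auto simp: zdvd_def)
    have "x - (a + d * b) = d * (y - b)" using y(2) by (simp add: algebra_simps)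
    then have "d * e zdvd x - (a + d * b)" using z by (intro zdvdI[of z]) (simp_all add: mult.assoc)
    then show "\<exists>c\<in>(\<lambda>(a, b). a + d * b) ` (D \<times> E). d * e zdvd x - c" using a b by force
  next
    fix s t assume "s \<in> (\<lambda>(a, b). a + d * b) ` (D \<times> E)" "t \<in> (\<lambda>(a, b). a + d * b) ` (D \<times> E)"
      "d * e zdvd s - t"
    then show "s = t" using uniq by auto
  qed
qed

lemma zindex_mult: "d \<in> Z2 \<Longrightarrow> d \<noteq> 0 \<Longrightarrow> e \<in> Z2 \<Longrightarrow> zindex (d * e) = zindex d * zindex e"
proof -
  assume de: "d \<in> Z2" "d \<noteq> 0" "e \<in> Z2"
  obtain D E where DE: "residue_system d D" "residue_system e E" using residue_system_ex by metis
  have "zindex (d * e) = card ((\<lambda>(a, b). a + d * b) ` (D \<times> E))"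
    using residue_system_mult(1)[OF DE de] by (rule residue_system_card[symmetric])
  also have "\<dots> = card D * card E"
    using residue_system_mult(2)[OF DE de] by (simp add: card_image card_cartesian_product)
  finally show ?thesis using DE by (simp add: residue_system_card)
qed

lemma zindex_of_int:
  assumes "n \<noteq> 0" shows "zindex (of_int n) = nat \<bar>n\<bar> ^ 2"
proof -
  let ?f = "\<lambda>(a::int, b::int). qs (of_int a) (of_int b)"
  have dvd: "of_int n zdvd qs (of_int a) (of_int b) \<longleftrightarrow> n dvd a \<and> n dvd b" for a b
  proof
    assume "of_int n zdvd qs (of_int a) (of_int b)"
    then obtain c d :: int where "qs (of_int a) (of_int b) = of_int n * qs (of_int c) (of_int d)"
      unfolding zdvd_def by (metis Z2_iff)
    then have "a = n * c" "b = n * d" by (simp_all add: qs_of_int flip: of_int_mult)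
    then show "n dvd a \<and> n dvd b" by simp
  next
    assume "n dvd a \<and> n dvd b"
    then obtain c d where "a = n * c" "b = n * d" by (auto elim!: dvdE)
    then show "of_int n zdvd qs (of_int a) (of_int b)"
      by (intro zdvdI[of "qs (of_int c) (of_int d)"]) (simp_all add: qs_of_int)
  qed
  have "residue_system (of_int n) (?f ` ({0..<\<bar>n\<bar>} \<times> {0..<\<bar>n\<bar>}))"
  proof (rule residue_systemI)
    fix x assume "x \<in> Z2"
    then obtain a b where x: "x = qs (of_int a) (of_int b)" by (rule Z2_cases)
    have "of_int n zdvd x - ?f (a mod \<bar>n\<bar>, b mod \<bar>n\<bar>)"
    proof -
      have "n dvd a - a mod \<bar>n\<bar>" "n dvd b - b mod \<bar>n\<bar>" by (metis abs_dvd_iff dvd_minus_mod)+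
      then show ?thesis using dvd[of "a - a mod \<bar>n\<bar>" "b - b mod \<bar>n\<bar>"] by (simp add: x)
    qed
    moreover have "(a mod \<bar>n\<bar>, b mod \<bar>n\<bar>) \<in> {0..<\<bar>n\<bar>} \<times> {0..<\<bar>n\<bar>}" using assms by simp
    ultimately show "\<exists>c\<in>?f ` ({0..<\<bar>n\<bar>} \<times> {0..<\<bar>n\<bar>}). of_int n zdvd x - c" by blast
  next
    fix s t assume "s \<in> ?f ` ({0..<\<bar>n\<bar>} \<times> {0..<\<bar>n\<bar>})" "t \<in> ?f ` ({0..<\<bar>n\<bar>} \<times> {0..<\<bar>n\<bar>})"
      and d: "of_int n zdvd s - t"
    then obtain a b a' b' where s: "s = ?f (a, b)" "t = ?f (a', b')" and
      r: "0 \<le> a" "a < \<bar>n\<bar>" "0 \<le> b" "b < \<bar>n\<bar>" "0 \<le> a'" "a' < \<bar>n\<bar>" "0 \<le> b'" "b' < \<bar>n\<bar>"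
      by auto
    have "n dvd a - a'" "n dvd b - b'" using d dvd[of "a - a'" "b - b'"] by (simp_all add: s)
    moreover have "\<bar>a - a'\<bar> < \<bar>n\<bar>" "\<bar>b - b'\<bar> < \<bar>n\<bar>" using r by linarith+
    ultimately have "a = a'" "b = b'"
      using dvd_imp_le_int[of "a - a'" n] dvd_imp_le_int[of "b - b'" n] by auto
    then show "s = t" by (simp add: s)
  qed auto
  then have "zindex (of_int n) = card (?f ` ({0..<\<bar>n\<bar>} \<times> {0..<\<bar>n\<bar>}))"
    by (simp add: residue_system_card)
  also have "\<dots> = card ({0..<\<bar>n\<bar>} \<times> {0..<\<bar>n\<bar>})"
    by (rule card_image) (auto simp: inj_on_def)
  finally show ?thesis by (simp add: card_cartesian_product power2_eq_square)
qed

lemma conj2_diff: "conj2 (x - y) = conj2 x - conj2 y"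
  by (rule qs_cases[of x]; rule qs_cases[of y]) simp

lemma zdvd_conj2: "d zdvd x \<Longrightarrow> conj2 d zdvd conj2 x"
  by (auto simp: zdvd_def conj2_mult)

lemma zindex_conj2: "zindex (conj2 d) = zindex d"
proof -
  obtain D where D: "residue_system d D" using residue_system_ex by blast
  then have DZ: "D \<subseteq> Z2" by (simp add: residue_system_def)
  have "residue_system (conj2 d) (conj2 ` D)"
  proof (rule residue_systemI)
    show "conj2 ` D \<subseteq> Z2" using DZ by auto
    fix x assume "x \<in> Z2"
    then obtain c where "c \<in> D" "d zdvd conj2 x - c" using residue_system_cases[OF D, of "conj2 x"] by auto
    then show "\<exists>c\<in>conj2 ` D. conj2 d zdvd x - c" using zdvd_conj2[of d "conj2 x - c"] by (auto simp: conj2_diff)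
  next
    fix s t assume st: "s \<in> conj2 ` D" "t \<in> conj2 ` D" "conj2 d zdvd s - t"
    then have "d zdvd conj2 s - conj2 t" using zdvd_conj2[of "conj2 d" "s - t"] by (simp add: conj2_diff)
    moreover have "conj2 s \<in> D" "conj2 t \<in> D" using st by auto
    ultimately have "conj2 s = conj2 t" using residue_system_unique[OF D] by blast
    then show "s = t" by (metis conj2_conj2)
  qed
  then have "zindex (conj2 d) = card (conj2 ` D)" by (simp add: residue_system_card)
  also have "\<dots> = card D" by (rule card_image) (metis conj2_conj2 inj_onI)
  finally show ?thesis using residue_system_card[OF D] by simp
qed

text \<open>The product \<open>d * conj2 d\<close> is a rational integer k, whose index is k^2, and
  conjugate elements have the same index. Hence the square of \<open>zindex d\<close> is
  k^2.\<close>

lemma zindex_eq_inm: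
  assumes d: "d \<in> Z2" "d \<noteq> 0" shows "zindex d = inm d"
proof -
  obtain k :: int where k: "nm d = of_int k" using nm_Z2[OF d(1)] by blast
  have k0: "k \<noteq> 0" using d k nm_eq_zero[of d] by auto
  have "zindex d * zindex d = zindex (d * conj2 d)" using d by (simp add: zindex_mult zindex_conj2)
  also have "\<dots> = nat \<bar>k\<bar> ^ 2" using k0 by (simp add: mult_conj2 k zindex_of_int)
  also have "nat \<bar>k\<bar> = inm d" by (simp add: inm_def k flip: of_int_abs)
  finally show ?thesis by (simp add: power2_eq_square[symmetric])
qed

section \<open>Ideals of the ring of integers, their divisibility and norm\<close>

lemma zideal_eq: "d \<in> Z2 \<Longrightarrow> zideal d = {x. d zdvd x}"
  by (auto simp: cgenideal_def zdvd_def mult.commute)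

lemma ideal_OK_iff: "ideal I OK \<longleftrightarrow> (\<exists>d\<in>Z2. I = zideal d)"
proof
  assume I: "ideal I OK"
  interpret ideal I OK by (rule I)
  have "\<exists>g\<in>I. \<forall>x\<in>I. g zdvd x"
  proof (rule Z2_principal)
    show "I \<subseteq> Z2" by (rule a_subset)
    show "x * c \<in> I" if "x \<in> I" "c \<in> Z2" for x c using I_r_closed[OF that] by simp
    show "x - y \<in> I" if "x \<in> I" "y \<in> I" for x y
    proof -
      have "y * (-1) \<in> I" using I_r_closed[OF that(2), of "-1"] by simp
      then show ?thesis using a_closed[OF that(1), of "y * (-1)"] by simp
    qed
    show "I \<noteq> {}" using zero_closed by auto
  qed
  then obtain g where g: "g \<in> I" "\<forall>x\<in>I. g zdvd x" by blast
  then have gZ: "g \<in> Z2" using a_subset by blast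
  have "I = zideal g"
    using g I_r_closed[OF g(1)] by (auto simp: zideal_eq[OF gZ] zdvd_def)
  then show "\<exists>d\<in>Z2. I = zideal d" using gZ by blast
qed (auto intro: OK.cgenideal_ideal)

text \<open>Divisibility in the monoid of ideals asks for a cofactor ideal. A product lies in each
  factor, which gives one direction; for the other the cofactor is the principal ideal of the
  quotient.\<close>

lemma zideal_divides_iff:
  assumes "d \<in> Z2" "x \<in> Z2"
  shows "zideal d divides\<^bsub>ideals_set OK\<^esub> zideal x \<longleftrightarrow> d zdvd x"
proof
  assume "zideal d divides\<^bsub>ideals_set OK\<^esub> zideal x"
  then obtain J where J: "ideal J OK" "zideal x = ideal_prod OK (zideal d) J"
    by (auto simp: factor_def ideals_set_def)
  have "zideal x \<subseteq> zideal d"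
    using OK.ideal_prod_inter[OF OK.cgenideal_ideal[OF assms(1)] J(1)] J(2) by auto
  then show "d zdvd x" using zdvd_refl[of x] unfolding zideal_eq[OF assms(1)] zideal_eq[OF assms(2)] by blast
next
  assume "d zdvd x"
  then obtain c where c: "c \<in> Z2" "x = d * c" by (auto simp: zdvd_def)
  have "zideal x = ideal_prod OK (zideal d) (zideal c)"
  proof
    show "zideal x \<subseteq> ideal_prod OK (zideal d) (zideal c)"
    proof
      fix z assume "z \<in> zideal x"
      then obtain b where "b \<in> Z2" "z = d * (c * b)"
        using assms c by (auto simp: zideal_eq zdvd_def mult.assoc)
      then show "z \<in> ideal_prod OK (zideal d) (zideal c)"
        using ideal_prod.prod[of d "zideal d" "c * b" "zideal c" OK] assms c
        by (simp add: zideal_eq)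
    qed
    show "ideal_prod OK (zideal d) (zideal c) \<subseteq> zideal x"
    proof
      fix z assume "z \<in> ideal_prod OK (zideal d) (zideal c)"
      then show "z \<in> zideal x"
      proof induction
        case (prod i j)
        then obtain u v where uv: "u \<in> Z2" "i = d * u" "v \<in> Z2" "j = c * v"
          using assms c by (auto simp: zideal_eq zdvd_def)
        then have "i * j = x * (u * v)" unfolding c(2) by (simp only: ac_simps)
        then have "x zdvd i * j" using uv(1,3) by (intro zdvdI[of "u * v"]) simp_all
        then show ?case using assms(2) by (simp add: zideal_eq)
      next
        case (sum s1 s2)
        then show ?case using assms(2) by (simp add: zideal_eq zdvd_add)
      qed
    qed
  qed
  then show "zideal d divides\<^bsub>ideals_set OK\<^esub> zideal x"
    using OK.cgenideal_ideal[OF c(1)] by (auto simp: factor_def ideals_set_def)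
qed

lemma absolute_norm_zideal:
  assumes d: "d \<in> Z2" "d \<noteq> 0" shows "absolute_norm (zideal d) = inm d"
proof -
  have "zideal d +>\<^bsub>OK\<^esub> x = residue_class d x" if "x \<in> Z2" for x
  proof -
    have "y \<in> zideal d +>\<^bsub>OK\<^esub> x \<longleftrightarrow> y \<in> residue_class d x" for y
    proof -
      have "y \<in> zideal d +>\<^bsub>OK\<^esub> x \<longleftrightarrow> (\<exists>h. d zdvd h \<and> y = h + x)"
        by (auto simp: a_r_coset_def' zideal_eq[OF d(1)])
      also have "\<dots> \<longleftrightarrow> d zdvd y - x" by (metis add_diff_cancel diff_add_cancel)
      finally show ?thesis
        using zdvd_Z2[OF d(1), of "y - x"] that Z2_closed(1)[of "y - x" x] by (auto simp: residue_class_def)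
    qed
    then show ?thesis by blast
  qed
  then have "a_rcosets\<^bsub>OK\<^esub> (zideal d) = residue_class d ` Z2"
    by (auto simp: A_RCOSETS_def')
  then show ?thesis
    using zindex_eq_inm[OF d] by (simp add: absolute_norm_def order_def FactRing_def zindex_def)
qed

text \<open>Taking the image under \<open>zideal\<close> identifies associated divisors, so each
  ideal occurs once.\<close>

definition odd_ideal_divisors :: "qsqrt2 \<Rightarrow> qsqrt2 set set" where
  "odd_ideal_divisors x = zideal ` {d \<in> Z2. d zdvd x \<and> \<not> sqrt2 zdvd d}"

definition odd_sigma :: "qsqrt2 \<Rightarrow> nat" where
  "odd_sigma x = (\<Sum>I\<in>odd_ideal_divisors x. absolute_norm I)"

lemma sqrt2_zdvd_qs: "sqrt2 zdvd qs (of_int a) (of_int b) \<longleftrightarrow> even a"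
proof
  assume "sqrt2 zdvd qs (of_int a) (of_int b)"
  then obtain c d :: int where "qs (of_int a) (of_int b) = sqrt2 * qs (of_int c) (of_int d)"
    unfolding zdvd_def by (metis Z2_iff)
  then have "(of_int a :: rat) = of_int (2 * d)" by (simp add: qs_sqrt2)
  then show "even a" unfolding of_int_eq_iff by simp
next
  assume "even a"
  then obtain c where "a = 2 * c" by blast
  then show "sqrt2 zdvd qs (of_int a) (of_int b)"
    by (intro zdvdI[of "qs (of_int b) (of_int c)"]) (simp_all add: qs_sqrt2)
qed

lemma zprime_sqrt2: "zprime sqrt2"
  unfolding zprime_def
proof (intro conjI ballI impI)
  show "\<not> sqrt2 zdvd 1" using sqrt2_zdvd_qs[of 1 0] by (simp add: qs_one)
  fix x y assume "x \<in> Z2" "y \<in> Z2" and xy: "sqrt2 zdvd x * y"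
  then obtain a b c d :: int where v: "x = qs (of_int a) (of_int b)" "y = qs (of_int c) (of_int d)"
    by (metis Z2_iff)
  have "x * y = qs (of_int (a * c + 2 * (b * d))) (of_int (a * d + b * c))" by (simp add: v)
  then have "even (a * c + 2 * (b * d))" using xy sqrt2_zdvd_qs[of "a * c + 2 * (b * d)"] by metis
  then show "sqrt2 zdvd x \<or> sqrt2 zdvd y" by (simp add: v sqrt2_zdvd_qs)
qed (simp_all add: sqrt2_nonzero)

lemma zdvd_coprime_prime:
  assumes p: "zprime p" and d: "d \<in> Z2" "\<not> p zdvd d" and x: "x \<in> Z2" and dv: "d zdvd p * x"
  shows "d zdvd x"
proof -
  have pZ: "p \<in> Z2" "p \<noteq> 0" using p by (simp_all add: zprime_def)
  obtain c where c: "c \<in> Z2" "p * x = d * c" using dv by (auto simp: zdvd_def)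
  then have "p zdvd d * c" using x by (metis zdvd_triv(1))
  then have "p zdvd c" using zprime_mult[OF p d(1) c(1)] d(2) by blast
  then obtain e where e: "e \<in> Z2" "c = p * e" by (auto simp: zdvd_def)
  have "p * x = p * (d * e)" using c(2) e(2) by (simp add: mult.left_commute)
  then show ?thesis using pZ e(1) by simp
qed

lemma zideal_mult_image: "p \<in> Z2 \<Longrightarrow> d \<in> Z2 \<Longrightarrow> zideal (p * d) = (*) p ` (zideal d)"
  by (auto simp: zideal_eq zdvd_def mult.assoc)

lemma finite_residue_classes:
  assumes "x \<in> Z2" "x \<noteq> 0" shows "finite (residue_class x ` Z2)"
proof (rule card_ge_0_finite)
  have "inm x \<noteq> 0" using assms by (simp add: inm_eq_zero)
  then show "card (residue_class x ` Z2) > 0"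
    using zindex_eq_inm[OF assms] by (simp add: zindex_def)
qed

text \<open>An ideal dividing \<open>x\<close> contains \<open>x\<close>, hence is a union of
  residue classes modulo \<open>x\<close>, of which there are finitely many.\<close>

lemma finite_odd_ideal_divisors:
  assumes x: "x \<in> Z2" "x \<noteq> 0" shows "finite (odd_ideal_divisors x)"
proof (rule finite_subset)
  show "odd_ideal_divisors x \<subseteq> Union ` Pow (residue_class x ` Z2)"
  proof
    fix I assume "I \<in> odd_ideal_divisors x"
    then obtain d where d: "d \<in> Z2" "d zdvd x" "I = zideal d" by (auto simp: odd_ideal_divisors_def)
    have IZ: "I \<subseteq> Z2" using d zdvd_Z2 by (auto simp: zideal_eq)
    have "I = \<Union> (residue_class x ` I)"
    proof
      show "I \<subseteq> \<Union> (residue_class x ` I)" using IZ by (auto simp: residue_class_def)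
      show "\<Union> (residue_class x ` I) \<subseteq> I"
      proof clarify
        fix y z assume "y \<in> I" "z \<in> residue_class x y"
        then have "d zdvd (z - y) + y"
          using d zdvd_trans[of d x "z - y"] by (intro zdvd_add) (auto simp: residue_class_def zideal_eq)
        then show "z \<in> I" using d by (simp add: zideal_eq)
      qed
    qed
    then show "I \<in> Union ` Pow (residue_class x ` Z2)" using IZ by blast
  qed
qed (use finite_residue_classes[OF x] in simp)

text \<open>The divisors prime to \<open>p\<close> do not change when a factor \<open>p\<close> is added, and the others are
  \<open>p\<close> times a divisor of the cofactor.\<close>

lemma odd_sigma_prime_step:
  assumes p: "zprime p" "\<not> sqrt2 zdvd p" and x: "x \<in> Z2" "x \<noteq> 0"
  defines "T \<equiv> \<lambda>y. (\<Sum>I\<in>zideal ` {d \<in> Z2. d zdvd y \<and> \<not> sqrt2 zdvd d \<and> \<not> p zdvd d}. absolute_norm I)"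
  shows "odd_sigma (p * x) = inm p * odd_sigma x + T x"
    and "T (p * x) = T x"
    and "\<not> p zdvd x \<Longrightarrow> odd_sigma x = T x"
proof -
  have pZ: "p \<in> Z2" "p \<noteq> 0" using p by (simp_all add: zprime_def)
  let ?A = "\<lambda>y. {d \<in> Z2. d zdvd y \<and> \<not> sqrt2 zdvd d \<and> \<not> p zdvd d}"
  have A: "?A (p * x) = ?A x" using zdvd_coprime_prime[OF p(1) _ _ x(1)] zdvd_mult2 pZ(1) by blast
  then show "T (p * x) = T x" by (simp add: T_def)
  show "odd_sigma x = T x" if np: "\<not> p zdvd x"
  proof -
    have "{d \<in> Z2. d zdvd x \<and> \<not> sqrt2 zdvd d} = ?A x" using np zdvd_trans by blast
    then show ?thesis by (simp add: T_def odd_sigma_def odd_ideal_divisors_def)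
  qed
  have B: "{d \<in> Z2. d zdvd p * x \<and> \<not> sqrt2 zdvd d}
      = ?A x \<union> (*) p ` {d \<in> Z2. d zdvd x \<and> \<not> sqrt2 zdvd d}" (is "?L = _ \<union> ?R")
  proof
    show "?L \<subseteq> ?A x \<union> ?R"
    proof
      fix d assume d: "d \<in> ?L"
      show "d \<in> ?A x \<union> ?R"
      proof (cases "p zdvd d")
        case True
        then obtain c where c: "c \<in> Z2" "d = p * c" by (auto simp: zdvd_def)
        then have "c zdvd x" using d pZ by (simp add: zdvd_mult_cancel)
        moreover have "\<not> sqrt2 zdvd c" using d c pZ zdvd_mult2 by blast
        ultimately show ?thesis using c by blast
      next
        case False
        then show ?thesis using d A by blast
      qed
    qed
    have "\<not> sqrt2 zdvd p * c" if "c \<in> Z2" "\<not> sqrt2 zdvd c" for c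
      using that zprime_mult[OF zprime_sqrt2 pZ(1)] p(2) by blast
    then have "?R \<subseteq> ?L" using pZ by (auto simp: zdvd_mult_cancel)
    moreover have "?A x \<subseteq> ?L" using A by blast
    ultimately show "?A x \<union> ?R \<subseteq> ?L" by blast
  qed
  have PI: "zideal ` (*) p ` {d \<in> Z2. d zdvd x \<and> \<not> sqrt2 zdvd d} = (`) ((*) p) ` odd_ideal_divisors x"
    unfolding odd_ideal_divisors_def image_image using pZ by (intro image_cong) (auto simp: zideal_mult_image)
  have fin: "finite (odd_ideal_divisors x)" using finite_odd_ideal_divisors[OF x] .
  have finA: "finite (zideal ` ?A x)"
    by (rule finite_subset[OF _ fin]) (auto simp: odd_ideal_divisors_def)
  have inj: "inj_on ((`) ((*) p)) (odd_ideal_divisors x)"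
    using pZ by (intro inj_onI) (simp add: inj_image_eq_iff inj_on_def)
  have disj: "zideal ` ?A x \<inter> (`) ((*) p) ` odd_ideal_divisors x = {}"
  proof -
    have False if "zideal d = (*) p ` I" "d \<in> ?A x" "I \<in> odd_ideal_divisors x" for d I
    proof -
      have "d \<in> zideal d" using that(2) by (simp add: zideal_eq)
      then have "d \<in> (*) p ` I" unfolding that(1) .
      moreover have "I \<subseteq> Z2" using that(3) zdvd_Z2 by (auto simp: odd_ideal_divisors_def zideal_eq)
      ultimately have "p zdvd d" by auto
      then show False using that by blast
    qed
    then show ?thesis by auto
  qed
  have nmI: "absolute_norm ((*) p ` I) = inm p * absolute_norm I" if ID: "I \<in> odd_ideal_divisors x" for I
  proof -
    obtain d where I: "I = zideal d" and "d \<in> {d \<in> Z2. d zdvd x \<and> \<not> sqrt2 zdvd d}"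
      using ID unfolding odd_ideal_divisors_def by (rule imageE)
    then have d: "d \<in> Z2" "d zdvd x" by simp_all
    have "d \<noteq> 0" using d(2) x(2) by (metis mult_zero_left zdvd_def)
    then have "absolute_norm (zideal (p * d)) = inm p * absolute_norm (zideal d)"
      using d(1) pZ by (simp add: absolute_norm_zideal inm_mult)
    then show ?thesis by (simp only: I zideal_mult_image[OF pZ(1) d(1)])
  qed
  have "odd_sigma (p * x) = T x + (\<Sum>I\<in>(`) ((*) p) ` odd_ideal_divisors x. absolute_norm I)"
    unfolding odd_sigma_def T_def odd_ideal_divisors_def[of "p * x"] B image_Un PI
    by (rule sum.union_disjoint[OF finA _ disj]) (use fin in simp)
  also have "(\<Sum>I\<in>(`) ((*) p) ` odd_ideal_divisors x. absolute_norm I) = inm p * odd_sigma x"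
    by (simp add: sum.reindex[OF inj] odd_sigma_def sum_distrib_left nmI)
  finally show "odd_sigma (p * x) = inm p * odd_sigma x + T x" by simp
qed

lemma odd_sigma_prime_not_dvd:
  assumes "zprime p" "\<not> sqrt2 zdvd p" "x \<in> Z2" "x \<noteq> 0" "\<not> p zdvd x"
  shows "odd_sigma (p * x) = (inm p + 1) * odd_sigma x"
  using odd_sigma_prime_step[OF assms(1-4)] assms(5) by simp

text \<open>The sum over divisors prime to \<open>p\<close> is the same for \<open>x\<close> and
  \<open>p * x\<close>, and eliminating it from the two prime steps leaves the recursion of the
  Hecke relation.\<close>

lemma odd_sigma_prime_dvd:
  assumes "zprime p" "\<not> sqrt2 zdvd p" "x \<in> Z2" "x \<noteq> 0"
  shows "odd_sigma (p * (p * x)) + inm p * odd_sigma x = (inm p + 1) * odd_sigma (p * x)"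
proof -
  have "p * x \<in> Z2" "p * x \<noteq> 0" using assms by (simp_all add: zprime_def)
  then show ?thesis
    using odd_sigma_prime_step[OF assms] odd_sigma_prime_step(1)[OF assms(1,2), of "p * x"] by simp
qed

lemma odd_sigma_sqrt2: "x \<in> Z2 \<Longrightarrow> odd_sigma (sqrt2 * x) = odd_sigma x"
proof -
  assume x: "x \<in> Z2"
  have "{d \<in> Z2. d zdvd sqrt2 * x \<and> \<not> sqrt2 zdvd d} = {d \<in> Z2. d zdvd x \<and> \<not> sqrt2 zdvd d}"
    using zdvd_coprime_prime[OF zprime_sqrt2 _ _ x] zdvd_mult2[OF _ Z2_consts(3)] by blast
  then show ?thesis by (simp add: odd_sigma_def odd_ideal_divisors_def)
qed

lemma odd_sigma_unit_mult:
  assumes "x \<in> Z2" "u \<in> Z2" "v \<in> Z2" "u * v = 1"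
  shows "odd_sigma (u * x) = odd_sigma x"
proof -
  have "d zdvd u * x \<longleftrightarrow> d zdvd x" for d
    using assms zdvd_mult2[of d x u] zdvd_mult2[of d "u * x" v] by (auto simp: mult.assoc[symmetric] mult.commute)
  then show ?thesis by (simp add: odd_sigma_def odd_ideal_divisors_def)
qed

lemma odd_sigma_one: "odd_sigma 1 = 1"
proof -
  have eq: "zideal d = zideal 1" if "d \<in> Z2" "d zdvd 1" for d
    unfolding zideal_eq[OF that(1)] zideal_eq[OF Z2_consts(2)]
    using that zdvd_trans[OF that(2)] one_zdvd zdvd_Z2 by blast
  have "1 \<in> {d \<in> Z2. d zdvd 1 \<and> \<not> sqrt2 zdvd d}" using zprime_sqrt2 by (simp add: zprime_def)
  then have "odd_ideal_divisors 1 = {zideal 1}"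
    unfolding odd_ideal_divisors_def using eq by blast
  then show ?thesis using absolute_norm_zideal[of 1] by (simp add: odd_sigma_def inm_def)
qed

section \<open>A norm-Euclidean maximal order\<close>

definition e1 :: "qsqrt2 \<Rightarrow> real" where "e1 x = Rep_qsqrt2 x"
definition e2 :: "qsqrt2 \<Rightarrow> real" where "e2 x = Rep_qsqrt2 (conj2 x)"

lemma e_add: "e1 (x + y) = e1 x + e1 y" "e2 (x + y) = e2 x + e2 y"
  by (simp_all add: e1_def e2_def plus_qsqrt2.rep_eq conj2_add)
lemma e_mult: "e1 (x * y) = e1 x * e1 y" "e2 (x * y) = e2 x * e2 y"
  by (simp_all add: e1_def e2_def times_qsqrt2.rep_eq conj2_mult)
lemma e_one: "e1 1 = 1" "e2 1 = 1"
  by (simp_all add: e1_def e2_def one_qsqrt2.rep_eq qs_one) (simp_all add: Rep_qs)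
lemma e_power2: "e1 (x^2) = (e1 x)^2" "e2 (x^2) = (e2 x)^2"
  by (simp_all add: power2_eq_square e_mult)
lemma e_qs: "e1 (qs a b) = of_rat a + of_rat b * sqrt 2" "e2 (qs a b) = of_rat a - of_rat b * sqrt 2"
  by (simp_all add: e1_def e2_def Rep_qs of_rat_minus)
lemma e_zero_iff: "e1 x = 0 \<longleftrightarrow> x = 0" "e2 x = 0 \<longleftrightarrow> x = 0"
proof -
  have 1: "e1 y = 0 \<longleftrightarrow> y = 0" for y
    by (metis Rep_qsqrt2_inject e1_def zero_qsqrt2.rep_eq)
  then show "e1 x = 0 \<longleftrightarrow> x = 0" .
  have "e2 x = e1 (conj2 x)" by (simp add: e1_def e2_def)
  moreover have "conj2 x = 0 \<longleftrightarrow> x = 0" by (rule qs_cases[of x]) (auto simp: qs_eq_zero)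
  ultimately show "e2 x = 0 \<longleftrightarrow> x = 0" using 1 by simp
qed
lemma e1_e2: "e1 x * e2 x = of_rat (nm x)"
  by (simp add: e1_def e2_def mult_conj2 Rep_of_rat flip: times_qsqrt2.rep_eq)

definition tpos :: "qsqrt2 \<Rightarrow> bool" where "tpos x \<longleftrightarrow> e1 x > 0 \<and> e2 x > 0"

lemma totally_positive_tpos: "totally_positive x \<Longrightarrow> tpos x"
proof -
  have "e1 \<in> real_embeddings" "e2 \<in> real_embeddings"
    by (simp_all add: real_embeddings_def e_add e_mult e_one)
  then show "totally_positive x \<Longrightarrow> tpos x" by (simp add: totally_positive_def tpos_def)
qed

lemma tpos_cancel: "tpos x \<Longrightarrow> tpos (x * y) \<longleftrightarrow> tpos y"
  by (auto simp: tpos_def e_mult zero_less_mult_iff)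
lemma tpos_nonzero: "tpos x \<Longrightarrow> x \<noteq> 0"
  using e_zero_iff(1)[of x] by (auto simp: tpos_def)
lemma tpos_square: "x \<noteq> 0 \<Longrightarrow> tpos (x * x)"
  by (auto simp: tpos_def e_mult e_zero_iff zero_less_mult_iff) (metis e_zero_iff linorder_neqE_linordered_idom)+

section \<open>Quaternion conjugation and the reduced norm\<close>

fun qconj :: "'a::comm_ring_1 quat \<Rightarrow> 'a quat" where
  "qconj (Quat t x y z) = Quat t (- x) (- y) (- z)"

lemma nrd_mult: "nrd (p * q) = nrd p * nrd q"
  by (cases p; cases q) (simp add: power2_eq_square algebra_simps)
lemma nrd_qconj [simp]: "nrd (qconj q) = nrd q" by (cases q) simp
lemma qconj_qconj [simp]: "qconj (qconj q) = q" by (cases q) simp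
lemma mult_qconj: "q * qconj q = nrd q *\<^sub>q 1" "qconj q * q = nrd q *\<^sub>q 1"
  by (cases q; simp add: one_quat_def power2_eq_square algebra_simps)+
lemma quat_scale_mult: "(c *\<^sub>q p) * q = c *\<^sub>q (p * q)" "p * (c *\<^sub>q q) = c *\<^sub>q (p * q)"
  by (cases p; cases q; simp add: algebra_simps)+
lemma quat_scale_scale [simp]: "c *\<^sub>q (d *\<^sub>q q) = (c * d) *\<^sub>q q"
  by (cases q) (simp add: mult.assoc)
lemma quat_scale_one [simp]: "1 *\<^sub>q q = q" by (cases q) simp
lemma nrd_scale: "nrd (c *\<^sub>q q) = c^2 * nrd q"
  by (cases q) (simp add: power2_eq_square algebra_simps)
lemma nrd_one [simp]: "nrd 1 = 1" by (simp add: one_quat_def)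
lemma nrd_zero [simp]: "nrd 0 = 0" by (simp add: zero_quat_def)
lemma quat_scale_inverse:
  fixes c :: "'a::field" assumes "c \<noteq> 0"
  shows "c *\<^sub>q (inverse c *\<^sub>q q) = q" "inverse c *\<^sub>q (c *\<^sub>q q) = q"
  using assms by simp_all
lemma quat_scale_cancel:
  fixes c :: "'a::field" assumes "c \<noteq> 0" shows "c *\<^sub>q p = c *\<^sub>q q \<longleftrightarrow> p = q"
  using quat_scale_inverse(2)[OF assms] by metis
lemma quat_scale_zero [simp]: "c *\<^sub>q 0 = 0" by (simp add: zero_quat_def)

lemma e_nrd_nonneg: "e1 (nrd q) \<ge> 0" "e2 (nrd q) \<ge> 0"
  by (cases q; simp add: e_add e_power2)+

text \<open>The algebra is definite: under a real embedding the reduced norm is a sum of four real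
  squares.\<close>

lemma nrd_eq_zero: "nrd q = 0 \<longleftrightarrow> q = (0 :: qsqrt2 quat)"
proof
  assume h: "nrd q = 0"
  obtain t x y z where q: "q = Quat t x y z" by (cases q)
  have "(e1 t)^2 + (e1 x)^2 + (e1 y)^2 + (e1 z)^2 = 0"
  proof -
    have "e1 (nrd q) = (e1 t)^2 + (e1 x)^2 + (e1 y)^2 + (e1 z)^2" by (simp add: q e_add e_power2)
    then show ?thesis using h e_zero_iff(1)[of "nrd q"] by simp
  qed
  then have "e1 t = 0" "e1 x = 0" "e1 y = 0" "e1 z = 0"
    using zero_le_power2[of "e1 t"] zero_le_power2[of "e1 x"] zero_le_power2[of "e1 y"] zero_le_power2[of "e1 z"]
    by (metis add_nonneg_eq_0_iff add_nonneg_nonneg power_eq_0_iff)+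
  then show "q = 0" by (simp add: q zero_quat_def e_zero_iff)
qed simp

lemma tpos_nrd: "q \<noteq> 0 \<Longrightarrow> tpos (nrd q)"
  using e_nrd_nonneg[of q] nrd_eq_zero[of q] e_zero_iff[of "nrd q"] by (auto simp: tpos_def less_le)

text \<open>These are the quaternions with coordinates \<open>(A + B sqrt 2) / 2\<close> where the four integers \<open>A\<close> have the same parity and the
  four integers \<open>B\<close> have even sum. They form a maximal order.\<close>

definition Oq :: "int \<Rightarrow> int \<Rightarrow> int \<Rightarrow> int \<Rightarrow> int \<Rightarrow> int \<Rightarrow> int \<Rightarrow> int \<Rightarrow> qsqrt2 quat" where
  "Oq s x y z n u v w = Quat
     (qs (of_int s / 2) (of_int (2 * n - u - v - w) / 2))
     (qs (of_int (s + 2 * x) / 2) (of_int u / 2))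
     (qs (of_int (s + 2 * y) / 2) (of_int v / 2))
     (qs (of_int (s + 2 * z) / 2) (of_int w / 2))"

definition Omax :: "qsqrt2 quat set" where
  "Omax = {Oq s x y z n u v w | s x y z n u v w. True}"

lemma Oq_in_Omax [simp]: "Oq s x y z n u v w \<in> Omax" unfolding Omax_def by blast

lemma Omax_cases:
  assumes "q \<in> Omax" obtains s x y z n u v w where "q = Oq s x y z n u v w"
  using assms by (auto simp: Omax_def)

lemma Oq_inject [simp]: "Oq s x y z n u v w = Oq s' x' y' z' n' u' v' w' \<longleftrightarrow>
    s = s' \<and> x = x' \<and> y = y' \<and> z = z' \<and> n = n' \<and> u = u' \<and> v = v' \<and> w = w'"
  by (simp add: Oq_def del: of_int_add of_int_diff of_int_mult) auto

lemma Oq_add: "Oq s x y z n u v w + Oq s' x' y' z' n' u' v' w'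
    = Oq (s + s') (x + x') (y + y') (z + z') (n + n') (u + u') (v + v') (w + w')"
  by (simp add: Oq_def add_divide_distrib algebra_simps diff_divide_distrib)

lemma Oq_uminus: "- Oq s x y z n u v w = Oq (- s) (- x) (- y) (- z) (- n) (- u) (- v) (- w)"
  by (simp add: Oq_def add_divide_distrib algebra_simps diff_divide_distrib)

lemma Oq_scale: "qs (of_int a) (of_int b) *\<^sub>q Oq s x y z n u v w =
    Oq (a * s + 2 * (b * (2 * n - u - v - w)))
       (a * x + b * (2 * u + v + w - 2 * n)) (a * y + b * (u + 2 * v + w - 2 * n)) (a * z + b * (u + v + 2 * w - 2 * n))
       (a * n + b * (2 * s + x + y + z)) (a * u + b * (s + 2 * x)) (a * v + b * (s + 2 * y)) (a * w + b * (s + 2 * z))"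
  unfolding Oq_def quat_scale.simps qs_mult quat.inject qs_inject
  by (intro conjI) (simp_all add: field_simps)

text \<open>Clears denominators: with doubled coordinates, closure of the order under multiplication
  becomes eight polynomial identities over the integers.\<close>

lemma half_int_quat_mult:
  fixes a0 b0 a0' b0' c0 d0 a1 b1 a1' b1' c1 d1 a2 b2 a2' b2' c2 d2 a3 b3 a3' b3' c3 d3 :: int
  assumes "2 * c0 = (a0 * a0' + 2 * (b0 * b0')) - (a1 * a1' + 2 * (b1 * b1')) - (a2 * a2' + 2 * (b2 * b2')) - (a3 * a3' + 2 * (b3 * b3'))"
    "2 * d0 = (a0 * b0' + b0 * a0') - (a1 * b1' + b1 * a1') - (a2 * b2' + b2 * a2') - (a3 * b3' + b3 * a3')"
    "2 * c1 = (a0 * a1' + 2 * (b0 * b1')) + (a1 * a0' + 2 * (b1 * b0')) + (a2 * a3' + 2 * (b2 * b3')) - (a3 * a2' + 2 * (b3 * b2'))"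
    "2 * d1 = (a0 * b1' + b0 * a1') + (a1 * b0' + b1 * a0') + (a2 * b3' + b2 * a3') - (a3 * b2' + b3 * a2')"
    "2 * c2 = (a0 * a2' + 2 * (b0 * b2')) - (a1 * a3' + 2 * (b1 * b3')) + (a2 * a0' + 2 * (b2 * b0')) + (a3 * a1' + 2 * (b3 * b1'))"
    "2 * d2 = (a0 * b2' + b0 * a2') - (a1 * b3' + b1 * a3') + (a2 * b0' + b2 * a0') + (a3 * b1' + b3 * a1')"
    "2 * c3 = (a0 * a3' + 2 * (b0 * b3')) + (a1 * a2' + 2 * (b1 * b2')) - (a2 * a1' + 2 * (b2 * b1')) + (a3 * a0' + 2 * (b3 * b0'))"
    "2 * d3 = (a0 * b3' + b0 * a3') + (a1 * b2' + b1 * a2') - (a2 * b1' + b2 * a1') + (a3 * b0' + b3 * a0')"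
  shows
    "Quat (qs (of_int a0 / 2) (of_int b0 / 2)) (qs (of_int a1 / 2) (of_int b1 / 2))
      (qs (of_int a2 / 2) (of_int b2 / 2)) (qs (of_int a3 / 2) (of_int b3 / 2))
    * Quat (qs (of_int a0' / 2) (of_int b0' / 2)) (qs (of_int a1' / 2) (of_int b1' / 2))
      (qs (of_int a2' / 2) (of_int b2' / 2)) (qs (of_int a3' / 2) (of_int b3' / 2))
    = Quat (qs (of_int c0 / 2) (of_int d0 / 2)) (qs (of_int c1 / 2) (of_int d1 / 2))
      (qs (of_int c2 / 2) (of_int d2 / 2)) (qs (of_int c3 / 2) (of_int d3 / 2))"
  using assms[THEN arg_cong[where f = "of_int :: int \<Rightarrow> rat"]]
  unfolding times_quat.simps qs_mult qs_add qs_diff quat.inject qs_inject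
  by (intro conjI) (simp_all add: field_simps)

text \<open>Integral coordinates of the product give closure at once. The congruence conditions
  modulo \<open>sqrt2\<close> and 2 used below are read off from the parities of these
  polynomials.\<close>

lemma Oq_mult: "Oq s x y z n u v w * Oq s' x' y' z' n' u' v' w' = Oq
      (4 * n * n' - 2 * n * u' - 2 * n * v' - 2 * n * w' - 2 * n' * u - 2 * n' * v - 2 * n' * w - s * s' - s * x'
        - s * y' - s * z' - s' * x - s' * y - s' * z + u * v' + u * w' + u' * v + u' * w + v * w' + v' * w
        - 2 * x * x' - 2 * y * y' - 2 * z * z')
      (- 2 * n * n' + 2 * n * u' + n * v' + n * w' + 2 * n' * u + n' * v + n' * w + s * s' + s * x' + s * z' + s' * x
        + s' * y - u * u' - u * v' - u * w' - u' * v - u' * w - v' * w + x * x' + y * y' + y * z' - y' * z + z * z')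
      (- 2 * n * n' + n * u' + 2 * n * v' + n * w' + n' * u + 2 * n' * v + n' * w + s * s' + s * x' + s * y' + s' * y
        + s' * z - u * v' - u * w' - u' * v - v * v' - v * w' - v' * w + x * x' - x * z' + x' * z + y * y' + z * z')
      (- 2 * n * n' + n * u' + n * v' + 2 * n * w' + n' * u + n' * v + 2 * n' * w + s * s' + s * y' + s * z' + s' * x
        + s' * z - u * w' - u' * v - u' * w - v * w' - v' * w - w * w' + x * x' + x * y' - x' * y + y * y' + z * z')
      (2 * n * s' + n * x' + n * y' + n * z' + 2 * n' * s + n' * x + n' * y + n' * z - s * u' - s * v' - s * w'
        - s' * u - s' * v - s' * w - u * x' - u * z' - u' * x - u' * y - v * x' - v * y' - v' * y - v' * z - w * y'
        - w * z' - w' * x - w' * z)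
      (n * s' + 2 * n * x' + n' * s + 2 * n' * x - s * v' - s' * w - u * x' - u' * x - v * x' + v * z' - v' * x
        - v' * z - w * x' - w * y' - w' * x + w' * y)
      (n * s' + 2 * n * y' + n' * s + 2 * n' * y - s * w' - s' * u - u * y' - u * z' - u' * y + u' * z - v * y'
        - v' * y + w * x' - w * y' - w' * x - w' * y)
      (n * s' + 2 * n * z' + n' * s + 2 * n' * z - s * u' - s' * v + u * y' - u * z' - u' * y - u' * z - v * x'
        - v * z' + v' * x - v' * z - w * z' - w' * z)"
  unfolding Oq_def by (rule half_int_quat_mult) (simp_all add: algebra_simps)

lemma Omax_add [simp]: "p \<in> Omax \<Longrightarrow> q \<in> Omax \<Longrightarrow> p + q \<in> Omax"
  by (elim Omax_cases) (simp only: Oq_add Oq_in_Omax)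
lemma Omax_uminus [simp]: "p \<in> Omax \<Longrightarrow> - p \<in> Omax"
  by (elim Omax_cases) (simp only: Oq_uminus Oq_in_Omax)
lemma Omax_diff [simp]: "p \<in> Omax \<Longrightarrow> q \<in> Omax \<Longrightarrow> p - q \<in> Omax"
  unfolding minus_quat_def by (intro Omax_add Omax_uminus)
lemma Omax_mult [simp]: "p \<in> Omax \<Longrightarrow> q \<in> Omax \<Longrightarrow> p * q \<in> Omax"
  by (elim Omax_cases) (simp only: Oq_mult Oq_in_Omax)
lemma Omax_scale [simp]: "c \<in> Z2 \<Longrightarrow> q \<in> Omax \<Longrightarrow> c *\<^sub>q q \<in> Omax"
  by (elim Omax_cases Z2_cases) (simp only: Oq_scale Oq_in_Omax)
lemma Oq_one: "1 = Oq 2 (-1) (-1) (-1) 0 0 0 0"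
  by (simp add: Oq_def one_quat_def qs_consts)
lemma Omax_one [simp]: "1 \<in> Omax" by (simp add: Oq_one)
lemma Oq_zero: "0 = Oq 0 0 0 0 0 0 0 0"
  by (simp add: Oq_def zero_quat_def qs_consts)
lemma Omax_zero [simp]: "0 \<in> Omax" by (simp add: Oq_zero)
lemma Oq_qconj: "qconj (Oq s x y z n u v w) =
    Oq s (- s - x) (- s - y) (- s - z) (n - u - v - w) (- u) (- v) (- w)"
  by (simp add: Oq_def) (simp add: field_simps)
lemma Omax_qconj [simp]: "q \<in> Omax \<Longrightarrow> qconj q \<in> Omax"
  by (elim Omax_cases) (simp only: Oq_qconj Oq_in_Omax)

lemma nrd_Oq: "nrd (Oq s x y z n u v w) = qs
   (of_int (s*s + s*(x+y+z) + x*x + y*y + z*z + 2*n*n - 2*n*(u+v+w) + u*u + v*v + w*w + u*v + u*w + v*w))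
   (of_int (s*n + x*u + y*v + z*w))"
  unfolding Oq_def nrd.simps power2_eq_square qs_mult qs_add qs_inject
  by (intro conjI) (simp_all add: field_simps)

lemma nrd_Omax: "q \<in> Omax \<Longrightarrow> nrd q \<in> Z2"
  by (elim Omax_cases) (simp only: nrd_Oq Z2_qs)

text \<open>Here m is a nearest integer and m' the next one, of opposite parity, with f the squared
  distance. If d \<le> 1/2 is the distance to m, then 3 d^2 + (1 - d)^2 = 1 - 2 d (1 - 2 d) \<le> 1,
  which is the last condition.\<close>

definition near_pair :: "(int \<Rightarrow> rat) \<Rightarrow> int \<Rightarrow> int \<Rightarrow> bool" where
  "near_pair f m m' \<longleftrightarrow> (even m' \<longleftrightarrow> odd m) \<and> f m \<le> 1/4 \<and> f m' \<le> 1 \<and> 3 * f m + f m' \<le> 1"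

text \<open>Decoding by syndromes. The four parity conditions can fail in 16 ways. If none fails,
  rounding every coordinate costs at most 8/4. In eight cases changing a single coordinate repairs
  the failure, at cost at most 7/4 + 1 = 11/4. In the remaining seven cases a pair must be changed,
  and the suitable pairs partition the eight coordinates.\<close>

lemma parity_rounding_cases:
  assumes N: "near_pair f1 c1 c1'" "near_pair f2 c2 c2'" "near_pair f3 c3 c3'" "near_pair f4 c4 c4'"
      "near_pair g1 b1 b1'" "near_pair g2 b2 b2'" "near_pair g3 b3 b3'" "near_pair g4 b4 b4'"
    and R: "\<And>C1 C2 C3 C4 B1 B2 B3 B4. even (B1 + B2 + B3 + B4) \<Longrightarrow> even ((C2 - B2) - (C1 - B1)) \<Longrightarrow>
      even ((C3 - B3) - (C1 - B1)) \<Longrightarrow> even ((C4 - B4) - (C1 - B1)) \<Longrightarrow>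
      f1 C1 + f2 C2 + f3 C3 + f4 C4 + g1 B1 + g2 B2 + g3 B3 + g4 B4 \<le> 11/4 \<Longrightarrow> thesis"
  shows thesis
proof -
  define F where "F C1 C2 C3 C4 B1 B2 B3 B4 = f1 C1 + f2 C2 + f3 C3 + f4 C4 + g1 B1 + g2 B2 + g3 B3 + g4 B4"
    for C1 C2 C3 C4 B1 B2 B3 B4
  note par = N[unfolded near_pair_def, THEN conjunct1]
  note N' = N[unfolded near_pair_def, THEN conjunct2]
  note f = N'[THEN conjunct1] N'[THEN conjunct2, THEN conjunct1] N'[THEN conjunct2, THEN conjunct2]
  note R = R[folded F_def]
  have k0: thesis if a: "even (b1 + b2 + b3 + b4)" "even ((c2 - b2) - (c1 - b1))"
      "even ((c3 - b3) - (c1 - b1))" "even ((c4 - b4) - (c1 - b1))"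
    by (rule R[of b1 b2 b3 b4 c2 c1 c3 c4, rotated 4], use f(1) f(2) f(3) f(4) f(5) f(6) f(7) f(8) in \<open>unfold F_def, linarith\<close>)
      (use a in \<open>unfold even_diff even_add par, argo\<close>)+
  have k1: thesis if a: "even (b1 + b2 + b3 + b4)" "even ((c2 - b2) - (c1 - b1))"
      "even ((c3 - b3) - (c1 - b1))" "odd ((c4 - b4) - (c1 - b1))"
    by (rule R[of b1 b2 b3 b4 c2 c1 c3 c4', rotated 4], use f(1) f(2) f(3) f(12) f(5) f(6) f(7) f(8) in \<open>unfold F_def, linarith\<close>)
      (use a in \<open>unfold even_diff even_add par, argo\<close>)+
  have k2: thesis if a: "even (b1 + b2 + b3 + b4)" "even ((c2 - b2) - (c1 - b1))"
      "odd ((c3 - b3) - (c1 - b1))" "even ((c4 - b4) - (c1 - b1))"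
    by (rule R[of b1 b2 b3 b4 c2 c1 c3' c4, rotated 4], use f(1) f(2) f(11) f(4) f(5) f(6) f(7) f(8) in \<open>unfold F_def, linarith\<close>)
      (use a in \<open>unfold even_diff even_add par, argo\<close>)+
  have k3: thesis if a: "even (b1 + b2 + b3 + b4)" "even ((c2 - b2) - (c1 - b1))"
      "odd ((c3 - b3) - (c1 - b1))" "odd ((c4 - b4) - (c1 - b1))"
  proof -
    \<comment> \<open>The four alternatives change disjoint pairs that cover all coordinates. Their
      totals therefore add up to the eight values \<open>3 * f m + f m'\<close>, at most 8, and one
      of them is at most 2.\<close>
    have "F c1' c2' c3 c4 b1 b2 b3 b4 \<le> 11/4
        \<or> F c1 c2 c3' c4' b1 b2 b3 b4 \<le> 11/4
        \<or> F c1 c2 c3 c4 b1' b2' b3 b4 \<le> 11/4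
        \<or> F c1 c2 c3 c4 b1 b2 b3' b4' \<le> 11/4"
      using f(17-24) unfolding F_def by linarith
    then show thesis
      by (elim disjE) (erule R[rotated 4]; use a in \<open>unfold even_diff even_add par, argo\<close>)+
  qed
  have k4: thesis if a: "even (b1 + b2 + b3 + b4)" "odd ((c2 - b2) - (c1 - b1))"
      "even ((c3 - b3) - (c1 - b1))" "even ((c4 - b4) - (c1 - b1))"
    by (rule R[of b1 b2 b3 b4 c2' c1 c3 c4, rotated 4], use f(1) f(10) f(3) f(4) f(5) f(6) f(7) f(8) in \<open>unfold F_def, linarith\<close>)
      (use a in \<open>unfold even_diff even_add par, argo\<close>)+
  have k5: thesis if a: "even (b1 + b2 + b3 + b4)" "odd ((c2 - b2) - (c1 - b1))"
      "even ((c3 - b3) - (c1 - b1))" "odd ((c4 - b4) - (c1 - b1))"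
  proof -
    have "F c1' c2 c3' c4 b1 b2 b3 b4 \<le> 11/4
        \<or> F c1 c2' c3 c4' b1 b2 b3 b4 \<le> 11/4
        \<or> F c1 c2 c3 c4 b1' b2 b3' b4 \<le> 11/4
        \<or> F c1 c2 c3 c4 b1 b2' b3 b4' \<le> 11/4"
      using f(17-24) unfolding F_def by linarith
    then show thesis
      by (elim disjE) (erule R[rotated 4]; use a in \<open>unfold even_diff even_add par, argo\<close>)+
  qed
  have k6: thesis if a: "even (b1 + b2 + b3 + b4)" "odd ((c2 - b2) - (c1 - b1))"
      "odd ((c3 - b3) - (c1 - b1))" "even ((c4 - b4) - (c1 - b1))"
  proof -
    have "F c1' c2 c3 c4' b1 b2 b3 b4 \<le> 11/4
        \<or> F c1 c2' c3' c4 b1 b2 b3 b4 \<le> 11/4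
        \<or> F c1 c2 c3 c4 b1' b2 b3 b4' \<le> 11/4
        \<or> F c1 c2 c3 c4 b1 b2' b3' b4 \<le> 11/4"
      using f(17-24) unfolding F_def by linarith
    then show thesis
      by (elim disjE) (erule R[rotated 4]; use a in \<open>unfold even_diff even_add par, argo\<close>)+
  qed
  have k7: thesis if a: "even (b1 + b2 + b3 + b4)" "odd ((c2 - b2) - (c1 - b1))"
      "odd ((c3 - b3) - (c1 - b1))" "odd ((c4 - b4) - (c1 - b1))"
    by (rule R[of b1 b2 b3 b4 c2 c1' c3 c4, rotated 4], use f(9) f(2) f(3) f(4) f(5) f(6) f(7) f(8) in \<open>unfold F_def, linarith\<close>)
      (use a in \<open>unfold even_diff even_add par, argo\<close>)+
  have k8: thesis if a: "odd (b1 + b2 + b3 + b4)" "even ((c2 - b2) - (c1 - b1))"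
      "even ((c3 - b3) - (c1 - b1))" "even ((c4 - b4) - (c1 - b1))"
  proof -
    have "F c1' c2 c3 c4 b1' b2 b3 b4 \<le> 11/4
        \<or> F c1 c2' c3 c4 b1 b2' b3 b4 \<le> 11/4
        \<or> F c1 c2 c3' c4 b1 b2 b3' b4 \<le> 11/4
        \<or> F c1 c2 c3 c4' b1 b2 b3 b4' \<le> 11/4"
      using f(17-24) unfolding F_def by linarith
    then show thesis
      by (elim disjE) (erule R[rotated 4]; use a in \<open>unfold even_diff even_add par, argo\<close>)+
  qed
  have k9: thesis if a: "odd (b1 + b2 + b3 + b4)" "even ((c2 - b2) - (c1 - b1))"
      "even ((c3 - b3) - (c1 - b1))" "odd ((c4 - b4) - (c1 - b1))"
    by (rule R[of b1 b2 b3 b4' c2 c1 c3 c4, rotated 4], use f(1) f(2) f(3) f(4) f(5) f(6) f(7) f(16) in \<open>unfold F_def, linarith\<close>)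
      (use a in \<open>unfold even_diff even_add par, argo\<close>)+
  have k10: thesis if a: "odd (b1 + b2 + b3 + b4)" "even ((c2 - b2) - (c1 - b1))"
      "odd ((c3 - b3) - (c1 - b1))" "even ((c4 - b4) - (c1 - b1))"
    by (rule R[of b1 b2 b3' b4 c2 c1 c3 c4, rotated 4], use f(1) f(2) f(3) f(4) f(5) f(6) f(15) f(8) in \<open>unfold F_def, linarith\<close>)
      (use a in \<open>unfold even_diff even_add par, argo\<close>)+
  have k11: thesis if a: "odd (b1 + b2 + b3 + b4)" "even ((c2 - b2) - (c1 - b1))"
      "odd ((c3 - b3) - (c1 - b1))" "odd ((c4 - b4) - (c1 - b1))"
  proof -
    have "F c1' c2 c3 c4 b1 b2' b3 b4 \<le> 11/4
        \<or> F c1 c2' c3 c4 b1' b2 b3 b4 \<le> 11/4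
        \<or> F c1 c2 c3' c4 b1 b2 b3 b4' \<le> 11/4
        \<or> F c1 c2 c3 c4' b1 b2 b3' b4 \<le> 11/4"
      using f(17-24) unfolding F_def by linarith
    then show thesis
      by (elim disjE) (erule R[rotated 4]; use a in \<open>unfold even_diff even_add par, argo\<close>)+
  qed
  have k12: thesis if a: "odd (b1 + b2 + b3 + b4)" "odd ((c2 - b2) - (c1 - b1))"
      "even ((c3 - b3) - (c1 - b1))" "even ((c4 - b4) - (c1 - b1))"
    by (rule R[of b1 b2' b3 b4 c2 c1 c3 c4, rotated 4], use f(1) f(2) f(3) f(4) f(5) f(14) f(7) f(8) in \<open>unfold F_def, linarith\<close>)
      (use a in \<open>unfold even_diff even_add par, argo\<close>)+
  have k13: thesis if a: "odd (b1 + b2 + b3 + b4)" "odd ((c2 - b2) - (c1 - b1))"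
      "even ((c3 - b3) - (c1 - b1))" "odd ((c4 - b4) - (c1 - b1))"
  proof -
    have "F c1' c2 c3 c4 b1 b2 b3' b4 \<le> 11/4
        \<or> F c1 c2' c3 c4 b1 b2 b3 b4' \<le> 11/4
        \<or> F c1 c2 c3' c4 b1' b2 b3 b4 \<le> 11/4
        \<or> F c1 c2 c3 c4' b1 b2' b3 b4 \<le> 11/4"
      using f(17-24) unfolding F_def by linarith
    then show thesis
      by (elim disjE) (erule R[rotated 4]; use a in \<open>unfold even_diff even_add par, argo\<close>)+
  qed
  have k14: thesis if a: "odd (b1 + b2 + b3 + b4)" "odd ((c2 - b2) - (c1 - b1))"
      "odd ((c3 - b3) - (c1 - b1))" "even ((c4 - b4) - (c1 - b1))"
  proof -
    have "F c1' c2 c3 c4 b1 b2 b3 b4' \<le> 11/4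
        \<or> F c1 c2' c3 c4 b1 b2 b3' b4 \<le> 11/4
        \<or> F c1 c2 c3' c4 b1 b2' b3 b4 \<le> 11/4
        \<or> F c1 c2 c3 c4' b1' b2 b3 b4 \<le> 11/4"
      using f(17-24) unfolding F_def by linarith
    then show thesis
      by (elim disjE) (erule R[rotated 4]; use a in \<open>unfold even_diff even_add par, argo\<close>)+
  qed
  have k15: thesis if a: "odd (b1 + b2 + b3 + b4)" "odd ((c2 - b2) - (c1 - b1))"
      "odd ((c3 - b3) - (c1 - b1))" "odd ((c4 - b4) - (c1 - b1))"
    by (rule R[of b1' b2 b3 b4 c2 c1 c3 c4, rotated 4], use f(1) f(2) f(3) f(4) f(13) f(6) f(7) f(8) in \<open>unfold F_def, linarith\<close>)
      (use a in \<open>unfold even_diff even_add par, argo\<close>)+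
  show thesis using k0 k1 k2 k3 k4 k5 k6 k7 k8 k9 k10 k11 k12 k13 k14 k15 by argo
qed

lemma near_pair_ex:
  fixes r :: rat
  shows "\<exists>m m'. near_pair (\<lambda>m. (r - of_int m)^2) m m'"
proof -
  define m where "m = round r"
  define d where "d = r - of_int m"
  have d: "\<bar>d\<bar> \<le> 1/2" unfolding d_def m_def using of_int_round_abs_le[of r] by (simp add: abs_minus_commute)
  define m' where "m' = (if d \<ge> 0 then m + 1 else m - 1)"
  have "(r - of_int m')^2 = (1 - \<bar>d\<bar>)^2"
    by (auto simp: m'_def d_def power2_eq_square algebra_simps)
  moreover have "d^2 = \<bar>d\<bar> * \<bar>d\<bar>" by (simp add: power2_eq_square)
  moreover have "\<bar>d\<bar> * \<bar>d\<bar> \<le> 1/2 * \<bar>d\<bar>" using d by (intro mult_right_mono) simp_all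
  ultimately have "(r - of_int m)^2 \<le> 1/4" "(r - of_int m')^2 \<le> 1" "3 * (r - of_int m)^2 + (r - of_int m')^2 \<le> 1"
    using d by (simp_all add: power2_eq_square[of "1 - _"] algebra_simps flip: d_def)
  moreover have "even m' \<longleftrightarrow> odd m" by (simp add: m'_def)
  ultimately show ?thesis unfolding near_pair_def by blast
qed

text \<open>In the coordinates \<open>(a + b, b)\<close> of \<open>a + b sqrt 2\<close>, the order is half of the lattice of integer vectors that reduce
  modulo 2 to the extended Hamming code of length 8. Every vector is within squared distance 11/4 of it, and the
  estimate \<open>X\<^sup>2 - 2 Y\<^sup>2 \<le> 2 (X + Y)\<^sup>2\<close> turns this into a bound for the norm.\<close>

lemma Omax_approx: "\<exists>p\<in>Omax. \<bar>nm (nrd (q - p))\<bar> < 1"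
proof -
  obtain a1 b1 a2 b2 a3 b3 a4 b4 where q: "q = Quat (qs a1 b1) (qs a2 b2) (qs a3 b3) (qs a4 b4)"
    by (metis qs_surj quat.exhaust)
  obtain C1 C2 C3 C4 B1 B2 B3 B4 :: int where B: "even (B1 + B2 + B3 + B4)"
    and C: "even ((C2 - B2) - (C1 - B1))" "even ((C3 - B3) - (C1 - B1))" "even ((C4 - B4) - (C1 - B1))"
    and E: "(2 * a1 + 2 * b1 - of_int C1)^2 + (2 * a2 + 2 * b2 - of_int C2)^2 + (2 * a3 + 2 * b3 - of_int C3)^2
      + (2 * a4 + 2 * b4 - of_int C4)^2 + (2 * b1 - of_int B1)^2 + (2 * b2 - of_int B2)^2
      + (2 * b3 - of_int B3)^2 + (2 * b4 - of_int B4)^2 \<le> 11/4"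
  proof -
    obtain c1 c1' c2 c2' c3 c3' c4 c4' d1 d1' d2 d2' d3 d3' d4 d4' where
      "near_pair (\<lambda>m. (2*a1+2*b1 - of_int m)^2) c1 c1'" "near_pair (\<lambda>m. (2*a2+2*b2 - of_int m)^2) c2 c2'"
      "near_pair (\<lambda>m. (2*a3+2*b3 - of_int m)^2) c3 c3'" "near_pair (\<lambda>m. (2*a4+2*b4 - of_int m)^2) c4 c4'"
      "near_pair (\<lambda>m. (2*b1 - of_int m)^2) d1 d1'" "near_pair (\<lambda>m. (2*b2 - of_int m)^2) d2 d2'"
      "near_pair (\<lambda>m. (2*b3 - of_int m)^2) d3 d3'" "near_pair (\<lambda>m. (2*b4 - of_int m)^2) d4 d4'"
      using near_pair_ex by metis
    from parity_rounding_cases[OF this that] show thesis .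
  qed
  obtain n x y z where n: "B1 + B2 + B3 + B4 = 2 * n" and xyz: "(C2 - B2) - (C1 - B1) = 2 * x"
      "(C3 - B3) - (C1 - B1) = 2 * y" "(C4 - B4) - (C1 - B1) = 2 * z"
    using B C by (elim evenE)
  define p where "p = Oq (C1 - B1) x y z n B2 B3 B4"
  have p: "p = Quat (qs (of_int (C1 - B1) / 2) (of_int B1 / 2)) (qs (of_int (C2 - B2) / 2) (of_int B2 / 2))
      (qs (of_int (C3 - B3) / 2) (of_int B3 / 2)) (qs (of_int (C4 - B4) / 2) (of_int B4 / 2))"
  proof -
    have "C1 - B1 + 2 * x = C2 - B2" "C1 - B1 + 2 * y = C3 - B3" "C1 - B1 + 2 * z = C4 - B4"
      "2 * n - B2 - B3 - B4 = B1" using n xyz by linarith+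
    then show ?thesis by (simp only: p_def Oq_def)
  qed
  define f1 f2 f3 f4 g1 g2 g3 g4 where
    "f1 = 2 * a1 + 2 * b1 - of_int C1" "f2 = 2 * a2 + 2 * b2 - of_int C2" "f3 = 2 * a3 + 2 * b3 - of_int C3"
    "f4 = 2 * a4 + 2 * b4 - of_int C4" "g1 = 2 * b1 - of_int B1" "g2 = 2 * b2 - of_int B2"
    "g3 = 2 * b3 - of_int B3" "g4 = 2 * b4 - of_int B4"
  note fg = this
  have "q - p = Quat (qs ((f1 - g1) / 2) (g1 / 2)) (qs ((f2 - g2) / 2) (g2 / 2))
      (qs ((f3 - g3) / 2) (g3 / 2)) (qs ((f4 - g4) / 2) (g4 / 2))"
    by (simp add: q p fg minus_quat_def field_simps)
  moreover define X where "X = ((f1 - g1)^2 + (f2 - g2)^2 + (f3 - g3)^2 + (f4 - g4)^2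
      + 2 * (g1^2 + g2^2 + g3^2 + g4^2)) / 4"
  moreover define Y where "Y = ((f1 - g1) * g1 + (f2 - g2) * g2 + (f3 - g3) * g3 + (f4 - g4) * g4) / 2"
  ultimately have nrd: "nrd (q - p) = qs X Y"
    by (simp add: power2_eq_square) (simp add: field_simps)
  have "X + Y = (f1^2 + f2^2 + f3^2 + f4^2 + g1^2 + g2^2 + g3^2 + g4^2) / 4"
    by (simp add: X_def Y_def power2_eq_square field_simps)
  moreover have "\<dots> \<le> 11/16" using E by (simp add: fg)
  moreover have "(f1^2 + f2^2 + f3^2 + f4^2 + g1^2 + g2^2 + g3^2 + g4^2) / 4 \<ge> 0" by simp
  ultimately have XY: "X + Y \<le> 11/16" "X + Y \<ge> 0" by linarith+
  have "(X + Y)^2 \<le> (11/16)^2" using XY by (intro power_mono)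
  moreover have "X^2 - 2 * Y^2 = 2 * (X + Y)^2 - (X + 2 * Y)^2"
    by (simp add: power2_eq_square algebra_simps)
  moreover have "(X + 2 * Y)^2 \<ge> 0" by simp
  moreover have "2 * (11/16::rat)^2 < 1" by (simp add: power2_eq_square)
  ultimately have "X^2 - 2 * Y^2 < 1" by linarith
  then have "nm (nrd (q - p)) < 1" by (simp add: nrd nm_qs)
  moreover have "(of_rat (nm (nrd (q - p))) :: real) \<ge> 0"
    using e_nrd_nonneg[of "q - p"] by (simp flip: e1_e2)
  ultimately have "\<bar>nm (nrd (q - p))\<bar> < 1" by simp
  moreover have "p \<in> Omax" by (simp add: p_def)
  ultimately show ?thesis by blast
qed

section \<open>Euclidean division on the left and principal right ideals\<close>

lemma Omax_division:
  assumes "s \<in> Omax" "s \<noteq> 0" "q \<in> Omax"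
  shows "\<exists>t\<in>Omax. inm (nrd (q - s * t)) < inm (nrd s)"
proof -
  let ?c = "nrd s"
  have c: "?c \<noteq> 0" using assms(2) by (simp add: nrd_eq_zero)
  define x where "x = inverse ?c *\<^sub>q (qconj s * q)"
  have sx: "s * x = q"
    using c by (simp add: x_def quat_scale_mult mult.assoc[symmetric] mult_qconj)
  obtain t where t: "t \<in> Omax" "\<bar>nm (nrd (x - t))\<bar> < 1" using Omax_approx by blast
  have "q - s * t = s * (x - t)" by (simp add: sx[symmetric] right_diff_distrib)
  then have "\<bar>nm (nrd (q - s * t))\<bar> = \<bar>nm ?c\<bar> * \<bar>nm (nrd (x - t))\<bar>"
    by (simp add: nrd_mult nm_mult abs_mult)
  also have "\<dots> < \<bar>nm ?c\<bar> * 1"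
    using t(2) c by (intro mult_strict_left_mono) (simp_all add: nm_eq_zero)
  finally have "(of_nat (inm (nrd (q - s * t))) :: rat) < of_nat (inm ?c)"
    using assms t by (simp add: inm_Z2 nrd_Omax)
  then show ?thesis using t(1) by (auto simp only: of_nat_less_iff)
qed

lemma right_ideal_principal:
  assumes I: "I \<subseteq> Omax" "\<And>x y. x \<in> I \<Longrightarrow> y \<in> I \<Longrightarrow> x - y \<in> I"
    "\<And>x c. x \<in> I \<Longrightarrow> c \<in> Omax \<Longrightarrow> x * c \<in> I" and ne: "\<exists>x\<in>I. x \<noteq> 0"
  shows "\<exists>s\<in>I. s \<noteq> 0 \<and> I = (*) s ` Omax"
proof -
  define P where "P g \<longleftrightarrow> g \<in> I \<and> g \<noteq> 0" for g
  obtain g0 where "P g0" using ne by (auto simp: P_def)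
  then obtain g where g: "P g" and min: "\<And>h. P h \<Longrightarrow> inm (nrd g) \<le> inm (nrd h)"
    using ex_has_least_nat[of P g0 "\<lambda>g. inm (nrd g)"] by blast
  have "\<exists>t\<in>Omax. x = g * t" if x: "x \<in> I" for x
  proof -
    obtain t where t: "t \<in> Omax" "inm (nrd (x - g * t)) < inm (nrd g)"
      using Omax_division[of g x] g x I(1) by (auto simp: P_def)
    have "x - g * t \<in> I" using g x t I by (auto simp: P_def)
    then have "x - g * t = 0" using min[of "x - g * t"] t by (auto simp: P_def)
    then show ?thesis using t by auto
  qed
  then have "I = (*) g ` Omax" using g I(3) by (auto simp: P_def)
  then show ?thesis using g unfolding P_def by blast
qed

section \<open>Hecke relations and units\<close>

abbreviation scaled_Omax :: "qsqrt2 \<Rightarrow> qsqrt2 quat set" where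
  "scaled_Omax m \<equiv> (\<lambda>q. m *\<^sub>q q) ` Omax"

definition reps :: "qsqrt2 \<Rightarrow> qsqrt2 quat set" where
  "reps x = {q \<in> Omax. nrd q = x}"

lemma finite_reps: "finite (reps x)"
proof -
  obtain a b where x: "x = qs a b" by (rule qs_cases)
  define K where "K = \<lceil>4 * a\<rceil>"
  \<comment> \<open>All coordinates of the doubled quaternion are at most K in absolute value;
    \<open>n\<close> is half the sum of four of them, whence the bound 2 K.\<close>
  define B where "B = {- 2 * K..2 * K}"
  let ?f = "\<lambda>(s, x, y, z, n, u, v, w). Oq s x y z n u v w"
  have "reps x \<subseteq> ?f ` (B \<times> B \<times> B \<times> B \<times> B \<times> B \<times> B \<times> B)"
  proof
    fix q assume q: "q \<in> reps x"
    then obtain s x' y z n u v w where qO: "q = Oq s x' y z n u v w" and nq: "nrd q = x"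
      by (auto simp: reps_def elim: Omax_cases)
    define b0 where "b0 = 2 * n - u - v - w"
    \<comment> \<open>Four times the rational part of the norm is a positive definite form in the
      eight integers, so it bounds each of them.\<close>
    have "4 * a = of_int (s^2 + (s + 2 * x')^2 + (s + 2 * y)^2 + (s + 2 * z)^2
        + 2 * b0^2 + 2 * u^2 + 2 * v^2 + 2 * w^2)"
      using nq by (simp add: qO nrd_Oq x b0_def power2_eq_square algebra_simps)
    then have sum: "s^2 + (s + 2 * x')^2 + (s + 2 * y)^2 + (s + 2 * z)^2
        + 2 * b0^2 + 2 * u^2 + 2 * v^2 + 2 * w^2 = K"
      unfolding K_def by (metis ceiling_of_int)
    have le: "\<bar>c\<bar> \<le> c^2" for c :: int
      using self_le_power[of "\<bar>c\<bar>" 2] by (cases "c = 0") simp_all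
    have "s^2 \<le> K" "(s + 2 * x')^2 \<le> K" "(s + 2 * y)^2 \<le> K" "(s + 2 * z)^2 \<le> K"
      "b0^2 \<le> K" "u^2 \<le> K" "v^2 \<le> K" "w^2 \<le> K"
      using sum zero_le_power2[of s] zero_le_power2[of "s + 2 * x'"] zero_le_power2[of "s + 2 * y"] zero_le_power2[of "s + 2 * z"]
        zero_le_power2[of b0] zero_le_power2[of u] zero_le_power2[of v] zero_le_power2[of w]
      by linarith+
    then have "\<bar>s\<bar> \<le> K" "\<bar>s + 2 * x'\<bar> \<le> K" "\<bar>s + 2 * y\<bar> \<le> K" "\<bar>s + 2 * z\<bar> \<le> K"
      "\<bar>b0\<bar> \<le> K" "\<bar>u\<bar> \<le> K" "\<bar>v\<bar> \<le> K" "\<bar>w\<bar> \<le> K"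
      using order_trans[OF le] by blast+
    then have "- K \<le> s" "s \<le> K" "- K \<le> s + 2 * x'" "s + 2 * x' \<le> K" "- K \<le> s + 2 * y" "s + 2 * y \<le> K"
      "- K \<le> s + 2 * z" "s + 2 * z \<le> K" "- K \<le> b0" "b0 \<le> K" "- K \<le> u" "u \<le> K" "- K \<le> v" "v \<le> K"
      "- K \<le> w" "w \<le> K" unfolding abs_le_iff by linarith+
    then have "s \<in> B" "x' \<in> B" "y \<in> B" "z \<in> B" "n \<in> B" "u \<in> B" "v \<in> B" "w \<in> B"
      unfolding B_def b0_def atLeastAtMost_iff by linarith+
    then have "(s, x', y, z, n, u, v, w) \<in> B \<times> B \<times> B \<times> B \<times> B \<times> B \<times> B \<times> B" by simp
    moreover have "q = ?f (s, x', y, z, n, u, v, w)" by (simp add: qO)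
    ultimately show "q \<in> ?f ` (B \<times> B \<times> B \<times> B \<times> B \<times> B \<times> B \<times> B)" by (rule rev_image_eqI)
  qed
  then show ?thesis by (rule finite_subset) (simp add: B_def)
qed

lemma quat_mult_left_cancel:
  fixes s :: "'a::field quat"
  assumes "nrd s \<noteq> 0" shows "s * p = s * q \<longleftrightarrow> p = q"
proof
  assume "s * p = s * q"
  then have "qconj s * (s * p) = qconj s * (s * q)" by simp
  then have "nrd s *\<^sub>q p = nrd s *\<^sub>q q" by (simp add: mult.assoc[symmetric] mult_qconj quat_scale_mult)
  then show "p = q" using quat_scale_cancel[OF assms] by blast
qed simp


lemma card_left_multiples:
  assumes "s \<in> Omax" "nrd s = p" "p \<noteq> 0"
  shows "card {q \<in> reps (p * x). q \<in> (*) s ` Omax} = card (reps x)"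
proof -
  have "{q \<in> reps (p * x). q \<in> (*) s ` Omax} = (*) s ` reps x"
    using assms by (auto simp: reps_def nrd_mult)
  moreover have "inj_on ((*) s) (reps x)"
    using assms by (intro inj_onI) (simp add: quat_mult_left_cancel)
  ultimately show ?thesis by (simp add: card_image)
qed

lemma card_scaled_reps:
  assumes "m \<in> Z2" "m \<noteq> 0"
  shows "card {q \<in> reps (m^2 * x). q \<in> scaled_Omax m} = card (reps x)"
proof -
  have "{q \<in> reps (m^2 * x). q \<in> scaled_Omax m} = (\<lambda>q. m *\<^sub>q q) ` reps x"
    using assms by (auto simp: reps_def nrd_scale)
  moreover have "inj_on (\<lambda>q. m *\<^sub>q q) (reps x)"
    using assms by (intro inj_onI) (simp add: quat_scale_cancel)
  ultimately show ?thesis by (simp add: card_image)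
qed

lemma card_scaled_reps_empty:
  assumes "m \<in> Z2" "m \<noteq> 0" "\<not> m^2 zdvd x"
  shows "card {q \<in> reps x. q \<in> scaled_Omax m} = 0"
proof -
  have "{q \<in> reps x. q \<in> scaled_Omax m} = {}"
    using assms by (auto simp: reps_def nrd_scale nrd_Omax)
  then show ?thesis by (simp only: card.empty)
qed

text \<open>Double counting of pairs (l, q) with q a left multiple of \<open>s l\<close>: an element
  outside m O is counted once, an element of m O once for every l. The scalar m is kept apart from
  the norm p because above 2 they are \<open>sqrt2\<close> and \<open>lambda2\<close>. Adding
  \<open>card M\<close> on both sides avoids subtraction of natural numbers.\<close>

lemma hecke_relation:
  assumes "finite L" and p: "p \<in> Z2" "p \<noteq> 0" and x: "x \<in> Z2"
    and s: "\<And>l. l \<in> L \<Longrightarrow> s l \<in> Omax \<and> nrd (s l) = p"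
    and all: "\<And>l q. l \<in> L \<Longrightarrow> q \<in> Omax \<Longrightarrow> m *\<^sub>q q \<in> (*) (s l) ` Omax"
    and unique: "\<And>q. q \<in> Omax \<Longrightarrow> p zdvd nrd q \<Longrightarrow> q \<notin> scaled_Omax m \<Longrightarrow>
      \<exists>!l. l \<in> L \<and> q \<in> (*) (s l) ` Omax"
  defines "M \<equiv> {q \<in> reps (p * x). q \<in> scaled_Omax m}"
  shows "card L * card (reps x) + card M = card (reps (p * x)) + card L * card M"
proof -
  let ?R = "reps (p * x)"
  have fin: "finite ?R" "finite M" "finite (?R - M)" by (simp_all add: finite_reps M_def)
  have MR: "M \<subseteq> ?R" by (auto simp: M_def)
  have "card L * card (reps x) = (\<Sum>l\<in>L. card {q \<in> ?R. q \<in> (*) (s l) ` Omax})"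
    using s p by (simp add: card_left_multiples)
  also have "\<dots> = (\<Sum>l\<in>L. \<Sum>q\<in>?R. if q \<in> (*) (s l) ` Omax then 1 else 0)"
    by (intro sum.cong refl) (simp add: sum.If_cases finite_reps Int_def)
  also have "\<dots> = (\<Sum>q\<in>?R. \<Sum>l\<in>L. if q \<in> (*) (s l) ` Omax then 1 else 0)" by (rule sum.swap)
  also have "\<dots> = (\<Sum>q\<in>?R. card {l \<in> L. q \<in> (*) (s l) ` Omax})"
    using assms(1) by (intro sum.cong refl) (simp add: sum.If_cases Int_def)
  also have "\<dots> = (\<Sum>q\<in>?R - M. card {l \<in> L. q \<in> (*) (s l) ` Omax}) + (\<Sum>q\<in>M. card {l \<in> L. q \<in> (*) (s l) ` Omax})"
    by (rule sum.subset_diff[OF MR fin(1)])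
  also have "(\<Sum>q\<in>?R - M. card {l \<in> L. q \<in> (*) (s l) ` Omax}) = (\<Sum>q\<in>?R - M. 1)"
  proof (rule sum.cong[OF refl])
    fix q assume q: "q \<in> ?R - M"
    then have "\<exists>!l. l \<in> L \<and> q \<in> (*) (s l) ` Omax"
      using x by (intro unique) (auto simp: M_def reps_def)
    then obtain l where "{l \<in> L. q \<in> (*) (s l) ` Omax} = {l}" by blast
    then show "card {l \<in> L. q \<in> (*) (s l) ` Omax} = 1" by simp
  qed
  also have "(\<Sum>q\<in>M. card {l \<in> L. q \<in> (*) (s l) ` Omax}) = (\<Sum>q\<in>M. card L)"
  proof (rule sum.cong[OF refl])
    fix q assume "q \<in> M"
    then have "{l \<in> L. q \<in> (*) (s l) ` Omax} = L" using all by (auto simp: M_def)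
    then show "card {l \<in> L. q \<in> (*) (s l) ` Omax} = card L" by simp
  qed
  finally have "card L * card (reps x) = card (?R - M) + card M * card L" by simp
  moreover have "card (?R - M) + card M = card ?R"
    using card_Diff_subset[OF fin(2) MR] card_mono[OF fin(1) MR] by simp
  ultimately show ?thesis by (simp add: mult.commute)
qed

section \<open>Totally positive units and associates\<close>

lemma tpos_qs_int: "tpos (qs (of_int a) (of_int b)) \<longleftrightarrow> a > 0 \<and> a^2 > 2 * b^2"
proof -
  let ?x = "qs (of_int a) (of_int b)"
  have e: "e1 ?x = of_int a + of_int b * sqrt 2" "e2 ?x = of_int a - of_int b * sqrt 2"
    by (simp_all add: e_qs)
  have prod: "e1 ?x * e2 ?x = of_int (a^2 - 2 * b^2)" by (simp add: e power2_eq_square algebra_simps)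
  show ?thesis
  proof
    assume t: "tpos ?x"
    then have "e1 ?x + e2 ?x > 0" "e1 ?x * e2 ?x > 0" by (simp_all add: tpos_def)
    then have "(of_int (2 * a) :: real) > 0" "(of_int (a^2 - 2 * b^2) :: real) > 0" by (simp_all only: prod) (simp add: e)
    then show "a > 0 \<and> a^2 > 2 * b^2" unfolding of_int_0_less_iff by simp
  next
    assume ab: "a > 0 \<and> a^2 > 2 * b^2"
    have "e1 ?x * e2 ?x > 0" using ab unfolding prod of_int_0_less_iff by simp
    moreover have "e1 ?x + e2 ?x > 0" using ab by (simp add: e)
    ultimately show "tpos ?x" unfolding tpos_def by (smt (verit) zero_less_mult_iff)
  qed
qed

text \<open>Descent on the second coordinate: division by the square of 1 + sqrt 2 makes it smaller
  until the unit is 1. Negative second coordinates are reduced to positive ones by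
  conjugation.\<close>

lemma tpos_unit_square_aux:
  fixes a b :: int
  assumes "a^2 - 2 * b^2 = 1" "a > 0"
  shows "\<exists>v\<in>Z2. qs (of_int a) (of_int b) = v * v"
  using assms
proof (induction "nat \<bar>b\<bar>" arbitrary: a b rule: less_induct)
  case less
  have main: "\<exists>v\<in>Z2. qs (of_int a) (of_int c) = v * v" if c: "\<bar>c\<bar> = \<bar>b\<bar>" "c > 0" for c
  proof -
    have ac: "a^2 - 2 * c^2 = 1" using less.prems(1) c by (metis power2_abs)
    \<comment> \<open>These are the coordinates of (a + c sqrt 2)(3 - 2 sqrt 2), where 3 - 2 sqrt 2
      is the inverse of (1 + sqrt 2)^2.\<close>
    define a' c' where "a' = 3 * a - 4 * c" and "c' = 3 * c - 2 * a"
    have 1: "a'^2 - 2 * c'^2 = 1" using ac by (simp add: a'_def c'_def power2_eq_square algebra_simps)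
    have sq: "c^2 \<ge> 1" using c(2) by (simp add: power2_eq_square) (smt (verit) mult_le_cancel_left1)
    have "(4 * c)^2 < (3 * a)^2" using ac sq by (simp add: power2_eq_square)
    then have "4 * c < 3 * a" using power2_less_imp_less[of "4 * c" "3 * a"] less.prems(2) by simp
    then have 2: "a' > 0" by (simp add: a'_def)
    have "a^2 < (2 * c)^2" using ac sq by (simp add: power2_eq_square)
    then have "a < 2 * c" using c power2_less_imp_less[of a "2 * c"] by simp
    moreover have "c^2 < a^2" using ac sq by simp
    then have "c < a" using less.prems(2) power2_less_imp_less[of c a] by simp
    ultimately have "\<bar>c'\<bar> < c" by (simp add: c'_def)
    then have "nat \<bar>c'\<bar> < nat \<bar>b\<bar>" using c by simp
    from less.hyps[OF this 1 2] obtain v where v: "v \<in> Z2" "qs (of_int a') (of_int c') = v * v" by blast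
    have "qs (of_int a) (of_int c) = qs (of_int a') (of_int c') * (qs 1 1 * qs 1 1)"
      by (simp add: a'_def c'_def)
    also have "\<dots> = (v * qs 1 1) * (v * qs 1 1)" by (simp only: v ac_simps)
    finally show ?thesis using v(1) Z2_qs[of 1 1] by (intro bexI[of _ "v * qs 1 1"]) simp_all
  qed
  consider "b = 0" | "b > 0" | "b < 0" by linarith
  then show ?case
  proof cases
    case 1
    then have "a^2 = 1" using less.prems by simp
    then have "a = 1" using less.prems(2) by (auto simp: power2_eq_1_iff)
    then show ?thesis using 1 by (intro bexI[of _ 1]) (simp_all add: qs_one[symmetric])
  next
    case 2
    then show ?thesis using main[of b] by simp
  next
    case 3
    then obtain v where v: "v \<in> Z2" "qs (of_int a) (of_int (- b)) = v * v" using main[of "- b"] by auto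
    have "qs (of_int a) (of_int b) = conj2 (qs (of_int a) (of_int (- b)))" by simp
    also have "\<dots> = conj2 v * conj2 v" by (simp only: v conj2_mult)
    finally show ?thesis using v(1) by (intro bexI[of _ "conj2 v"]) simp_all
  qed
qed

text \<open>The square root is a scalar by which a quaternion can be divided. This turns a norm that
  is correct up to a totally positive unit into the exact one.\<close>

lemma tpos_unit_square:
  assumes "u \<in> Z2" "u zdvd 1" "tpos u"
  shows "\<exists>v\<in>Z2. \<exists>w\<in>Z2. u = v * v \<and> v * w = 1"
proof -
  obtain a b where u: "u = qs (of_int a) (of_int b)" using assms(1) by (rule Z2_cases)
  then have ab: "a > 0" "a^2 > 2 * b^2" using assms(3) tpos_qs_int by auto
  have "\<bar>nm u\<bar> = 1" using inm_Z2[OF assms(1)] unit_iff_inm[OF assms(1)] assms(2) by simp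
  then have "\<bar>a^2 - 2 * b^2\<bar> = 1" unfolding u nm_qs by (simp flip: of_int_power of_int_mult of_int_diff of_int_abs)
  then have "a^2 - 2 * b^2 = 1" using ab by simp
  then obtain v where v: "v \<in> Z2" "u = v * v"
    using tpos_unit_square_aux[OF _ ab(1)] unfolding u by metis
  obtain c where c: "c \<in> Z2" "1 = u * c" using assms(2) by (auto simp: zdvd_def)
  then have "v * (v * c) = 1" by (simp add: v(2) mult.assoc)
  then show ?thesis using v c(1) by (intro bexI[of _ v] bexI[of _ "v * c"]) simp_all
qed

text \<open>The fundamental unit \<open>1 + sqrt 2\<close> has norm -1, so every element has a totally positive associate.\<close>

lemma tpos_associate:
  assumes "x \<in> Z2" "x \<noteq> 0"
  shows "\<exists>u\<in>Z2. \<exists>v\<in>Z2. u * v = 1 \<and> tpos (u * x)"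
proof -
  have e: "e1 x \<noteq> 0" "e2 x \<noteq> 0" using assms by (simp_all add: e_zero_iff)
  have s: "sqrt 2 > 1" by simp
  have r: "e1 (qs 1 1) > 0" "e2 (qs 1 1) < 0" using s by (simp_all add: e_qs del: real_sqrt_gt_1_iff)
  have Z: "qs 1 1 \<in> Z2" "qs (-1) 1 \<in> Z2" "qs (-1) (-1) \<in> Z2" "qs 1 (-1) \<in> Z2"
    using Z2_qs[of 1 1] Z2_qs[of "-1" 1] Z2_qs[of "-1" "-1"] Z2_qs[of 1 "-1"] by simp_all
  have inv: "qs 1 1 * qs (-1) 1 = 1" "qs (-1) (-1) * qs 1 (-1) = 1" by (simp_all add: qs_one)
  have m: "e1 (qs (-1) (-1)) < 0" "e2 (qs (-1) (-1)) > 0" "e1 (-1) = -1" "e2 (-1) = -1"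
    using s e_qs[of "-1" 0] by (simp_all add: e_qs qs_one of_rat_minus del: real_sqrt_gt_1_iff)
  consider "e1 x > 0" "e2 x > 0" | "e1 x > 0" "e2 x < 0" | "e1 x < 0" "e2 x > 0" | "e1 x < 0" "e2 x < 0"
    using e by linarith
  then show ?thesis
  proof cases
    case 1
    then show ?thesis by (intro bexI[of _ 1] bexI[of _ 1]) (simp_all add: tpos_def)
  next
    case 2
    then show ?thesis using r Z inv
      by (intro bexI[of _ "qs 1 1"] bexI[of _ "qs (-1) 1"]) (simp_all add: tpos_def e_mult mult_neg_neg del: qs_mult)
  next
    case 3
    then show ?thesis using m Z inv
      by (intro bexI[of _ "qs (-1) (-1)"] bexI[of _ "qs 1 (-1)"]) (simp_all add: tpos_def e_mult mult_neg_neg del: qs_mult)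
  next
    case 4
    then show ?thesis using m e_mult[of "-1" x] Z2_uminus[OF Z2_consts(2)]
      by (intro bexI[of _ "-1"] bexI[of _ "-1"]) (simp_all add: tpos_def)
  qed
qed

lemma reps_unit_square:
  assumes "v \<in> Z2" "w \<in> Z2" "v * w = 1"
  shows "card (reps (v * v * x)) = card (reps x)"
proof -
  have v0: "v \<noteq> 0" using assms(3) by auto
  have "reps (v * v * x) \<subseteq> scaled_Omax v"
  proof
    fix q assume "q \<in> reps (v * v * x)"
    then have "q = v *\<^sub>q (w *\<^sub>q q)" "w *\<^sub>q q \<in> Omax" using assms by (simp_all add: reps_def)
    then show "q \<in> scaled_Omax v" by blast
  qed
  then have "{q \<in> reps (v^2 * x). q \<in> scaled_Omax v} = reps (v * v * x)"
    by (auto simp: power2_eq_square)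
  then show ?thesis using card_scaled_reps[OF assms(1) v0, of x] by simp
qed

section \<open>The maximal order modulo an odd prime\<close>

text \<open>Pigeonhole: for l = 2 k + 1 the k + 1 squares of 0, ..., k and the k + 1 values -1 - x^2
  cannot all be distinct modulo l.\<close>

lemma minus_one_sum_two_squares_mod:
  fixes l :: int
  assumes l: "Factorial_Ring.prime l" "odd l"
  shows "\<exists>a b. l dvd a^2 + b^2 + 1"
proof -
  have l1: "l > 1" using l(1) prime_gt_1_int by blast
  obtain k where k: "l = 2 * k + 1" using l(2) by (rule oddE)
  then have k0: "k \<ge> 0" using l1 by simp
  define f g where "f x = x^2 mod l" and "g x = (- 1 - x^2) mod l" for x :: int
  have sq: "x = y" if "x \<in> {0..k}" "y \<in> {0..k}" "l dvd x^2 - y^2" for x y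
  proof -
    have "l dvd (x - y) * (x + y)" using that(3) by (simp add: power2_eq_square algebra_simps)
    then have "l dvd x - y \<or> l dvd x + y" using l(1) prime_dvd_multD by blast
    then have "x - y = 0 \<or> x + y = 0"
      using that(1,2) k dvd_imp_le_int[of "x - y" l] dvd_imp_le_int[of "x + y" l]
      unfolding atLeastAtMost_iff by linarith
    then show ?thesis using that(1,2) by auto
  qed
  have injf: "inj_on f {0..k}" unfolding f_def
    by (intro inj_onI sq) (auto simp: mod_eq_dvd_iff)
  have injg: "inj_on g {0..k}" unfolding g_def
    by (intro inj_onI sq[symmetric]) (auto simp: mod_eq_dvd_iff)
  have "f ` {0..k} \<inter> g ` {0..k} \<noteq> {}"
  proof
    assume disj: "f ` {0..k} \<inter> g ` {0..k} = {}"
    have "card (f ` {0..k} \<union> g ` {0..k}) = card {0..k} + card {0..k}"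
      using disj by (simp add: card_Un_disjoint card_image[OF injf] card_image[OF injg])
    moreover have "f ` {0..k} \<union> g ` {0..k} \<subseteq> {0..<l}" using l1 by (auto simp: f_def g_def)
    then have "card (f ` {0..k} \<union> g ` {0..k}) \<le> card {0..<l}" by (intro card_mono) simp_all
    ultimately show False using k k0 by simp
  qed
  then obtain a b where "f a = g b" by blast
  then have "l dvd a^2 - (- 1 - b^2)" by (simp add: f_def g_def mod_eq_dvd_iff)
  then have "l dvd a^2 + b^2 + 1" by (simp add: algebra_simps)
  then show ?thesis by blast
qed

lemma odd_zprime_not_dvd_two:
  assumes "zprime p" "\<not> sqrt2 zdvd p" shows "\<not> p zdvd 2"
proof
  assume "p zdvd 2"
  then have "p zdvd sqrt2 * sqrt2" by (simp add: sqrt2_squared)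
  then have "p zdvd sqrt2 * 1" using zprime_mult[OF assms(1)] by simp
  moreover have "\<not> p zdvd 1" "p \<in> Z2" using assms(1) by (simp_all add: zprime_def)
  ultimately show False
    using zdvd_coprime_prime[OF zprime_sqrt2 _ assms(2) Z2_consts(2)] by blast
qed

lemma of_int_zdvd: "m dvd n \<Longrightarrow> of_int m zdvd of_int n"
  by (auto simp: zdvd_def dvd_def)

text \<open>The integer \<open>p * conj2 p\<close> is a multiple of \<open>p\<close>; being prime,
  \<open>p\<close> divides one of its rational prime factors.\<close>

lemma zprime_over_int_prime:
  assumes p: "zprime p"
  shows "\<exists>l::int. Factorial_Ring.prime l \<and> p zdvd of_int l"
proof -
  have pZ: "p \<in> Z2" "p \<noteq> 0" "\<not> p zdvd 1" using p by (simp_all add: zprime_def)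
  have *: "p zdvd of_int (int n) \<Longrightarrow> n > 0 \<Longrightarrow> ?thesis" for n
  proof (induction n rule: less_induct)
    case (less n)
    show ?case
    proof (cases "n = 1")
      case True
      then show ?thesis using less pZ by simp
    next
      case False
      then obtain l where l: "Factorial_Ring.prime l" "l dvd n" using prime_factor_nat by blast
      then obtain m where m: "n = l * m" by blast
      have "of_int (int n) = of_int (int l) * (of_int (int m) :: qsqrt2)" by (simp add: m)
      then have "p zdvd of_int (int l) * of_int (int m)" using less.prems(1) by metis
      then have "p zdvd of_int (int l) \<or> p zdvd of_int (int m)"
        using zprime_mult[OF p Z2_consts(4) Z2_consts(4)] by blast
      moreover have "m < n" "m > 0" using l less.prems m by (auto dest: prime_gt_1_nat)
      ultimately show ?thesis using l(1) less.IH by (metis prime_nat_int_transfer)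
    qed
  qed
  obtain k where k: "nm p = of_int k" using nm_Z2[OF pZ(1)] by blast
  have k0: "k \<noteq> 0" using k pZ(2) nm_eq_zero[of p] by auto
  have "p zdvd p * conj2 p" using pZ by simp
  then have "p zdvd of_int k" by (simp add: mult_conj2 k)
  moreover have "of_int k zdvd of_int (int (nat \<bar>k\<bar>))" by (rule of_int_zdvd) simp
  ultimately have "p zdvd of_int (int (nat \<bar>k\<bar>))" by (rule zdvd_trans)
  then show ?thesis by (rule *) (use k0 in simp)
qed

lemma zprime_minus_one_sum_two_squares:
  assumes "zprime p" "\<not> sqrt2 zdvd p"
  shows "\<exists>a\<in>Z2. \<exists>b\<in>Z2. p zdvd a^2 + b^2 + 1"
proof -
  obtain l :: int where l: "Factorial_Ring.prime l" "p zdvd of_int l" using zprime_over_int_prime[OF assms(1)] by blast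
  have "odd l"
  proof
    assume "even l"
    then have "of_int l zdvd of_int 2" using l(1) primes_dvd_imp_eq[of 2 l] by simp
    then show False using odd_zprime_not_dvd_two[OF assms] zdvd_trans[OF l(2)] by simp
  qed
  then obtain a b where "l dvd a^2 + b^2 + 1" using minus_one_sum_two_squares_mod l(1) by blast
  then have "of_int l zdvd of_int (a^2 + b^2 + 1)" by (rule of_int_zdvd)
  then have "p zdvd (of_int a)^2 + (of_int b)^2 + 1" using zdvd_trans[OF l(2)] by simp
  then show ?thesis using Z2_consts(4) by blast
qed

text \<open>The entries of twice the image of a quaternion under
  \<open>i \<mapsto> [[a, b], [b, - a]]\<close>, \<open>j \<mapsto> [[0, 1], [- 1, 0]]\<close>, which is multiplicative modulo \<open>a\<^sup>2 + b\<^sup>2 + 1\<close>.\<close>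

fun m11 m12 m21 m22 :: "qsqrt2 \<Rightarrow> qsqrt2 \<Rightarrow> qsqrt2 quat \<Rightarrow> qsqrt2" where
  "m11 a b (Quat t x y z) = 2 * (t + x * a - z * b)"
| "m12 a b (Quat t x y z) = 2 * (x * b + y + z * a)"
| "m21 a b (Quat t x y z) = 2 * (x * b - y + z * a)"
| "m22 a b (Quat t x y z) = 2 * (t - x * a + z * b)"

text \<open>Elements of \<open>Omax\<close> are only half-integral, which is why the matrix entries
  \<open>m11\<close>, ..., \<open>m22\<close> carry a factor 2. The powers of 2 that this introduces
  are invertible modulo an odd prime.\<close>

lemma Omax_double_coords:
  assumes "Quat t x y z \<in> Omax"
  shows "2 * t \<in> Z2" "2 * x \<in> Z2" "2 * y \<in> Z2" "2 * z \<in> Z2"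
proof -
  have h: "2 * qs (of_int a / 2) (of_int b / 2) \<in> Z2" for a b
    by (simp add: qs_numeral)
  show "2 * t \<in> Z2" "2 * x \<in> Z2" "2 * y \<in> Z2" "2 * z \<in> Z2"
    using assms by (auto simp: Omax_def Oq_def h simp del: qs_mult of_int_add of_int_mult of_int_diff)
qed

lemma Z2_quat_Omax:
  assumes "t \<in> Z2" "x \<in> Z2" "y \<in> Z2" "z \<in> Z2" shows "Quat t x y z \<in> Omax"
proof -
  have i: "quat_i = Oq 0 1 0 0 0 0 0 0" "quat_j = Oq 0 0 1 0 0 0 0 0" "quat_k = Oq 0 0 0 1 0 0 0 0"
    by (simp_all add: quat_i_def quat_j_def quat_k_def Oq_def qs_consts)
  show ?thesis unfolding quat_basis[of t] i using assms by (intro Omax_add Omax_scale Omax_one Oq_in_Omax)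
qed

lemma m_Z2:
  assumes "q \<in> Omax" "a \<in> Z2" "b \<in> Z2"
  shows "m11 a b q \<in> Z2" "m12 a b q \<in> Z2" "m21 a b q \<in> Z2" "m22 a b q \<in> Z2"
proof -
  obtain t x y z where q: "q = Quat t x y z" by (cases q)
  note Z = Omax_double_coords[OF assms(1)[unfolded q]]
  have "m11 a b q = 2 * t + 2 * x * a - 2 * z * b" "m12 a b q = 2 * x * b + 2 * y + 2 * z * a"
    "m21 a b q = 2 * x * b - 2 * y + 2 * z * a" "m22 a b q = 2 * t - 2 * x * a + 2 * z * b"
    by (simp_all add: q algebra_simps)
  then show "m11 a b q \<in> Z2" "m12 a b q \<in> Z2" "m21 a b q \<in> Z2" "m22 a b q \<in> Z2"
    using Z assms(2,3) by simp_all
qed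

lemma m_diff:
  "m11 a b (p - q) = m11 a b p - m11 a b q" "m12 a b (p - q) = m12 a b p - m12 a b q"
  "m21 a b (p - q) = m21 a b p - m21 a b q" "m22 a b (p - q) = m22 a b p - m22 a b q"
  by (cases p; cases q; simp add: minus_quat_def algebra_simps)+

lemma m_scale:
  "m11 a b (c *\<^sub>q q) = c * m11 a b q" "m12 a b (c *\<^sub>q q) = c * m12 a b q"
  "m21 a b (c *\<^sub>q q) = c * m21 a b q" "m22 a b (c *\<^sub>q q) = c * m22 a b q"
  by (cases q; simp add: algebra_simps)+

text \<open>A product of two doubled entries is four times a true one, hence the factor 2 before the
  doubled entry of \<open>q * q'\<close>. The error term arises because the matrices of i and k have
  square \<open>a^2 + b^2\<close> instead of -1, so only the coordinates x and z enter it.\<close>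

lemma m_mult:
  assumes "q \<in> Omax" "q' \<in> Omax"
  shows "\<exists>c\<in>Z2. m11 a b q * m11 a b q' + m12 a b q * m21 a b q' = 2 * m11 a b (q * q') + (a^2 + b^2 + 1) * c"
    and "\<exists>c\<in>Z2. m11 a b q * m12 a b q' + m12 a b q * m22 a b q' = 2 * m12 a b (q * q') + (a^2 + b^2 + 1) * c"
    and "\<exists>c\<in>Z2. m21 a b q * m11 a b q' + m22 a b q * m21 a b q' = 2 * m21 a b (q * q') + (a^2 + b^2 + 1) * c"
    and "\<exists>c\<in>Z2. m21 a b q * m12 a b q' + m22 a b q * m22 a b q' = 2 * m22 a b (q * q') + (a^2 + b^2 + 1) * c"
proof -
  obtain t x y z where q: "q = Quat t x y z" by (cases q)
  obtain t' x' y' z' where q': "q' = Quat t' x' y' z'" by (cases q')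
  note Z = Omax_double_coords[OF assms(1)[unfolded q]] Omax_double_coords[OF assms(2)[unfolded q']]
  show "\<exists>c\<in>Z2. m11 a b q * m11 a b q' + m12 a b q * m21 a b q' = 2 * m11 a b (q * q') + (a^2 + b^2 + 1) * c"
    by (rule bexI[of _ "2 * x * (2 * x') + 2 * z * (2 * z')"]; (intro Z2_closed Z)?; simp add: q q' power2_eq_square algebra_simps)
  show "\<exists>c\<in>Z2. m11 a b q * m12 a b q' + m12 a b q * m22 a b q' = 2 * m12 a b (q * q') + (a^2 + b^2 + 1) * c"
    by (rule bexI[of _ "2 * x * (2 * z') - 2 * z * (2 * x')"]; (intro Z2_closed Z)?; simp add: q q' power2_eq_square algebra_simps)
  show "\<exists>c\<in>Z2. m21 a b q * m11 a b q' + m22 a b q * m21 a b q' = 2 * m21 a b (q * q') + (a^2 + b^2 + 1) * c"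
    by (rule bexI[of _ "2 * z * (2 * x') - 2 * x * (2 * z')"]; (intro Z2_closed Z)?; simp add: q q' power2_eq_square algebra_simps)
  show "\<exists>c\<in>Z2. m21 a b q * m12 a b q' + m22 a b q * m22 a b q' = 2 * m22 a b (q * q') + (a^2 + b^2 + 1) * c"
    by (rule bexI[of _ "2 * x * (2 * x') + 2 * z * (2 * z')"]; (intro Z2_closed Z)?; simp add: q q' power2_eq_square algebra_simps)
qed

lemma m_det:
  assumes "q \<in> Omax"
  shows "\<exists>c\<in>Z2. m11 a b q * m22 a b q - m12 a b q * m21 a b q = 2 * 2 * nrd q - (a^2 + b^2 + 1) * c"
proof -
  obtain t x y z where q: "q = Quat t x y z" by (cases q)
  note Z = Omax_double_coords[OF assms(1)[unfolded q]]
  show ?thesis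
    by (rule bexI[of _ "2 * x * (2 * x) + 2 * z * (2 * z)"]; (intro Z2_closed Z)?; simp add: q power2_eq_square algebra_simps)
qed

section \<open>Right ideals above an odd prime\<close>

locale odd_zprime =
  fixes p a b :: qsqrt2
  assumes prime: "zprime p" and odd: "\<not> sqrt2 zdvd p" and pos: "tpos p"
    and aZ: "a \<in> Z2" and bZ: "b \<in> Z2" and ab: "p zdvd a^2 + b^2 + 1"
begin

lemma pZ: "p \<in> Z2" "p \<noteq> 0" "\<not> p zdvd 1"
  using prime by (simp_all add: zprime_def)

lemma not_dvd_two: "\<not> p zdvd 2"
  by (rule odd_zprime_not_dvd_two[OF prime odd])

lemma mult_iff: "x \<in> Z2 \<Longrightarrow> y \<in> Z2 \<Longrightarrow> p zdvd x * y \<longleftrightarrow> p zdvd x \<or> p zdvd y"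
  by (rule zprime_mult[OF prime])

lemma two_mult_iff: "x \<in> Z2 \<Longrightarrow> p zdvd 2 * x \<longleftrightarrow> p zdvd x"
  using mult_iff[of 2 x] not_dvd_two by simp

abbreviation "a11 \<equiv> m11 a b"
abbreviation "a12 \<equiv> m12 a b"
abbreviation "a21 \<equiv> m21 a b"
abbreviation "a22 \<equiv> m22 a b"

lemmas aZ2 = m_Z2[OF _ aZ bZ]

text \<open>The row vector \<open>l\<close> annihilates the matrix of \<open>q\<close> from the left
  modulo \<open>p\<close>. Right multiplication preserves this, so each point of the projective line
  over the residue field gives a right ideal between p O and O.\<close>

definition line_ideal :: "qsqrt2 \<times> qsqrt2 \<Rightarrow> qsqrt2 quat set" where
  "line_ideal l = {q \<in> Omax. p zdvd fst l * a11 q + snd l * a21 q \<and> p zdvd fst l * a12 q + snd l * a22 q}"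

lemma line_ideal_right_mult:
  assumes l: "l \<in> Z2 \<times> Z2" and q: "q \<in> line_ideal l" and r: "r \<in> Omax"
  shows "q * r \<in> line_ideal l"
proof -
  obtain c d where l': "l = (c, d)" by (cases l)
  have cd: "c \<in> Z2" "d \<in> Z2" using l by (simp_all add: l')
  have qO: "q \<in> Omax" and h: "p zdvd c * a11 q + d * a21 q" "p zdvd c * a12 q + d * a22 q"
    using q by (simp_all add: line_ideal_def l')
  obtain u11 u12 u21 u22 where u: "u11 \<in> Z2" "u12 \<in> Z2" "u21 \<in> Z2" "u22 \<in> Z2"
    "a11 q * a11 r + a12 q * a21 r = 2 * a11 (q * r) + (a^2 + b^2 + 1) * u11"
    "a11 q * a12 r + a12 q * a22 r = 2 * a12 (q * r) + (a^2 + b^2 + 1) * u12"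
    "a21 q * a11 r + a22 q * a21 r = 2 * a21 (q * r) + (a^2 + b^2 + 1) * u21"
    "a21 q * a12 r + a22 q * a22 r = 2 * a22 (q * r) + (a^2 + b^2 + 1) * u22"
    using m_mult[OF qO r, of a b] by blast
  note Z = aZ2[OF qO] aZ2[OF r] aZ2[OF Omax_mult[OF qO r]]
  have "2 * (c * a11 (q * r) + d * a21 (q * r)) =
      c * (2 * a11 (q * r) + (a^2 + b^2 + 1) * u11) + d * (2 * a21 (q * r) + (a^2 + b^2 + 1) * u21)
      - (a^2 + b^2 + 1) * (c * u11 + d * u21)" by (simp add: algebra_simps)
  also have "\<dots> = (c * a11 q + d * a21 q) * a11 r + (c * a12 q + d * a22 q) * a21 r
      - (a^2 + b^2 + 1) * (c * u11 + d * u21)" unfolding u(5,7)[symmetric] by (simp add: algebra_simps)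
  finally have e1: "2 * (c * a11 (q * r) + d * a21 (q * r)) = \<dots>" .
  have "2 * (c * a12 (q * r) + d * a22 (q * r)) =
      c * (2 * a12 (q * r) + (a^2 + b^2 + 1) * u12) + d * (2 * a22 (q * r) + (a^2 + b^2 + 1) * u22)
      - (a^2 + b^2 + 1) * (c * u12 + d * u22)" by (simp add: algebra_simps)
  also have "\<dots> = (c * a11 q + d * a21 q) * a12 r + (c * a12 q + d * a22 q) * a22 r
      - (a^2 + b^2 + 1) * (c * u12 + d * u22)" unfolding u(6,8)[symmetric] by (simp add: algebra_simps)
  finally have e2: "2 * (c * a12 (q * r) + d * a22 (q * r)) = \<dots>" .
  have "p zdvd 2 * (c * a11 (q * r) + d * a21 (q * r))" "p zdvd 2 * (c * a12 (q * r) + d * a22 (q * r))"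
    unfolding e1 e2 using u(1-4) cd Z by (intro zdvd_diff zdvd_add zdvd_mult[OF h(1)] zdvd_mult[OF h(2)] zdvd_mult[OF ab]; simp)+
  then show ?thesis
    using cd Z qO r two_mult_iff[of "c * a11 (q * r) + d * a21 (q * r)"] two_mult_iff[of "c * a12 (q * r) + d * a22 (q * r)"]
    by (simp add: line_ideal_def l' del: distrib_left_numeral)
qed

lemma line_ideal_diff:
  assumes "q \<in> line_ideal l" "r \<in> line_ideal l" shows "q - r \<in> line_ideal l"
proof -
  have e: "c * (a11 q - a11 r) + d * (a21 q - a21 r) = (c * a11 q + d * a21 q) - (c * a11 r + d * a21 r)"
    "c * (a12 q - a12 r) + d * (a22 q - a22 r) = (c * a12 q + d * a22 q) - (c * a12 r + d * a22 r)" for c d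
    by (simp_all add: algebra_simps)
  show ?thesis using assms unfolding line_ideal_def mem_Collect_eq m_diff e by (auto intro: zdvd_diff)
qed

lemma scaled_in_line_ideal:
  assumes "l \<in> Z2 \<times> Z2" "q \<in> Omax" shows "p *\<^sub>q q \<in> line_ideal l"
proof -
  have e: "c * (p * x) + d * (p * y) = p * (c * x + d * y)" for c d x y :: qsqrt2 by (simp add: algebra_simps)
  show ?thesis using assms aZ2[OF assms(2)] pZ unfolding line_ideal_def mem_Collect_eq m_scale e by auto
qed

text \<open>Injectivity of the matrix map on O / p O: the entries determine four times the
  coordinates, and 4 is invertible modulo \<open>p\<close>.\<close>

lemma in_scaled_Omax:
  assumes q: "q \<in> Omax" and m: "p zdvd a11 q" "p zdvd a12 q" "p zdvd a21 q" "p zdvd a22 q"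
  shows "q \<in> scaled_Omax p"
proof -
  obtain t x y z where qq: "q = Quat t x y z" by (cases q)
  note Z = Omax_double_coords[OF q[unfolded qq]]
  define \<mu> \<nu> where "\<mu> = a11 q - a22 q" and "\<nu> = a12 q + a21 q"
  have \<mu>\<nu>: "p zdvd \<mu>" "p zdvd \<nu>" using m by (auto simp: \<mu>_def \<nu>_def intro: zdvd_add zdvd_diff)
  have t: "4 * t = a11 q + a22 q" and y: "4 * y = a12 q - a21 q" by (simp_all add: qq)
  \<comment> \<open>The combinations \<open>\<mu> * a + \<nu> * b\<close> and
    \<open>\<nu> * a - \<mu> * b\<close> are \<open>4 * (a^2 + b^2)\<close> times x and z, and
    \<open>a^2 + b^2\<close> is -1 modulo \<open>p\<close>.\<close>
  have x: "4 * x = (a^2 + b^2 + 1) * (2 * (2 * x)) - (\<mu> * a + \<nu> * b)"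
    and z: "4 * z = (a^2 + b^2 + 1) * (2 * (2 * z)) - (\<nu> * a - \<mu> * b)"
    by (simp_all add: \<mu>_def \<nu>_def qq power2_eq_square algebra_simps)
  have "p zdvd 4 * t" "p zdvd 4 * y" unfolding t y using m by (auto intro: zdvd_add zdvd_diff)
  moreover have xz: "2 * (2 * x) \<in> Z2" "2 * (2 * z) \<in> Z2" by (intro Z2_closed Z Z2_consts)+
  moreover have "p zdvd 4 * x" unfolding x by (intro zdvd_diff zdvd_add zdvd_mult \<mu>\<nu> ab aZ bZ xz)
  moreover have "p zdvd 4 * z" unfolding z by (intro zdvd_diff zdvd_add zdvd_mult \<mu>\<nu> ab aZ bZ xz)
  ultimately obtain t' x' y' z' where c: "t' \<in> Z2" "x' \<in> Z2" "y' \<in> Z2" "z' \<in> Z2"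
    "4 * t = p * t'" "4 * x = p * x'" "4 * y = p * y'" "4 * z = p * z'" unfolding zdvd_def by blast
  have 4: "4 *\<^sub>q q = p *\<^sub>q Quat t' x' y' z'" by (simp add: qq c)
  have "\<not> p zdvd 4" using mult_iff[of 2 2] not_dvd_two by simp
  then obtain u where u: "u \<in> Z2" "p zdvd 4 * u - 1" using zprime_inverse[OF prime, of 4] by auto
  then obtain w where w: "w \<in> Z2" "4 * u - 1 = p * w" by (auto simp: zdvd_def)
  \<comment> \<open>Only 4 q is known to be p times an integral quaternion. Since
    \<open>4 * u - 1\<close> is a multiple of \<open>p\<close>, writing q as u (4 q) - (4 u - 1) q
    exhibits it as p times an element of \<open>Omax\<close>.\<close>
  have "q = (u * 4 - (4 * u - 1)) *\<^sub>q q" by simp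
  also have "\<dots> = u *\<^sub>q (4 *\<^sub>q q) - (p * w) *\<^sub>q q"
    unfolding w(2) by (cases q) (simp add: minus_quat_def algebra_simps)
  also have "\<dots> = p *\<^sub>q (u *\<^sub>q Quat t' x' y' z' - w *\<^sub>q q)"
    unfolding 4 by (cases q) (simp add: minus_quat_def algebra_simps)
  finally have "q = p *\<^sub>q (u *\<^sub>q Quat t' x' y' z' - w *\<^sub>q q)" .
  moreover have "u *\<^sub>q Quat t' x' y' z' - w *\<^sub>q q \<in> Omax"
    using q u(1) w(1) c(1-4) by (intro Omax_diff Omax_scale Z2_quat_Omax)
  ultimately show ?thesis by (rule image_eqI)
qed

lemma det_dvd: assumes "q \<in> Omax" shows "p zdvd nrd q \<longleftrightarrow> p zdvd a11 q * a22 q - a12 q * a21 q"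
proof -
  obtain c where c: "c \<in> Z2" "a11 q * a22 q - a12 q * a21 q = 2 * 2 * nrd q - (a^2 + b^2 + 1) * c"
    using m_det[OF assms, of a b] by blast
  have N: "nrd q \<in> Z2" using assms by (rule nrd_Omax)
  have d: "p zdvd (a^2 + b^2 + 1) * c" using ab c(1) by (rule zdvd_mult)
  have "p zdvd nrd q \<longleftrightarrow> p zdvd 2 * (2 * nrd q)" using two_mult_iff[OF N] two_mult_iff[of "2 * nrd q"] N
    by (simp only: Z2_closed(2) Z2_consts(5))
  also have "\<dots> \<longleftrightarrow> p zdvd 2 * 2 * nrd q - (a^2 + b^2 + 1) * c"
    using zdvd_diff[OF _ d, of "2 * 2 * nrd q"] zdvd_add[OF _ d, of "2 * 2 * nrd q - (a^2 + b^2 + 1) * c"]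
    by (auto simp: mult.assoc)
  finally show ?thesis unfolding c(2) .
qed

end

context odd_zprime
begin

text \<open>A vector that is nonzero modulo \<open>p\<close> annihilates the matrix, so the
  determinant vanishes modulo \<open>p\<close>; the identities \<open>e\<close> in the proof are
  Cramer's rule.\<close>

lemma line_ideal_nrd:
  assumes l: "l \<in> Z2 \<times> Z2" "\<not> (p zdvd fst l \<and> p zdvd snd l)" and q: "q \<in> line_ideal l"
  shows "p zdvd nrd q"
proof -
  obtain c d where l': "l = (c, d)" by (cases l)
  have cd: "c \<in> Z2" "d \<in> Z2" using l by (simp_all add: l')
  have qO: "q \<in> Omax" and h: "p zdvd c * a11 q + d * a21 q" "p zdvd c * a12 q + d * a22 q"
    using q by (simp_all add: line_ideal_def l')
  note Z = aZ2[OF qO]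
  let ?D = "a11 q * a22 q - a12 q * a21 q"
  have e: "c * ?D = (c * a11 q + d * a21 q) * a22 q - (c * a12 q + d * a22 q) * a21 q"
    "d * ?D = (c * a12 q + d * a22 q) * a11 q - (c * a11 q + d * a21 q) * a12 q"
    by (simp_all add: algebra_simps)
  have "p zdvd c * ?D" "p zdvd d * ?D" unfolding e using Z by (intro zdvd_diff zdvd_mult[OF h(1)] zdvd_mult[OF h(2)]; simp)+
  moreover have "?D \<in> Z2" using Z by simp
  ultimately have "p zdvd ?D" using l(2) cd by (auto simp: mult_iff l')
  then show ?thesis using det_dvd[OF qO] by simp
qed

lemma line_ideal_nontrivial:
  assumes l: "l \<in> Z2 \<times> Z2" "\<not> (p zdvd fst l \<and> p zdvd snd l)"
  shows "\<exists>q\<in>line_ideal l. q \<notin> scaled_Omax p"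
proof -
  obtain c d where l': "l = (c, d)" by (cases l)
  have cd: "c \<in> Z2" "d \<in> Z2" using l by (simp_all add: l')
  \<comment> \<open>Modulo \<open>a^2 + b^2 + 1\<close> the doubled matrix of this element has first
    column (4 d, - 4 c), orthogonal to (c, d), and second column 0. It is nonzero modulo
    \<open>p\<close> because \<open>p\<close> is odd.\<close>
  define q where "q = Quat d (c * b - d * a) c (c * a + d * b)"
  have qO: "q \<in> Omax" unfolding q_def using cd aZ bZ by (intro Z2_quat_Omax) simp_all
  let ?N = "a^2 + b^2 + 1"
  have m: "a11 q = 4 * d - 2 * d * ?N" "a12 q = 2 * c * ?N" "a21 q = 2 * c * ?N - 4 * c" "a22 q = 2 * d * ?N"
    by (simp_all add: q_def power2_eq_square algebra_simps)
  have e: "c * a11 q + d * a21 q = 0" "c * a12 q + d * a22 q = ?N * (2 * c * c + 2 * d * d)"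
    unfolding m by (simp_all add: algebra_simps)
  have "q \<in> line_ideal l"
    unfolding line_ideal_def mem_Collect_eq l' fst_conv snd_conv e
    using qO cd by (auto intro: zdvd_mult[OF ab])
  moreover have "q \<notin> scaled_Omax p"
  proof
    assume "q \<in> scaled_Omax p"
    then obtain r where r: "r \<in> Omax" "q = p *\<^sub>q r" by blast
    then have "p zdvd a11 q" "p zdvd a21 q" using aZ2[OF r(1)] by (simp_all add: m_scale)
    moreover have "2 * (2 * d) = a11 q + ?N * (2 * d)" "2 * (2 * c) = ?N * (2 * c) - a21 q"
      unfolding m by (simp_all add: algebra_simps)
    ultimately have "p zdvd 2 * (2 * d)" "p zdvd 2 * (2 * c)"
      using zdvd_mult[OF ab] cd by (metis zdvd_add Z2_closed(2) Z2_consts(5), metis zdvd_diff Z2_closed(2) Z2_consts(5))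
    then have "p zdvd d" "p zdvd c" using cd two_mult_iff Z2_closed(2) Z2_consts(5) by metis+
    then show False using l(2) by (simp add: l')
  qed
  ultimately show ?thesis by blast
qed

text \<open>A generator s has norm \<open>p * u\<close>, and membership of \<open>p\<close> in the
  ideal yields \<open>p = u * nrd t\<close>, so one of these two factors is a unit. If
  \<open>nrd t\<close> were one, the ideal would lie in p O, against
  \<open>line_ideal_nontrivial\<close>. So u is a totally positive unit, hence a square, and s can
  be rescaled to norm exactly p.\<close>

lemma line_ideal_generator:
  assumes l: "l \<in> Z2 \<times> Z2" "\<not> (p zdvd fst l \<and> p zdvd snd l)"
  shows "\<exists>s\<in>Omax. nrd s = p \<and> line_ideal l = (*) s ` Omax"
proof -
  obtain q0 where q0: "q0 \<in> line_ideal l" "q0 \<notin> scaled_Omax p" using line_ideal_nontrivial[OF l] by blast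
  have "q0 \<noteq> 0" using q0(2) by (metis Omax_zero image_eqI quat_scale_zero)
  then have "\<exists>s\<in>line_ideal l. s \<noteq> 0 \<and> line_ideal l = (*) s ` Omax"
    using q0(1) line_ideal_diff line_ideal_right_mult[OF l(1)]
    by (intro right_ideal_principal) (auto simp: line_ideal_def)
  then obtain s where s: "s \<in> line_ideal l" "s \<noteq> 0" "line_ideal l = (*) s ` Omax" by blast
  have sO: "s \<in> Omax" using s(1) by (simp add: line_ideal_def)
  have "p zdvd nrd s" using line_ideal_nrd[OF l s(1)] .
  then obtain u where u: "u \<in> Z2" "nrd s = p * u" by (auto simp: zdvd_def)
  have "p *\<^sub>q 1 \<in> line_ideal l" using scaled_in_line_ideal[OF l(1)] by simp
  then obtain t where t: "t \<in> Omax" "p *\<^sub>q 1 = s * t" using s(3) by auto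
  have "p * p = nrd s * nrd t" using arg_cong[OF t(2), of nrd] by (simp add: nrd_scale nrd_mult power2_eq_square)
  then have put: "p = u * nrd t" using pZ by (simp add: u(2))
  have tZ: "nrd t \<in> Z2" using t(1) by (rule nrd_Omax)
  have "\<not> nrd t zdvd 1"
  proof
    assume "nrd t zdvd 1"
    then obtain k where k: "k \<in> Z2" "nrd t * k = 1" by (metis zdvd_def)
    have "s = s * (t * (k *\<^sub>q qconj t))"
      using k(2) by (simp add: quat_scale_mult mult_qconj mult.commute[of k])
    also have "\<dots> = p *\<^sub>q (k *\<^sub>q qconj t)" using t(2)
      by (simp add: mult.assoc[symmetric] quat_scale_mult mult.commute[of k] flip: t(2))
    finally have sp: "s = p *\<^sub>q (k *\<^sub>q qconj t)" .
    obtain r where r: "r \<in> Omax" "q0 = s * r" using q0(1) s(3) by blast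
    have "q0 = p *\<^sub>q ((k *\<^sub>q qconj t) * r)" unfolding r(2) sp by (rule quat_scale_mult)
    moreover have "(k *\<^sub>q qconj t) * r \<in> Omax" using t(1) k(1) r(1) by simp
    ultimately show False using q0(2) by (metis image_eqI)
  qed
  have "u zdvd 1"
  proof -
    have "p zdvd u * nrd t" using put by (metis zdvd_refl)
    then have "p zdvd u \<or> p zdvd nrd t" using mult_iff u(1) tZ by blast
    moreover have "\<not> p zdvd u"
    proof
      assume "p zdvd u"
      then obtain c where c: "c \<in> Z2" "u = p * c" by (auto simp: zdvd_def)
      then have "p * 1 = p * (c * nrd t)" by (metis put mult.assoc mult_1_right)
      then have "1 = c * nrd t" using pZ unfolding mult_cancel_left by blast
      then show False using \<open>\<not> nrd t zdvd 1\<close> c(1) by (metis zdvd_triv(2))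
    qed
    ultimately obtain c where c: "c \<in> Z2" "nrd t = p * c" by (auto simp: zdvd_def)
    then have "p * 1 = p * (u * c)" by (metis put mult.left_commute mult_1_right)
    then have "1 = u * c" using pZ unfolding mult_cancel_left by blast
    then show ?thesis using c(1) by (metis zdvd_triv(1))
  qed
  moreover have "tpos u" using tpos_nrd[OF s(2)] tpos_cancel[OF pos] by (simp add: u(2))
  ultimately obtain v w where v: "v \<in> Z2" "w \<in> Z2" "u = v * v" "v * w = 1"
    using tpos_unit_square[OF u(1)] by blast
  define s' where "s' = w *\<^sub>q s"
  have ss: "s = v *\<^sub>q s'" using v(4) by (simp add: s'_def)
  have "nrd s' = (v * w) * (v * w) * p" by (simp add: s'_def nrd_scale u(2) v(3) power2_eq_square)
  then have "nrd s' = p" by (simp add: v(4))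
  moreover have "s' \<in> Omax" using sO v by (simp add: s'_def)
  moreover have "(*) s ` Omax = (*) s' ` Omax"
  proof
    have "s * q = s' * (v *\<^sub>q q)" for q by (simp add: ss quat_scale_mult)
    then show "(*) s ` Omax \<subseteq> (*) s' ` Omax" using v(1) by auto
    have "s' * q = s * (w *\<^sub>q q)" for q by (simp add: s'_def quat_scale_mult)
    then show "(*) s' ` Omax \<subseteq> (*) s ` Omax" using v(2) by auto
  qed
  ultimately show ?thesis using s(3) by auto
qed

text \<open>The matrix is nonzero and singular modulo \<open>p\<close>, hence of rank one, and its
  left kernel is a single line. The lines are represented by \<open>(1, d)\<close> with d in a
  residue system, together with \<open>(0, 1)\<close>.\<close>

lemma line_ideal_unique:
  assumes D: "residue_system p D" and q: "q \<in> Omax" "p zdvd nrd q" "q \<notin> scaled_Omax p"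
  shows "\<exists>!l. l \<in> Pair 1 ` D \<union> {(0, 1)} \<and> q \<in> line_ideal l"
proof -
  have DZ: "D \<subseteq> Z2" using D by (simp add: residue_system_def)
  note Z = aZ2[OF q(1)]
  have det: "p zdvd a11 q * a22 q - a12 q * a21 q" using det_dvd[OF q(1)] q(2) by simp
  have I0: "q \<in> line_ideal (0, 1) \<longleftrightarrow> p zdvd a21 q \<and> p zdvd a22 q" using q(1) by (simp add: line_ideal_def)
  have I1: "q \<in> line_ideal (1, d) \<longleftrightarrow> p zdvd a11 q + d * a21 q \<and> p zdvd a12 q + d * a22 q" for d
    using q(1) by (simp add: line_ideal_def)
  have not0: "\<not> (p zdvd a21 q \<and> p zdvd a22 q)" if "d \<in> Z2" "q \<in> line_ideal (1, d)" for d
  proof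
    assume h: "p zdvd a21 q \<and> p zdvd a22 q"
    have "p zdvd (a11 q + d * a21 q) - d * a21 q" "p zdvd (a12 q + d * a22 q) - d * a22 q"
      using that(2)[unfolded I1] that(1) h by (intro zdvd_diff zdvd_mult2; simp)+
    then have "p zdvd a11 q" "p zdvd a12 q" by simp_all
    then show False using in_scaled_Omax[OF q(1)] h q(3) by blast
  qed
  show ?thesis
  proof (cases "p zdvd a21 q \<and> p zdvd a22 q")
    case True
    show ?thesis
    proof (rule ex1I[of _ "(0, 1)"])
      fix l assume "l \<in> Pair 1 ` D \<union> {(0, 1)} \<and> q \<in> line_ideal l"
      then show "l = (0, 1)" using not0 True DZ by auto
    qed (use True I0 in simp)
  next
    case False
    have ex: "\<exists>e\<in>Z2. q \<in> line_ideal (1, e)"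
    proof (cases "p zdvd a21 q")
      case False
      then obtain y where y: "y \<in> Z2" "p zdvd a21 q * y - 1" using zprime_inverse[OF prime Z(3)] by blast
      \<comment> \<open>The first column forces the slope - a11 / a21, and the vanishing determinant
        makes the same slope work for the second column.\<close>
      let ?e = "- (a11 q * y)"
      have e: "a11 q + ?e * a21 q = - (a11 q * (a21 q * y - 1))"
        "a21 q * (a12 q + ?e * a22 q) = - (a11 q * a22 q - a12 q * a21 q) - (a21 q * y - 1) * (a11 q * a22 q)"
        by (simp_all add: algebra_simps)
      have "p zdvd a11 q + ?e * a21 q" unfolding e(1) using y Z by (intro zdvd_uminus zdvd_mult2) simp_all
      moreover have "p zdvd a21 q * (a12 q + ?e * a22 q)"
        unfolding e(2) using y Z by (intro zdvd_diff zdvd_uminus det zdvd_mult[OF y(2)]) simp_all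
      then have "p zdvd a12 q + ?e * a22 q" using mult_iff False Z y(1) by simp
      ultimately show ?thesis using I1 y(1) Z by (intro bexI[of _ ?e]) simp_all
    next
      case True
      with False have "\<not> p zdvd a22 q" by blast
      then obtain y where y: "y \<in> Z2" "p zdvd a22 q * y - 1" using zprime_inverse[OF prime Z(4)] by blast
      let ?e = "- (a12 q * y)"
      have e: "a12 q + ?e * a22 q = - (a12 q * (a22 q * y - 1))"
        "a22 q * (a11 q + ?e * a21 q) = (a11 q * a22 q - a12 q * a21 q) - (a22 q * y - 1) * (a12 q * a21 q)"
        by (simp_all add: algebra_simps)
      have "p zdvd a12 q + ?e * a22 q" unfolding e(1) using y Z by (intro zdvd_uminus zdvd_mult2) simp_all
      moreover have "p zdvd a22 q * (a11 q + ?e * a21 q)"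
        unfolding e(2) using y Z by (intro zdvd_diff det zdvd_mult[OF y(2)]) simp_all
      then have "p zdvd a11 q + ?e * a21 q" using mult_iff \<open>\<not> p zdvd a22 q\<close> Z y(1) by simp
      ultimately show ?thesis using I1 y(1) Z by (intro bexI[of _ ?e]) simp_all
    qed
    have cong: "q \<in> line_ideal (1, d) \<longleftrightarrow> p zdvd d - e"
      if "d \<in> Z2" "e \<in> Z2" "q \<in> line_ideal (1, e)" for d e
    proof
      assume "p zdvd d - e"
      then have "p zdvd (a11 q + e * a21 q) + (d - e) * a21 q" "p zdvd (a12 q + e * a22 q) + (d - e) * a22 q"
        using that(3) Z by (auto simp: I1 intro!: zdvd_add zdvd_mult)
      then show "q \<in> line_ideal (1, d)" by (simp add: I1 algebra_simps)
    next
      assume "q \<in> line_ideal (1, d)"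
      then have "p zdvd (a11 q + d * a21 q) - (a11 q + e * a21 q)" "p zdvd (a12 q + d * a22 q) - (a12 q + e * a22 q)"
        using that(3) unfolding I1 by (blast intro: zdvd_diff)+
      then have "p zdvd (d - e) * a21 q" "p zdvd (d - e) * a22 q" by (simp_all add: algebra_simps)
      then show "p zdvd d - e" using mult_iff that(1,2) Z False by (metis Z2_closed(3))
    qed
    obtain e where e: "e \<in> Z2" "q \<in> line_ideal (1, e)" using ex by blast
    obtain d where d: "d \<in> D" "p zdvd e - d" using residue_system_cases[OF D e(1)] .
    then have d': "q \<in> line_ideal (1, d)" using cong[OF _ e] zdvd_uminus[OF d(2)] DZ by auto
    show ?thesis
    proof (rule ex1I[of _ "(1, d)"])
      show "(1, d) \<in> Pair 1 ` D \<union> {(0, 1)} \<and> q \<in> line_ideal (1, d)" using d(1) d' by blast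
      fix l assume "l \<in> Pair 1 ` D \<union> {(0, 1)} \<and> q \<in> line_ideal l"
      then obtain c where c: "l = (1, c)" "c \<in> D" "q \<in> line_ideal (1, c)" using False I0 by auto
      then have "p zdvd c - d" using cong[of c d] d(1) d' DZ by blast
      then show "l = (1, d)" using residue_system_unique[OF D c(2) d(1)] c(1) by simp
    qed
  qed
qed

lemma hecke:
  assumes x: "x \<in> Z2"
  defines "M \<equiv> {q \<in> reps (p * x). q \<in> scaled_Omax p}"
  shows "(inm p + 1) * card (reps x) + card M = card (reps (p * x)) + (inm p + 1) * card M"
proof -
  obtain D where D: "residue_system p D" using residue_system_ex by blast
  then have DZ: "D \<subseteq> Z2" by (simp add: residue_system_def)
  define L where "L = Pair 1 ` D \<union> {(0 :: qsqrt2, 1)}"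
  have cD: "card D = inm p" using residue_system_card[OF D] zindex_eq_inm[OF pZ(1,2)] by simp
  then have "card D > 0" using inm_eq_zero[OF pZ(1)] pZ(2) by simp
  then have finD: "finite D" by (rule card_ge_0_finite)
  have "Pair 1 ` D \<inter> {(0 :: qsqrt2, 1)} = {}" by auto
  then have cL: "card L = inm p + 1" using finD cD
    unfolding L_def by (subst card_Un_disjoint) (simp_all add: card_image inj_on_def)
  have LZ: "l \<in> Z2 \<times> Z2" "\<not> (p zdvd fst l \<and> p zdvd snd l)" if "l \<in> L" for l
    using that DZ pZ(3) by (auto simp: L_def)
  obtain s where s: "\<And>l. l \<in> L \<Longrightarrow> s l \<in> Omax \<and> nrd (s l) = p \<and> line_ideal l = (*) (s l) ` Omax"
    using line_ideal_generator[OF LZ] by metis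
  have "card L * card (reps x) + card {q \<in> reps (p * x). q \<in> scaled_Omax p}
      = card (reps (p * x)) + card L * card {q \<in> reps (p * x). q \<in> scaled_Omax p}"
  proof (rule hecke_relation)
    show "p *\<^sub>q q \<in> (*) (s l) ` Omax" if "l \<in> L" "q \<in> Omax" for l q
      using scaled_in_line_ideal[OF LZ(1)] that s by blast
    show "\<exists>!l. l \<in> L \<and> q \<in> (*) (s l) ` Omax"
      if "q \<in> Omax" "p zdvd nrd q" "q \<notin> scaled_Omax p" for q
      using line_ideal_unique[OF D that] s unfolding L_def[symmetric] by metis
  qed (use finD pZ x s in \<open>auto simp: L_def\<close>)
  then show ?thesis by (simp only: cL M_def)
qed

end

lemma card_reps_odd_prime_not_dvd:
  assumes p: "zprime p" "\<not> sqrt2 zdvd p" "tpos p" and x: "x \<in> Z2" "\<not> p zdvd x"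
  shows "card (reps (p * x)) = (inm p + 1) * card (reps x)"
proof -
  obtain a b where "a \<in> Z2" "b \<in> Z2" "p zdvd a^2 + b^2 + 1"
    using zprime_minus_one_sum_two_squares[OF p(1,2)] by blast
  then interpret odd_zprime p a b using p by unfold_locales
  have "\<not> p^2 zdvd p * x" using x(2) pZ by (simp add: power2_eq_square zdvd_mult_cancel)
  then show ?thesis using hecke[OF x(1)] card_scaled_reps_empty[OF pZ(1,2)] by simp
qed

text \<open>Division by \<open>p\<close> identifies the elements of p O of norm
  \<open>p * (p * x)\<close> with \<open>reps x\<close>, which evaluates the correction term of the
  Hecke relation.\<close>

lemma card_reps_odd_prime_dvd:
  assumes p: "zprime p" "\<not> sqrt2 zdvd p" "tpos p" and x: "x \<in> Z2"
  shows "card (reps (p * (p * x))) + inm p * card (reps x) = (inm p + 1) * card (reps (p * x))"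
proof -
  obtain a b where "a \<in> Z2" "b \<in> Z2" "p zdvd a^2 + b^2 + 1"
    using zprime_minus_one_sum_two_squares[OF p(1,2)] by blast
  then interpret odd_zprime p a b using p by unfold_locales
  have "card {q \<in> reps (p * (p * x)). q \<in> scaled_Omax p} = card (reps x)"
    using card_scaled_reps[OF pZ(1,2), of x] by (simp add: power2_eq_square mult.assoc)
  then show ?thesis using hecke[of "p * x"] x pZ by simp
qed

section \<open>The maximal order at the prime above 2\<close>

lemma in_left_multiples_Oq:
  assumes "q \<in> (*) g ` Omax"
  obtains s x y z n u v w where "q = g * Oq s x y z n u v w"
  using assms by (auto elim: Omax_cases)

text \<open>Modulo \<open>sqrt2\<close> the order is the matrix ring over the field of two elements,
  with three lines and three corresponding right ideals. This and the next two lemmas describe them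
  by parities; two conditions reflect the index 4 of each.\<close>

lemma left_ideal_two_1:
  "Oq s x y z n u v w \<in> (*) (Oq 1 0 0 (-1) 1 1 1 0) ` Omax \<longleftrightarrow> even (s + v + w) \<and> even (x + y + z + u + w)"
proof
  assume "Oq s x y z n u v w \<in> (*) (Oq 1 0 0 (-1) 1 1 1 0) ` Omax"
  then obtain s' x' y' z' n' u' v' w' where
    "Oq s x y z n u v w = Oq 1 0 0 (-1) 1 1 1 0 * Oq s' x' y' z' n' u' v' w'" by (rule in_left_multiples_Oq)
  then show "even (s + v + w) \<and> even (x + y + z + u + w)" by (simp add: Oq_mult)
next
  assume "even (s + v + w) \<and> even (x + y + z + u + w)"
  then have "\<exists>a. s = v + w + 2 * a" "\<exists>b. x = y + z + u + w + 2 * b" by presburger+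
  then obtain a b where s: "s = v + w + 2 * a" and x: "x = y + z + u + w + 2 * b" by blast
  \<comment> \<open>The witness is the quotient by the generator. It becomes integral once the
    parity conditions are substituted through a and b.\<close>
  have "Oq s x y z n u v w = Oq 1 0 0 (-1) 1 1 1 0 * Oq (v + w - z + u - n) (z + b) (w + a + y + z + b) (a + z) (-v
    - w - a + n) (-v - w - a - z - b) (-w - a - y - b) (-v - a + b + n)"
    unfolding s x by (simp add: Oq_mult)
  then show "Oq s x y z n u v w \<in> (*) (Oq 1 0 0 (-1) 1 1 1 0) ` Omax" using Oq_in_Omax by (rule image_eqI)
qed

lemma left_ideal_two_2:
  "Oq s x y z n u v w \<in> (*) (Oq 1 0 (-1) 0 1 1 0 1) ` Omax \<longleftrightarrow> even (s + u + v) \<and> even (x + y + z + v + w)"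
proof
  assume "Oq s x y z n u v w \<in> (*) (Oq 1 0 (-1) 0 1 1 0 1) ` Omax"
  then obtain s' x' y' z' n' u' v' w' where
    "Oq s x y z n u v w = Oq 1 0 (-1) 0 1 1 0 1 * Oq s' x' y' z' n' u' v' w'" by (rule in_left_multiples_Oq)
  then show "even (s + u + v) \<and> even (x + y + z + v + w)" by (simp add: Oq_mult)
next
  assume "even (s + u + v) \<and> even (x + y + z + v + w)"
  then have "\<exists>a. s = u + v + 2 * a" "\<exists>b. x = y + z + v + w + 2 * b" by presburger+
  then obtain a b where s: "s = u + v + 2 * a" and x: "x = y + z + v + w + 2 * b" by blast
  have "Oq s x y z n u v w = Oq 1 0 (-1) 0 1 1 0 1 * Oq (u + v - y + w - n) (v + a + y + z + b) (a + y) (-v - w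
    - b) (-u - v - a + n) (-v - a - z - b) (-u - v - a - y - w - b + n) (-u - a + w + b)"
    unfolding s x by (simp add: Oq_mult)
  then show "Oq s x y z n u v w \<in> (*) (Oq 1 0 (-1) 0 1 1 0 1) ` Omax" using Oq_in_Omax by (rule image_eqI)
qed

lemma left_ideal_two_3:
  "Oq s x y z n u v w \<in> (*) (Oq 1 (-1) 0 0 1 0 1 1) ` Omax \<longleftrightarrow> even (s + u + w) \<and> even (x + y + z + u + v)"
proof
  assume "Oq s x y z n u v w \<in> (*) (Oq 1 (-1) 0 0 1 0 1 1) ` Omax"
  then obtain s' x' y' z' n' u' v' w' where
    "Oq s x y z n u v w = Oq 1 (-1) 0 0 1 0 1 1 * Oq s' x' y' z' n' u' v' w'" by (rule in_left_multiples_Oq)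
  then show "even (s + u + w) \<and> even (x + y + z + u + v)" by (simp add: Oq_mult)
next
  assume "even (s + u + w) \<and> even (x + y + z + u + v)"
  then have "\<exists>a. s = u + w + 2 * a" "\<exists>b. x = y + z + u + v + 2 * b" by presburger+
  then obtain a b where s: "s = u + w + 2 * a" and x: "x = y + z + u + v + 2 * b" by blast
  have "Oq s x y z n u v w = Oq 1 (-1) 0 0 1 0 1 1 * Oq (w - y - z - 2 * b - n) (u + a + y + z + v + 2 * b) (y + b) (u
    + a + y + z + b) (-u - w - a + n) (-u - w - a - z - v - b + n) (-u - w - a - y - b) (-a + v + b)"
    unfolding s x by (simp add: Oq_mult)
  then show "Oq s x y z n u v w \<in> (*) (Oq 1 (-1) 0 0 1 0 1 1) ` Omax" using Oq_in_Omax by (rule image_eqI)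
qed

lemma sqrt2_multiple_Oq:
  "Oq s x y z n u v w \<in> scaled_Omax sqrt2 \<longleftrightarrow>
    even s \<and> even (u + v) \<and> even (v + w) \<and> even (x + y + z)"
proof
  assume "Oq s x y z n u v w \<in> scaled_Omax sqrt2"
  then obtain s' x' y' z' n' u' v' w' where
    "Oq s x y z n u v w = qs (of_int 0) (of_int 1) *\<^sub>q Oq s' x' y' z' n' u' v' w'"
    by (auto simp: qs_sqrt2 elim: Omax_cases)
  then show "even s \<and> even (u + v) \<and> even (v + w) \<and> even (x + y + z)" unfolding Oq_scale by simp
next
  assume "even s \<and> even (u + v) \<and> even (v + w) \<and> even (x + y + z)"
  then have "\<exists>a. s = 2 * a" "\<exists>b. v = u + 2 * b" "\<exists>c. w = u + 2 * c" "\<exists>d. z = 2 * d - x - y" by presburger+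
  then obtain a b c d where h: "s = 2 * a" "v = u + 2 * b" "w = u + 2 * c" "z = 2 * d - x - y" by blast
  have "Oq s x y z n u v w = qs (of_int 0) (of_int 1) *\<^sub>q Oq (2 * n - 3 * u - 2 * b - 2 * c)
      (2 * u + b + c - n) (2 * u + 2 * b + c - n) (2 * u + b + 2 * c - n) (2 * a + d) (a + x) (a + y) (a + z)"
    unfolding Oq_scale h by simp
  then show "Oq s x y z n u v w \<in> scaled_Omax sqrt2" by (simp add: qs_sqrt2)
qed

text \<open>Modulo 2 the rational part of the norm is f(s, x + y + z) + f(u + v, v + w) with f(a, b)
  = a^2 + a b + b^2, and f(a, b) is odd exactly when a or b is.\<close>

lemma sqrt2_zdvd_nrd_Oq:
  "sqrt2 zdvd nrd (Oq s x y z n u v w) \<longleftrightarrow>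
    ((odd s \<or> odd (x + y + z)) \<longleftrightarrow> (odd (u + v) \<or> odd (v + w)))"
  unfolding nrd_Oq sqrt2_zdvd_qs by simp argo

text \<open>Peels an explicit list one element at a time, so that existence and uniqueness become a
  propositional statement about parities.\<close>

lemma ex1_insert:
  assumes "a \<notin> A"
  shows
    "(\<exists>!l. l \<in> insert a A \<and> P l) \<longleftrightarrow> P a \<and> (\<forall>l\<in>A. \<not> P l) \<or> \<not> P a \<and> (\<exists>!l. l \<in> A \<and> P l)"
  using assms by auto

text \<open>This is 2 + sqrt 2 = sqrt 2 (1 + sqrt 2), a totally positive generator of the prime
  above 2. The element \<open>sqrt2\<close> itself is not totally positive and so is no reduced
  norm.\<close>

definition lambda2 :: qsqrt2 where "lambda2 = qs 2 1"

lemma lambda2_Z2 [simp]: "lambda2 \<in> Z2"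
  unfolding lambda2_def using Z2_qs[of 2 1] by simp
lemma lambda2_nonzero [simp]: "lambda2 \<noteq> 0"
  by (simp add: lambda2_def qs_eq_zero)
lemma lambda2_eq: "lambda2 = sqrt2 * qs 1 1" and unit_inverse: "qs 1 1 * qs (- 1) 1 = 1"
  by (simp_all add: lambda2_def qs_consts)
lemma unit_Z2 [simp]: "qs 1 1 \<in> Z2" "qs (- 1) 1 \<in> Z2"
  using Z2_qs[of 1 1] Z2_qs[of "-1" 1] by simp_all
lemma tpos_lambda2: "tpos lambda2"
  unfolding lambda2_def using tpos_qs_int[of 2 1] by simp
lemma lambda2_zdvd_imp: "lambda2 zdvd x \<Longrightarrow> sqrt2 zdvd x"
  using zdvd_trans[of sqrt2 lambda2 x] by (simp add: lambda2_eq)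

lemma nrd_two_generators:
  "nrd (Oq 1 0 0 (-1) 1 1 1 0) = lambda2"
  "nrd (Oq 1 0 (-1) 0 1 1 0 1) = lambda2"
  "nrd (Oq 1 (-1) 0 0 1 0 1 1) = lambda2"
  "nrd (Oq 1 (-1) (-1) (-1) 0 (-1) 0 0) = lambda2"
  "nrd (Oq 1 0 (-1) 0 0 0 (-1) 1) = lambda2"
  unfolding nrd_Oq lambda2_def by simp_all

text \<open>The residue field has two elements, so there are three lines. Scaling by
  \<open>sqrt2\<close> replaces scaling by \<open>lambda2\<close>, from which it differs by a unit,
  and gives the same right ideal.\<close>

lemma hecke_lambda2:
  assumes "x \<in> Z2"
  defines "M \<equiv> {q \<in> reps (lambda2 * x). q \<in> scaled_Omax sqrt2}"
  shows "3 * card (reps x) + card M = card (reps (lambda2 * x)) + 3 * card M"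
proof -
  let ?L = "{Oq 1 0 0 (-1) 1 1 1 0, Oq 1 0 (-1) 0 1 1 0 1, Oq 1 (-1) 0 0 1 0 1 1}"
  have not_in:
      "Oq 1 0 0 (-1) 1 1 1 0 \<notin> {Oq 1 0 (-1) 0 1 1 0 1, Oq 1 (-1) 0 0 1 0 1 1}"
      "Oq 1 0 (-1) 0 1 1 0 1 \<notin> {Oq 1 (-1) 0 0 1 0 1 1}"
      "Oq 1 (-1) 0 0 1 0 1 1 \<notin> {}"
    by simp_all
  have "card ?L * card (reps x) + card {q \<in> reps (lambda2 * x). q \<in> scaled_Omax sqrt2}
      = card (reps (lambda2 * x)) + card ?L * card {q \<in> reps (lambda2 * x). q \<in> scaled_Omax sqrt2}"
  proof (rule hecke_relation[where s = "\<lambda>l. l"])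
    show "sqrt2 *\<^sub>q q \<in> (*) l ` Omax" if l: "l \<in> ?L" and q: "q \<in> Omax" for l q
    proof -
      have "sqrt2 *\<^sub>q q \<in> Omax" using q by simp
      then obtain s x y z n u v w where e: "sqrt2 *\<^sub>q q = Oq s x y z n u v w" by (rule Omax_cases)
      have "Oq s x y z n u v w \<in> scaled_Omax sqrt2" unfolding e[symmetric] using q by simp
      then show ?thesis using l unfolding e
        by (auto simp: sqrt2_multiple_Oq left_ideal_two_1 left_ideal_two_2 left_ideal_two_3)
    qed
    show "\<exists>!l. l \<in> ?L \<and> q \<in> (*) l ` Omax"
      if q: "q \<in> Omax" "lambda2 zdvd nrd q" "q \<notin> scaled_Omax sqrt2" for q
    proof -
      obtain s x y z n u v w where e: "q = Oq s x y z n u v w" using q(1) by (rule Omax_cases)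
      have "sqrt2 zdvd nrd q" using q(2) by (rule lambda2_zdvd_imp)
      then have 1: "(odd s \<or> odd (x + y + z)) \<longleftrightarrow> (odd (u + v) \<or> odd (v + w))"
        unfolding e sqrt2_zdvd_nrd_Oq .
      have 2: "\<not> (even s \<and> even (u + v) \<and> even (v + w) \<and> even (x + y + z))"
        using q(3) unfolding e sqrt2_multiple_Oq .
      show ?thesis unfolding e ex1_insert[OF not_in(1)] ex1_insert[OF not_in(2)] ex1_insert[OF not_in(3)]
        by (simp add: left_ideal_two_1 left_ideal_two_2 left_ideal_two_3) (use 1 2 in \<open>simp; argo\<close>)
    qed
  qed (use assms(1) nrd_two_generators in auto)
  then show ?thesis by (simp add: M_def)
qed

text \<open>Identify \<open>O / 2 O\<close> with 2 by 2 matrices over \<open>O\<^sub>K / 2\<close>. The elements of \<open>Eichler2\<close> and \<open>Eichler4\<close> are those that are diagonal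
  modulo \<open>sqrt 2\<close> and modulo 2, and \<open>Corner\<close> says of such an element that the first diagonal entry is a unit
  modulo \<open>sqrt 2\<close>. Conjugation exchanges the two diagonal entries.\<close>

definition Eichler2 :: "qsqrt2 quat set" where
  "Eichler2 = {Oq s x y z n u v w | s x y z n u v w. even (v + w) \<and> even (s + u + w)}"

definition Eichler4 :: "qsqrt2 quat set" where
  "Eichler4 = {Oq s x y z n u v w | s x y z n u v w.
     even (v + w) \<and> even (s + u + w) \<and> even (y + z) \<and> even (x + z + w)}"

definition Corner :: "qsqrt2 quat set" where
  "Corner = {Oq s x y z n u v w | s x y z n u v w. odd (x + y + z)}"

lemma Eichler_Oq [simp]:
  "Oq s x y z n u v w \<in> Eichler2 \<longleftrightarrow> even (v + w) \<and> even (s + u + w)"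
  "Oq s x y z n u v w \<in> Eichler4 \<longleftrightarrow> even (v + w) \<and> even (s + u + w) \<and> even (y + z) \<and> even (x + z + w)"
  "Oq s x y z n u v w \<in> Corner \<longleftrightarrow> odd (x + y + z)"
  unfolding Eichler2_def Eichler4_def Corner_def mem_Collect_eq Oq_inject by blast+

lemma Eichler_subset: "Eichler4 \<subseteq> Eichler2" "Eichler2 \<subseteq> Omax"
  unfolding Eichler2_def Eichler4_def by auto

section \<open>Counting by left translates at the prime above 2\<close>

lemma card_left_translates:
  assumes fin: "finite L" "finite A" and nz: "\<And>l. l \<in> L \<Longrightarrow> nrd l \<noteq> (0 :: qsqrt2)"
    and sub: "\<And>l t. l \<in> L \<Longrightarrow> t \<in> A \<Longrightarrow> l * t \<in> S"
    and ex1: "\<And>q. q \<in> S \<Longrightarrow> \<exists>!l. l \<in> L \<and> q \<in> (*) l ` A"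
  shows "card S = card L * card A"
proof -
  have "S \<subseteq> (\<Union>l\<in>L. (*) l ` A)"
  proof
    fix q assume "q \<in> S"
    from ex1_implies_ex[OF ex1[OF this]] show "q \<in> (\<Union>l\<in>L. (*) l ` A)" by blast
  qed
  moreover have "(\<Union>l\<in>L. (*) l ` A) \<subseteq> S" using sub by auto
  ultimately have "S = (\<Union>l\<in>L. (*) l ` A)" by (rule equalityI)
  also have "card \<dots> = (\<Sum>l\<in>L. card ((*) l ` A))"
  proof (intro card_UN_disjoint ballI impI)
    fix l j assume lj: "l \<in> L" "j \<in> L" "l \<noteq> j"
    show "(*) l ` A \<inter> (*) j ` A = {}"
    proof (rule ccontr)
      assume "(*) l ` A \<inter> (*) j ` A \<noteq> {}"
      then obtain q where q: "q \<in> (*) l ` A" "q \<in> (*) j ` A" by blast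
      then have "q \<in> S" using sub[OF lj(1)] by auto
      from ex1[OF this] show False using q lj by blast
    qed
  qed (use fin in auto)
  also have "\<dots> = (\<Sum>l\<in>L. card A)"
    using nz by (intro sum.cong refl card_image inj_onI) (simp add: quat_mult_left_cancel)
  finally show ?thesis by simp
qed

lemma left_translate_iff:
  "nrd g \<noteq> (0 :: qsqrt2) \<Longrightarrow> g * t \<in> (*) g ` A \<longleftrightarrow> t \<in> A"
  by (auto simp: quat_mult_left_cancel)

lemma unit_translate_iff:
  assumes g: "g \<in> Omax" "nrd g = 1" and q: "q \<in> reps x"
  shows "q \<in> (*) g ` (reps x \<inter> E) \<longleftrightarrow> qconj g * q \<in> E"
proof -
  have e: "g * (qconj g * q) = q" by (simp add: mult.assoc[symmetric] mult_qconj g(2))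
  have "qconj g * q \<in> reps x" using g q by (simp add: reps_def nrd_mult)
  then have "qconj g * q \<in> reps x \<inter> E \<longleftrightarrow> qconj g * q \<in> E" by blast
  then show ?thesis using left_translate_iff[of g "qconj g * q" "reps x \<inter> E"] g(2) unfolding e by simp
qed

text \<open>An element of odd norm is invertible modulo \<open>sqrt2\<close>. The group GL_2 over
  the field of two elements has order 6 and the identity is its only diagonal element; the list
  contains one quaternion of norm 1 for each of the six classes.\<close>

lemma card_reps_Eichler2:
  assumes "\<not> sqrt2 zdvd x"
  shows "card (reps x) = 6 * card (reps x \<inter> Eichler2)"
proof -
  let ?L = "{Oq 2 (-1) (-1) (-1) 0 0 0 0, Oq 0 0 0 0 1 1 1 0, Oq 0 0 0 0 1 1 0 1,
      Oq 0 0 0 0 1 0 1 1,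
      Oq 1 0 0 (-1) 0 0 0 0, Oq 1 0 (-1) (-1) 0 0 0 0}"
  have not_in:
      "Oq 2 (-1) (-1) (-1) 0 0 0 0 \<notin> {Oq 0 0 0 0 1 1 1 0, Oq 0 0 0 0 1 1 0 1, Oq 0 0 0 0 1 0 1 1,
        Oq 1 0 0 (-1) 0 0 0 0, Oq 1 0 (-1) (-1) 0 0 0 0}"
      "Oq 0 0 0 0 1 1 1 0 \<notin> {Oq 0 0 0 0 1 1 0 1, Oq 0 0 0 0 1 0 1 1, Oq 1 0 0 (-1) 0 0 0 0, Oq 1 0 (-1) (-1) 0 0 0 0}"
      "Oq 0 0 0 0 1 1 0 1 \<notin> {Oq 0 0 0 0 1 0 1 1, Oq 1 0 0 (-1) 0 0 0 0, Oq 1 0 (-1) (-1) 0 0 0 0}"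
      "Oq 0 0 0 0 1 0 1 1 \<notin> {Oq 1 0 0 (-1) 0 0 0 0, Oq 1 0 (-1) (-1) 0 0 0 0}"
      "Oq 1 0 0 (-1) 0 0 0 0 \<notin> {Oq 1 0 (-1) (-1) 0 0 0 0}"
      "Oq 1 0 (-1) (-1) 0 0 0 0 \<notin> {}"
    by simp_all
  have L: "l \<in> Omax \<and> nrd l = 1" if "l \<in> ?L" for l
    using that by (auto simp: nrd_Oq qs_one)
  have "card (reps x) = card ?L * card (reps x \<inter> Eichler2)"
  proof (rule card_left_translates)
    show "l * t \<in> reps x" if "l \<in> ?L" "t \<in> reps x \<inter> Eichler2" for l t
      using L[OF that(1)] that(2) by (simp add: reps_def nrd_mult)
    show "\<exists>!l. l \<in> ?L \<and> q \<in> (*) l ` (reps x \<inter> Eichler2)" if q: "q \<in> reps x" for q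
    proof -
      obtain s x' y z n u v w where e: "q = Oq s x' y z n u v w" using q by (auto simp: reps_def elim: Omax_cases)
      have "\<not> sqrt2 zdvd nrd q" using q assms by (simp add: reps_def)
      then have 1: "\<not> ((odd s \<or> odd (x' + y + z)) \<longleftrightarrow> (odd (u + v) \<or> odd (v + w)))"
        unfolding e sqrt2_zdvd_nrd_Oq .
      have
        "(l \<in> ?L \<and> q \<in> (*) l ` (reps x \<inter> Eichler2)) \<longleftrightarrow> (l \<in> ?L \<and> qconj l * q \<in> Eichler2)" for l
        using L unit_translate_iff[OF _ _ q] by blast
      then have iff:
        "(\<exists>!l. l \<in> ?L \<and> q \<in> (*) l ` (reps x \<inter> Eichler2)) \<longleftrightarrow> (\<exists>!l. l \<in> ?L \<and> qconj l * q \<in> Eichler2)"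
        by (simp only:)
      have c:
        "qconj (Oq 2 (-1) (-1) (-1) 0 0 0 0) * Oq s x' y z n u v w \<in> Eichler2 \<longleftrightarrow> even (v
          + w) \<and> even (s + u + w)"
        "qconj (Oq 0 0 0 0 1 1 1 0) * Oq s x' y z n u v w \<in> Eichler2 \<longleftrightarrow> even (x' + y
          + z) \<and> even (s + x' + y + z + u + v)"
        "qconj (Oq 0 0 0 0 1 1 0 1) * Oq s x' y z n u v w \<in> Eichler2 \<longleftrightarrow> even (s + x' + y
          + z) \<and> even (s + u + w)"
        "qconj (Oq 0 0 0 0 1 0 1 1) * Oq s x' y z n u v w \<in> Eichler2 \<longleftrightarrow> even s \<and> even (x' + y + z + v + w)"
        "qconj (Oq 1 0 0 (-1) 0 0 0 0) * Oq s x' y z n u v w \<in> Eichler2 \<longleftrightarrow> even (u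
          + w) \<and> even (s + x' + y + z + u + v)"
        "qconj (Oq 1 0 (-1) (-1) 0 0 0 0) * Oq s x' y z n u v w \<in> Eichler2 \<longleftrightarrow> even (u
          + v) \<and> even (x' + y + z + v + w)"
        by (simp_all add: Oq_qconj Oq_mult) argo+
      have "\<exists>!l. l \<in> ?L \<and> qconj l * q \<in> Eichler2"
        using 1
        unfolding e ex1_insert[OF not_in(1)] ex1_insert[OF not_in(2)] ex1_insert[OF not_in(3)]
          ex1_insert[OF not_in(4)] ex1_insert[OF not_in(5)] ex1_insert[OF not_in(6)] ball_simps c even_add
        by (simp only: empty_iff simp_thms Ex1_def; argo)
      then show ?thesis unfolding iff .
    qed
  qed (use L finite_reps in auto)
  then show ?thesis by simp
qed

text \<open>For odd norm these elements are congruent to 1 modulo \<open>sqrt2\<close>. Modulo 2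
  such matrices form a group of order 16 with four diagonal ones, and 1, i, j, k represent the four
  cosets.\<close>

lemma card_Eichler2_Eichler4:
  assumes "\<not> sqrt2 zdvd x"
  shows "card (reps x \<inter> Eichler2) = 4 * card (reps x \<inter> Eichler4)"
proof -
  let ?L = "{Oq 2 (-1) (-1) (-1) 0 0 0 0, Oq 0 1 0 0 0 0 0 0, Oq 0 0 1 0 0 0 0 0, Oq 0 0 0 1 0 0 0 0}"
  have not_in:
      "Oq 2 (-1) (-1) (-1) 0 0 0 0 \<notin> {Oq 0 1 0 0 0 0 0 0, Oq 0 0 1 0 0 0 0 0, Oq 0 0 0 1 0 0 0 0}"
      "Oq 0 1 0 0 0 0 0 0 \<notin> {Oq 0 0 1 0 0 0 0 0, Oq 0 0 0 1 0 0 0 0}"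
      "Oq 0 0 1 0 0 0 0 0 \<notin> {Oq 0 0 0 1 0 0 0 0}"
      "Oq 0 0 0 1 0 0 0 0 \<notin> {}"
    by simp_all
  have L: "l \<in> Omax \<and> nrd l = 1" if "l \<in> ?L" for l
    using that by (auto simp: nrd_Oq qs_one)
  have "card (reps x \<inter> Eichler2) = card ?L * card (reps x \<inter> Eichler4)"
  proof (rule card_left_translates)
    show "l * t \<in> reps x \<inter> Eichler2" if lt: "l \<in> ?L" "t \<in> reps x \<inter> Eichler4" for l t
    proof -
      have "l * t \<in> reps x" using L[OF that(1)] that(2) by (simp add: reps_def nrd_mult)
      moreover obtain s x' y z n u v w where e: "t = Oq s x' y z n u v w"
        using lt(2) by (auto simp: reps_def elim: Omax_cases)
      have "l * t \<in> Eichler2" using lt unfolding e by (auto simp: Oq_mult)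
      ultimately show ?thesis by blast
    qed
    show "\<exists>!l. l \<in> ?L \<and> q \<in> (*) l ` (reps x \<inter> Eichler4)" if q: "q \<in> reps x \<inter> Eichler2" for q
    proof -
      obtain s x' y z n u v w where e: "q = Oq s x' y z n u v w" using q by (auto simp: reps_def elim: Omax_cases)
      have "\<not> sqrt2 zdvd nrd q" using q assms by (simp add: reps_def)
      then have 1: "\<not> ((odd s \<or> odd (x' + y + z)) \<longleftrightarrow> (odd (u + v) \<or> odd (v + w)))"
        unfolding e sqrt2_zdvd_nrd_Oq .
      have 2: "even (v + w) \<and> even (s + u + w)" using q by (simp add: e)
      have
        "(l \<in> ?L \<and> q \<in> (*) l ` (reps x \<inter> Eichler4)) \<longleftrightarrow> (l \<in> ?L \<and> qconj l * q \<in> Eichler4)" for l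
        using L unit_translate_iff[of _ q x] q by blast
      then have iff:
        "(\<exists>!l. l \<in> ?L \<and> q \<in> (*) l ` (reps x \<inter> Eichler4)) \<longleftrightarrow> (\<exists>!l. l \<in> ?L \<and> qconj l * q \<in> Eichler4)"
        by (simp only:)
      have c:
        "qconj (Oq 2 (-1) (-1) (-1) 0 0 0 0) * Oq s x' y z n u v w \<in> Eichler4 \<longleftrightarrow> even (v
          + w) \<and> even (s + u + w) \<and> even (y + z) \<and> even (x' + z + w)"
        "qconj (Oq 0 1 0 0 0 0 0 0) * Oq s x' y z n u v w \<in> Eichler4 \<longleftrightarrow> even (v
          + w) \<and> even (s + u + w) \<and> even (s + y + z) \<and> even (y + v)"
        "qconj (Oq 0 0 1 0 0 0 0 0) * Oq s x' y z n u v w \<in> Eichler4 \<longleftrightarrow> even (v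
          + w) \<and> even (s + u + w) \<and> even (s + x') \<and> even (s + x' + z + u)"
        "qconj (Oq 0 0 0 1 0 0 0 0) * Oq s x' y z n u v w \<in> Eichler4 \<longleftrightarrow> even (v
          + w) \<and> even (s + u + w) \<and> even (x') \<and> even (s + y + u + v + w)"
        by (simp_all add: Oq_qconj Oq_mult) argo+
      have "\<exists>!l. l \<in> ?L \<and> qconj l * q \<in> Eichler4"
        using 1 2
        unfolding e ex1_insert[OF not_in(1)] ex1_insert[OF not_in(2)] ex1_insert[OF not_in(3)]
          ex1_insert[OF not_in(4)] ball_simps c even_add
        by (simp only: empty_iff simp_thms Ex1_def; argo)
      then show ?thesis unfolding iff .
    qed
  qed (use L finite_reps in auto)
  then show ?thesis by simp
qed

text \<open>Both generators span the right ideal of \<open>left_ideal_two_3\<close> in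
  \<open>Omax\<close>, which contains every element counted on the left. They differ by the unit -k,
  which is not in \<open>Eichler4\<close>. So each element has two integral quotients, and exactly
  one of them is again diagonal modulo 2.\<close>

lemma card_corner_Eichler4:
  assumes "x \<in> Z2"
  shows "card (reps (lambda2 * x) \<inter> Eichler4 \<inter> Corner) = 2 * card (reps x \<inter> Eichler4 \<inter> Corner)"
proof -
  let ?L = "{Oq 1 (-1) 0 0 1 0 1 1, Oq 1 (-1) (-1) (-1) 0 (-1) 0 0}"
  let ?A = "reps x \<inter> Eichler4 \<inter> Corner"
  have not_in: "Oq 1 (-1) 0 0 1 0 1 1 \<notin> {Oq 1 (-1) (-1) (-1) 0 (-1) 0 0}" "Oq 1 (-1) (-1) (-1) 0 (-1) 0 0 \<notin> {}" by simp_all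
  have L: "l \<in> Omax \<and> nrd l = lambda2" if "l \<in> ?L" for l
    using that by (auto simp: nrd_two_generators)
  have "card (reps (lambda2 * x) \<inter> Eichler4 \<inter> Corner) = card ?L * card ?A"
  proof (rule card_left_translates)
    show "l * t \<in> reps (lambda2 * x) \<inter> Eichler4 \<inter> Corner" if lt: "l \<in> ?L" "t \<in> ?A" for l t
    proof -
      have "l * t \<in> reps (lambda2 * x)" using L[OF that(1)] that(2) by (simp add: reps_def nrd_mult)
      moreover obtain s x' y z n u v w where e: "t = Oq s x' y z n u v w"
        using lt(2) by (auto simp: reps_def elim: Omax_cases)
      have "l * t \<in> Eichler4 \<inter> Corner" using lt unfolding e by (auto simp: Oq_mult)
      ultimately show ?thesis by blast
    qed
    show "\<exists>!l. l \<in> ?L \<and> q \<in> (*) l ` ?A" if q: "q \<in> reps (lambda2 * x) \<inter> Eichler4 \<inter> Corner" for q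
    proof -
      obtain s x' y z n u v w where q0: "q = Oq s x' y z n u v w" using q by (auto simp: reps_def elim: Omax_cases)
      have nq: "nrd q = lambda2 * x" using q by (simp add: reps_def)
      \<comment> \<open>Free integers solve the parity conditions for membership and for even norm,
        so that the quotients by both generators get integral coordinates.\<close>
      obtain w f b e d c n a where e: "q = Oq (2 * w + 2 * f + 2 * b + 1) (2 * w + 2 * e + 2 * d + 1) (w + 2 * e
        + 2 * c + 1) (w + 2 * e + 1) n (w + 2 * f + 1) (w + 2 * a) w"
      proof -
        have "sqrt2 zdvd nrd (Oq s x' y z n u v w)" using q unfolding q0[symmetric]
          by (simp add: reps_def lambda2_zdvd_imp assms)
        then have "(odd s \<or> odd (x' + y + z)) \<longleftrightarrow> (odd (u + v) \<or> odd (v + w))"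
          unfolding sqrt2_zdvd_nrd_Oq .
        moreover have "even (v + w)" "even (s + u + w)" "even (y + z)" "even (x' + z + w)" "odd (x' + y + z)"
          using q unfolding q0 Int_iff Eichler_Oq by blast+
        ultimately have "\<exists>a. v = w + 2 * a" "\<exists>b. s = u + w + 2 * b" "\<exists>c. y = z + 2 * c"
          "\<exists>d. x' = z + w + 2 * d"
          "\<exists>e. z = w + 1 + 2 * e" "\<exists>f. u = w + 1 + 2 * f" by presburger+
        then obtain a b c d e f where h: "v = w + 2 * a" "s = u + w + 2 * b" "y = z + 2 * c" "x' = z + w + 2 * d"
          "z = w + 1 + 2 * e" "u = w + 1 + 2 * f" by blast
        show thesis by (rule that[of w f b e d c n a]) (simp add: q0 h)
      qed
      define t1 t2 where "t1 = Oq (w + 2 * f - 2 * e - 2 * d - n + 2 * a) (2 * w + b + 2 * e + 2 * d + 1) (-f + e + d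
        + c - a) (2 * w + f + b + 3 * e + d + c - a + 2) (-2 * w - 2 * f - b + n - 1) (-3 * w - f - b - e - d + c + n
        - a - 1) (-2 * w - f - b - e - d - c + a - 1) (-f - b - e + d - c + a - 1)"
        and "t2 = Oq (-5 * w - 4 * f - 2 * b - 4 * e - 2 * c + n - 4) (2 * w + 2 * f + b + 2 * e + 2) (5 * w + 3 * f
          + 2 * b + 3 * e + d + c - n + a + 3) (3 * w + 3 * f + b + e - d + c - n + a + 2) (b + 2 * e + 2 * c + n
          - 2 * a + 1) (2 * w + f + b + e + d + c - a + 1) (-3 * w - f - b - e - d + c + n - a - 1) (w - f + b + 3 * e
          + d + c + n - a + 1)"
      have e1: "q = Oq 1 (-1) 0 0 1 0 1 1 * t1" and e2: "q = Oq 1 (-1) (-1) (-1) 0 (-1) 0 0 * t2"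
        unfolding e t1_def t2_def by (simp_all add: Oq_mult)
      have "nrd t1 = x" "nrd t2 = x"
        using nq nrd_two_generators arg_cong[OF e1, of nrd] arg_cong[OF e2, of nrd] by (simp_all add: nrd_mult)
      \<comment> \<open>The two quotients satisfy complementary conditions: the parity of b alone
        selects the generator.\<close>
      then have "t1 \<in> ?A \<longleftrightarrow> even b" "t2 \<in> ?A \<longleftrightarrow> odd b"
        by (auto simp: reps_def t1_def t2_def)
      moreover have "q \<in> (*) (Oq 1 (-1) 0 0 1 0 1 1) ` ?A \<longleftrightarrow> t1 \<in> ?A"
        "q \<in> (*) (Oq 1 (-1) (-1) (-1) 0 (-1) 0 0) ` ?A \<longleftrightarrow> t2 \<in> ?A"
        using left_translate_iff[of "Oq 1 (-1) 0 0 1 0 1 1" t1 ?A] left_translate_iff[of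
          "Oq 1 (-1) (-1) (-1) 0 (-1) 0 0" t2 ?A] nrd_two_generators
        unfolding e1[symmetric] e2[symmetric] by simp_all
      ultimately show ?thesis unfolding ex1_insert[OF not_in(1)] ex1_insert[OF not_in(2)] by auto
    qed
  qed (use L finite_reps in auto)
  then show ?thesis by simp
qed

text \<open>The unit -k relating the two generators of the previous count lies in
  \<open>Eichler2\<close>, so a different second generator is used. It spans the same right ideal of
  \<open>Omax\<close>, and the parity of \<open>w + y\<close> selects the quotient.\<close>

lemma card_corner_Eichler2:
  assumes "x \<in> Z2"
  shows "card (reps (lambda2 * x) \<inter> Eichler2 \<inter> Corner) = 2 * card (reps x \<inter> Eichler2 \<inter> Corner)"
proof -
  let ?L = "{Oq 1 (-1) 0 0 1 0 1 1, Oq 1 0 (-1) 0 0 0 (-1) 1}"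
  let ?A = "reps x \<inter> Eichler2 \<inter> Corner"
  have not_in: "Oq 1 (-1) 0 0 1 0 1 1 \<notin> {Oq 1 0 (-1) 0 0 0 (-1) 1}" "Oq 1 0 (-1) 0 0 0 (-1) 1 \<notin> {}" by simp_all
  have L: "l \<in> Omax \<and> nrd l = lambda2" if "l \<in> ?L" for l
    using that by (auto simp: nrd_two_generators)
  have "card (reps (lambda2 * x) \<inter> Eichler2 \<inter> Corner) = card ?L * card ?A"
  proof (rule card_left_translates)
    show "l * t \<in> reps (lambda2 * x) \<inter> Eichler2 \<inter> Corner" if lt: "l \<in> ?L" "t \<in> ?A" for l t
    proof -
      have "l * t \<in> reps (lambda2 * x)" using L[OF that(1)] that(2) by (simp add: reps_def nrd_mult)
      moreover obtain s x' y z n u v w where e: "t = Oq s x' y z n u v w"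
        using lt(2) by (auto simp: reps_def elim: Omax_cases)
      have "l * t \<in> Eichler2 \<inter> Corner" using lt unfolding e by (auto simp: Oq_mult)
      ultimately show ?thesis by blast
    qed
    show "\<exists>!l. l \<in> ?L \<and> q \<in> (*) l ` ?A" if q: "q \<in> reps (lambda2 * x) \<inter> Eichler2 \<inter> Corner" for q
    proof -
      obtain s x' y z n u v w where q0: "q = Oq s x' y z n u v w" using q by (auto simp: reps_def elim: Omax_cases)
      have nq: "nrd q = lambda2 * x" using q by (simp add: reps_def)
      obtain w d b y z c n a where e: "q = Oq (2 * w + 2 * d + 2 * b + 1) (y + z + 2 * c + 1) y z n (w + 2 * d + 1) (w + 2 * a) w"
      proof -
        have "sqrt2 zdvd nrd (Oq s x' y z n u v w)" using q unfolding q0[symmetric]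
          by (simp add: reps_def lambda2_zdvd_imp assms)
        then have "(odd s \<or> odd (x' + y + z)) \<longleftrightarrow> (odd (u + v) \<or> odd (v + w))"
          unfolding sqrt2_zdvd_nrd_Oq .
        moreover have "even (v + w)" "even (s + u + w)" "odd (x' + y + z)"
          using q unfolding q0 Int_iff Eichler_Oq by blast+
        ultimately have "\<exists>a. v = w + 2 * a" "\<exists>b. s = u + w + 2 * b" "\<exists>c. x' = y + z + 1 + 2 * c"
          "\<exists>d. u = w + 1 + 2 * d" by presburger+
        then obtain a b c d where h: "v = w + 2 * a" "s = u + w + 2 * b" "x' = y + z + 1 + 2 * c"
          "u = w + 1 + 2 * d" by blast
        show thesis by (rule that[of w d b y z c n a]) (simp add: q0 h)
      qed
      define t1 t2 where "t1 = Oq (3 * w + 2 * d - y - z - 2 * c - n + 2 * a) (b + y + z + 2 * c + 1) (-w - d + y + c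
        - a) (d + b + y + z + c - a + 1) (-2 * w - 2 * d - b + n - 1) (-2 * w - d - b - z - c + n - a - 1) (-w - d - b
        - y - c + a - 1) (-d - b + c + a)"
        and "t2 = Oq (3 * w + 2 * d + 2 * b + y + z + 2 * c - n + 2) (-2 * w - 2 * d - b + n - 1) (-2 * w - d - c + n
          - a - 1) (-w - d - b - y - c + a - 1) (-b - y - z - 2 * c - 1) (3 * w + 3 * d + b - c - n + a + 1) (-d - b
          - y - z - c + a - 1) (-w - d - b - z - c - a - 1)"
      have e1: "q = Oq 1 (-1) 0 0 1 0 1 1 * t1" and e2: "q = Oq 1 0 (-1) 0 0 0 (-1) 1 * t2"
        unfolding e t1_def t2_def by (simp_all add: Oq_mult)
      have "nrd t1 = x" "nrd t2 = x"
        using nq nrd_two_generators arg_cong[OF e1, of nrd] arg_cong[OF e2, of nrd] by (simp_all add: nrd_mult)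
      then have "t1 \<in> ?A \<longleftrightarrow> odd (w + y)" "t2 \<in> ?A \<longleftrightarrow> even (w + y)"
        by (auto simp: reps_def t1_def t2_def)
      moreover have "q \<in> (*) (Oq 1 (-1) 0 0 1 0 1 1) ` ?A \<longleftrightarrow> t1 \<in> ?A"
        "q \<in> (*) (Oq 1 0 (-1) 0 0 0 (-1) 1) ` ?A \<longleftrightarrow> t2 \<in> ?A"
        using left_translate_iff[of "Oq 1 (-1) 0 0 1 0 1 1" t1 ?A] left_translate_iff[of
          "Oq 1 0 (-1) 0 0 0 (-1) 1" t2 ?A] nrd_two_generators
        unfolding e1[symmetric] e2[symmetric] by simp_all
      ultimately show ?thesis unfolding ex1_insert[OF not_in(1)] ex1_insert[OF not_in(2)] by auto
    qed
  qed (use L finite_reps in auto)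
  then show ?thesis by simp
qed

section \<open>The order of the theorem\<close>

lemma Eichler_Omax: "q \<in> Eichler2 \<Longrightarrow> q \<in> Omax" "q \<in> Eichler4 \<Longrightarrow> q \<in> Omax"
  using Eichler_subset by blast+

lemma Eichler4_neq_Eichler2: "Eichler4 \<noteq> Eichler2"
proof -
  have "Oq 0 1 0 0 0 0 0 0 \<in> Eichler2" "Oq 0 1 0 0 0 0 0 0 \<notin> Eichler4" by simp_all
  then show ?thesis by blast
qed

definition G_elem :: "qsqrt2 \<Rightarrow> qsqrt2 \<Rightarrow> qsqrt2 \<Rightarrow> qsqrt2 \<Rightarrow> qsqrt2 quat" where
  "G_elem a b c d = a *\<^sub>q 1 + b *\<^sub>q (2 * sqrt2) *\<^sub>q quat_i
     + c *\<^sub>q (2 *\<^sub>q quat_i + (1 / sqrt2) *\<^sub>q (quat_i + quat_j))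
     + d *\<^sub>q (1 / 2) *\<^sub>q ((1 + sqrt2) *\<^sub>q 1 + (3 + sqrt2) *\<^sub>q quat_i + quat_j + quat_k)"

lemma inverse_sqrt2: "1 / sqrt2 = qs 0 (1/2)" and inverse_two: "1 / 2 = qs (1/2) 0"
  by (simp_all add: divide_eq_eq sqrt2_nonzero) (simp_all add: qs_consts)

lemma G_elem_Quat:
  "G_elem (qs a1 a2) (qs b1 b2) (qs c1 c2) (qs d1 d2) = Quat
     (qs (a1 + d1 / 2 + d2) (a2 + d1 / 2 + d2 / 2))
     (qs (4 * b2 + 2 * c1 + c2 + 3 * d1 / 2 + d2) (2 * b1 + c1 / 2 + 2 * c2 + d1 / 2 + 3 * d2 / 2))
     (qs (c2 + d1 / 2) (c1 / 2 + d2 / 2))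
     (qs (d1 / 2) (d2 / 2))"
  unfolding G_elem_def inverse_sqrt2 inverse_two quat_i_def quat_j_def quat_k_def one_quat_def
  unfolding qs_consts by (simp add: field_simps)

text \<open>The quaternion 1 / sqrt 2 - i - k / sqrt 2; conjugation by it carries the diagonal order
  \<open>Eichler4\<close> onto \<open>G\<close>.\<close>

abbreviation conjugator :: "qsqrt2 quat" where "conjugator \<equiv> Oq 0 (-1) 0 0 0 0 0 (-1)"

lemma nrd_conjugator: "nrd conjugator = 2"
  by (simp add: nrd_Oq qs_numeral)

lemma G_elem_conjugator:
  "G_elem (qs (of_int a1) (of_int a2)) (qs (of_int b1) (of_int b2)) (qs (of_int c1) (of_int c2)) (qs (of_int d1) (of_int d2))
      * conjugator = conjugator * Oq (2 * a1 + d1 + 2 * d2) (-a1 + 2 * b2 + c1) (-a1 + 2 * b2 + c1 - d2)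
      (-a1 + 2 * b1 + c1 + 2 * c2 + d2) (a2 + 2 * b1 + 2 * b2 + c1 + 3 * c2 + 2 * d1 + 2 * d2)
      (2 * b1 + 2 * c2 + d1 + d2) (2 * b1 + 2 * c2 + d2) (4 * b2 + 2 * c1 + 2 * c2 + 2 * d1 + d2)"
  unfolding G_elem_Quat Oq_def by (simp add: field_simps)

text \<open>The map f is conjugation by \<open>conjugator\<close>, which preserves norms; working
  with \<open>q * conjugator = conjugator * t\<close> keeps the inverse out of the coordinate
  computations.\<close>

lemma r_G_eq: "r_G x = card (reps x \<inter> Eichler4)"
proof -
  define h' where "h' = inverse 2 *\<^sub>q qconj conjugator"
  define f where "f t = conjugator * (t * h')" for t
  have h': "conjugator * h' = 1" "h' * conjugator = 1"
    by (simp_all add: h'_def quat_scale_mult mult_qconj nrd_conjugator)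
  have fI: "f t = q" if "q * conjugator = conjugator * t" for q t
  proof -
    have "f t = (conjugator * t) * h'" by (simp only: f_def mult.assoc)
    also have "\<dots> = q * (conjugator * h')" by (simp only: that[symmetric] mult.assoc)
    finally show ?thesis by (simp only: h' mult_1_right)
  qed
  have "bij_betw f (reps x \<inter> Eichler4) {q \<in> G. nrd q = x}"
    unfolding bij_betw_def
  proof
    have "h' * (f t * conjugator) = t" for t
    proof -
      have "h' * (f t * conjugator) = (h' * conjugator) * t * (h' * conjugator)" by (simp only: f_def mult.assoc)
      then show ?thesis by (simp only: h' mult_1_left mult_1_right)
    qed
    then show "inj_on f (reps x \<inter> Eichler4)" by (metis inj_onI)
    have nf: "nrd (f t) = nrd t" for t
    proof -
      have "nrd conjugator * nrd h' = 1" using arg_cong[OF h'(1), of nrd] by (simp add: nrd_mult)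
      then show ?thesis by (simp add: f_def nrd_mult mult.left_commute)
    qed
    have fG: "f t \<in> G" if t: "t \<in> Eichler4" for t
    proof -
      obtain s x y z n u v w where e: "t = Oq s x y z n u v w" using Eichler_Omax(2)[OF t] by (rule Omax_cases)
      have "even (v + w)" "even (s + u + w)" "even (y + z)" "even (x + z + w)" using t by (simp_all only: e Eichler_Oq)
      then have "\<exists>a. v = w + 2 * a" "\<exists>b. s = u + w + 2 * b" "\<exists>c. y = z + 2 * c" "\<exists>d. x = z + w + 2 * d" by presburger+
      then obtain a b c d where k: "v = w + 2 * a" "s = u + w + 2 * b" "y = z + 2 * c" "x = z + w + 2 * d" by blast
      \<comment> \<open>The arguments invert the linear formula of \<open>G_elem_conjugator\<close>;
        the parity conditions on t, solved by a, b, c, d, make them integral.\<close>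
      define g where "g = G_elem (qs (of_int (b - 2 * d + 2 * c + a)) (of_int (-u - w - d + c + n)))
        (qs (of_int (u + b + z + 2 * c)) (of_int (w + d + a)))
        (qs (of_int (-w + b + z - 2 * d + 2 * c - a)) (of_int (-u - b - z - d - c + a)))
        (qs (of_int (u - w - 2 * a)) (of_int (w + 2 * d - 2 * c)))"
      have "g * conjugator = conjugator * t"
        unfolding g_def G_elem_conjugator e k
        by (rule arg_cong[where f = "(*) conjugator"], simp only: Oq_inject, simp)
      then have "f t = g" by (rule fI)
      moreover have "g \<in> G" unfolding G_def g_def G_elem_def mem_Collect_eq using Z2_qs by blast
      ultimately show ?thesis by simp
    qed
    have Gf: "q \<in> f ` (reps x \<inter> Eichler4)" if q: "q \<in> G" "nrd q = x" for q
    proof -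
      obtain a b c d where "a \<in> Z2" "b \<in> Z2" "c \<in> Z2" "d \<in> Z2" and g: "q = G_elem a b c d"
        using q(1) unfolding G_def G_elem_def by blast
      then obtain a1 a2 b1 b2 c1 c2 d1 d2 where g': "q = G_elem (qs (of_int a1) (of_int a2)) (qs (of_int b1) (of_int b2))
          (qs (of_int c1) (of_int c2)) (qs (of_int d1) (of_int d2))"
        by (metis Z2_iff)
      have "\<exists>t. t \<in> Eichler4 \<and> q * conjugator = conjugator * t"
        unfolding g' by (rule exI, rule conjI[rotated], rule G_elem_conjugator, simp)
      then obtain t where t: "t \<in> Eichler4" "q * conjugator = conjugator * t" by blast
      have ft: "q = f t" using fI[OF t(2)] by (rule sym)
      then have "nrd t = x" using nf q(2) by simp
      then have "t \<in> reps x \<inter> Eichler4" using t(1) Eichler_subset by (auto simp: reps_def)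
      then show ?thesis using ft by blast
    qed
    show "f ` (reps x \<inter> Eichler4) = {q \<in> G. nrd q = x}"
      using fG Gf nf by (auto simp: reps_def)
  qed
  then show ?thesis unfolding r_G_def by (simp add: bij_betw_same_card)
qed

text \<open>Even norm excludes two unit entries on the diagonal modulo \<open>sqrt2\<close>, and two
  nonunits mean divisibility by \<open>sqrt2\<close>. Conjugation exchanges the two remaining kinds,
  hence the factor 2. The set E stays general to cover both \<open>Eichler2\<close> and
  \<open>Eichler4\<close>.\<close>

lemma card_Eichler_even:
  assumes E: "E \<subseteq> Eichler2" "\<And>q. q \<in> E \<Longrightarrow> qconj q \<in> E" and x: "sqrt2 zdvd x"
  shows "card (reps x \<inter> E) = 2 * card (reps x \<inter> E \<inter> Corner) + card (reps x \<inter> E \<inter> scaled_Omax sqrt2)"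
proof -
  let ?C = "reps x \<inter> E \<inter> Corner" and ?D = "reps x \<inter> E \<inter> scaled_Omax sqrt2"
  have fin: "finite (reps x \<inter> B)" for B by (simp add: finite_reps)
  have conj: "qconj q \<in> reps x \<inter> E" if "q \<in> reps x \<inter> E" for q
    using that E(2) by (auto simp: reps_def)
  have tri: "(q \<in> Corner \<or> qconj q \<in> Corner \<or> q \<in> scaled_Omax sqrt2) \<and> \<not> (q \<in> Corner \<and> qconj q \<in> Corner)
      \<and> (q \<in> scaled_Omax sqrt2 \<longrightarrow> q \<notin> Corner \<and> qconj q \<notin> Corner)" if q: "q \<in> reps x \<inter> E" for q
  proof -
    obtain s x' y z n u v w where e: "q = Oq s x' y z n u v w" using q by (auto simp: reps_def elim: Omax_cases)
    have "sqrt2 zdvd nrd q" using q x by (simp add: reps_def)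
    then have "(odd s \<or> odd (x' + y + z)) \<longleftrightarrow> (odd (u + v) \<or> odd (v + w))"
      unfolding e sqrt2_zdvd_nrd_Oq .
    moreover have "even (v + w) \<and> even (s + u + w)" using q E(1) by (auto simp: e)
    ultimately show ?thesis unfolding e Oq_qconj Eichler_Oq sqrt2_multiple_Oq by simp argo
  qed
  have C: "qconj q \<in> Corner" if "q \<in> qconj ` ?C" for q using that by auto
  have un: "reps x \<inter> E = (?C \<union> qconj ` ?C) \<union> ?D"
  proof
    show "reps x \<inter> E \<subseteq> (?C \<union> qconj ` ?C) \<union> ?D"
    proof
      fix q assume q: "q \<in> reps x \<inter> E"
      have "q \<in> qconj ` ?C" if "qconj q \<in> Corner"
        using that conj[OF q] by (intro image_eqI[of _ _ "qconj q"]) simp_all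
      then show "q \<in> (?C \<union> qconj ` ?C) \<union> ?D" using tri[OF q] q by blast
    qed
    show "(?C \<union> qconj ` ?C) \<union> ?D \<subseteq> reps x \<inter> E" using conj by blast
  qed
  have "card (reps x \<inter> E) = card (?C \<union> qconj ` ?C) + card ?D"
  proof (subst un, rule card_Un_disjoint)
    show "(?C \<union> qconj ` ?C) \<inter> ?D = {}" using tri C by blast
  qed (simp_all add: finite_reps)
  also have "card (?C \<union> qconj ` ?C) = card ?C + card (qconj ` ?C)"
  proof (rule card_Un_disjoint)
    show "?C \<inter> qconj ` ?C = {}" using tri C by blast
  qed (simp_all add: finite_reps)
  also have "card (qconj ` ?C) = card ?C" by (rule card_image) (metis inj_onI qconj_qconj)
  finally show ?thesis by simp
qed

lemma Eichler_qconj: "q \<in> Eichler2 \<Longrightarrow> qconj q \<in> Eichler2" "q \<in> Eichler4 \<Longrightarrow> qconj q \<in> Eichler4"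
proof -
  show "qconj q \<in> Eichler2" if q: "q \<in> Eichler2"
  proof -
    obtain s x y z n u v w where e: "q = Oq s x y z n u v w" using Eichler_Omax(1)[OF q] by (rule Omax_cases)
    show ?thesis using q unfolding e Oq_qconj Eichler_Oq by simp
  qed
  show "qconj q \<in> Eichler4" if q: "q \<in> Eichler4"
  proof -
    obtain s x y z n u v w where e: "q = Oq s x y z n u v w" using Eichler_Omax(2)[OF q] by (rule Omax_cases)
    show ?thesis using q unfolding e Oq_qconj Eichler_Oq by simp argo
  qed
qed

text \<open>An off-diagonal entry of \<open>sqrt2 *\<^sub>q q\<close> vanishes modulo 2 exactly when
  that of q vanishes modulo \<open>sqrt2\<close>. This relates each order to the next larger one at
  an exponent lower by 2.\<close>

lemma sqrt2_scale_Eichler: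
  assumes "q \<in> Omax"
  shows "sqrt2 *\<^sub>q q \<in> Eichler2" "sqrt2 *\<^sub>q q \<in> Eichler4 \<longleftrightarrow> q \<in> Eichler2"
proof -
  obtain s x y z n u v w where e: "q = Oq s x y z n u v w" using assms by (rule Omax_cases)
  have s: "sqrt2 = qs (of_int 0) (of_int 1)" by (simp add: qs_sqrt2)
  show "sqrt2 *\<^sub>q q \<in> Eichler2" "sqrt2 *\<^sub>q q \<in> Eichler4 \<longleftrightarrow> q \<in> Eichler2"
    unfolding e s Oq_scale Eichler_Oq by (simp, simp, argo)
qed

lemma card_sqrt2_multiples_Eichler:
  "card (reps (sqrt2^2 * x) \<inter> Eichler2 \<inter> scaled_Omax sqrt2) = card (reps x)"
  "card (reps (sqrt2^2 * x) \<inter> Eichler4 \<inter> scaled_Omax sqrt2) = card (reps x \<inter> Eichler2)"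
proof -
  have inj: "inj_on (\<lambda>q. sqrt2 *\<^sub>q q) B" for B
    by (intro inj_onI) (simp add: quat_scale_cancel sqrt2_nonzero)
  have "reps (sqrt2^2 * x) \<inter> Eichler2 \<inter> scaled_Omax sqrt2 = (\<lambda>q. sqrt2 *\<^sub>q q) ` reps x"
    by (auto simp: reps_def nrd_scale sqrt2_scale_Eichler sqrt2_nonzero)
  then show "card (reps (sqrt2^2 * x) \<inter> Eichler2 \<inter> scaled_Omax sqrt2) = card (reps x)"
    by (simp add: card_image[OF inj])
  have "reps (sqrt2^2 * x) \<inter> Eichler4 \<inter> scaled_Omax sqrt2 = (\<lambda>q. sqrt2 *\<^sub>q q) ` (reps x \<inter> Eichler2)"
    by (auto simp: reps_def nrd_scale sqrt2_scale_Eichler sqrt2_nonzero)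
  then show "card (reps (sqrt2^2 * x) \<inter> Eichler4 \<inter> scaled_Omax sqrt2) = card (reps x \<inter> Eichler2)"
    by (simp add: card_image[OF inj])
qed

lemma sqrt2_multiples_empty:
  assumes "\<not> sqrt2^2 zdvd x" shows "reps x \<inter> E \<inter> scaled_Omax sqrt2 = {}"
  using assms nrd_Omax by (auto simp: reps_def nrd_scale)

text \<open>When the norm is odd, both diagonal entries are units modulo
  \<open>sqrt2\<close>.\<close>

lemma odd_subset_Corner:
  assumes "\<not> sqrt2 zdvd x" "E \<subseteq> Eichler2" shows "reps x \<inter> E \<inter> Corner = reps x \<inter> E"
proof -
  have "q \<in> Corner" if q: "q \<in> reps x \<inter> E" for q
  proof -
    obtain s x' y z n u v w where e: "q = Oq s x' y z n u v w" using q by (auto simp: reps_def elim: Omax_cases)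
    have "\<not> sqrt2 zdvd nrd q" using q assms by (simp add: reps_def)
    then have "\<not> ((odd s \<or> odd (x' + y + z)) \<longleftrightarrow> (odd (u + v) \<or> odd (v + w)))"
      unfolding e sqrt2_zdvd_nrd_Oq .
    moreover have "even (v + w) \<and> even (s + u + w)" using q assms(2) by (auto simp: e)
    ultimately show ?thesis unfolding e Eichler_Oq by simp argo
  qed
  then show ?thesis by blast
qed

text \<open>Four times the rational part of the norm is a sum of weighted squares equal to 4, and
  the parity conditions leave only two solutions. With the factors 6 and 4 of the translates this
  gives the 48 elements of norm 1 in \<open>Omax\<close>.\<close>

lemma reps_one_Eichler4: "reps 1 \<inter> Eichler4 = {1, - 1}"
proof (rule equalityI)
  show "{1, - 1} \<subseteq> reps 1 \<inter> Eichler4"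
    unfolding Oq_one Oq_uminus by (simp add: reps_def nrd_Oq qs_one)
  show "reps 1 \<inter> Eichler4 \<subseteq> {1, - 1}"
  proof
    fix q assume q: "q \<in> reps 1 \<inter> Eichler4"
    then obtain s x y z n u v w where e: "q = Oq s x y z n u v w" by (auto simp: reps_def elim: Omax_cases)
    have par: "even (v + w)" "even (s + u + w)" "even (y + z)" "even (x + z + w)" using q by (simp_all only: e Int_iff Eichler_Oq)
    define b where "b = 2 * n - u - v - w"
    have "nrd q = 1" using q by (simp add: reps_def)
    then have "s*s + s*(x+y+z) + x*x + y*y + z*z + 2*n*n - 2*n*(u+v+w) + u*u + v*v + w*w + u*v + u*w + v*w = 1"
      unfolding e nrd_Oq qs_one qs_inject by (metis of_int_1 of_int_eq_iff)
    then have sum: "s^2 + (s + 2*x)^2 + (s + 2*y)^2 + (s + 2*z)^2 + 2 * b^2 + 2 * u^2 + 2 * v^2 + 2 * w^2 = 4"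
      by (simp add: b_def power2_eq_square algebra_simps)
    have odd_sq: "c^2 \<ge> 1" if "odd c" for c :: int
    proof -
      have "c^2 > 0" using that by auto
      then show ?thesis by linarith
    qed
    have even_sq: "c = 0" if c: "even c" "c^2 \<le> 3" for c :: int
    proof -
      obtain k where k: "c = 2 * k" using c(1) by blast
      then have "k^2 < 1" using c(2) by (simp add: power2_eq_square)
      moreover have "k^2 \<ge> 0" by simp
      ultimately have "k^2 = 0" by linarith
      then show ?thesis by (simp add: k)
    qed
    note nonneg = zero_le_power2[of s] zero_le_power2[of "s + 2*x"] zero_le_power2[of "s + 2*y"] zero_le_power2[of "s + 2*z"]
      zero_le_power2[of b] zero_le_power2[of u] zero_le_power2[of v] zero_le_power2[of w]
    have s: "even s"
    proof (rule ccontr)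
      \<comment> \<open>Four odd squares already exhaust the total 4, so u and w vanish, against the
        parity of \<open>s + u + w\<close>.\<close>
      assume s: "odd s"
      then have "s^2 \<ge> 1" "(s + 2*x)^2 \<ge> 1" "(s + 2*y)^2 \<ge> 1" "(s + 2*z)^2 \<ge> 1" by (simp_all add: odd_sq)
      then have "u^2 \<le> 0" "w^2 \<le> 0" using sum nonneg by linarith+
      then have "u = 0" "w = 0" by simp_all
      then show False using par s by simp
    qed
    have "even u"
    proof (rule ccontr)
      assume "odd u"
      then have "odd u" "odd v" "odd w" "odd b" using par s unfolding b_def by presburger+
      then have "u^2 \<ge> 1" "v^2 \<ge> 1" "w^2 \<ge> 1" "b^2 \<ge> 1" by (simp_all add: odd_sq)
      then show False using sum nonneg by linarith
    qed
    then have "even u" "even v" "even w" "even b" using par s unfolding b_def by presburger+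
    moreover have "u^2 \<le> 3" "v^2 \<le> 3" "w^2 \<le> 3" "b^2 \<le> 3" using sum nonneg by linarith+
    ultimately have B: "u = 0" "v = 0" "w = 0" "b = 0" by (simp_all add: even_sq)
    then have n: "n = 0" by (simp add: b_def)
    obtain t where t: "s = 2 * t" using s by blast
    have sum': "t^2 + (t + x)^2 + (t + y)^2 + (t + z)^2 = 1"
      using sum B by (simp add: t power2_eq_square algebra_simps)
    have ev: "even (t + x)"
    proof (rule ccontr)
      \<comment> \<open>With \<open>w = 0\<close> the three sums have equal parity, so three odd
        squares would exceed the total 1.\<close>
      assume o: "odd (t + x)"
      then have "odd (t + y)" "odd (t + z)" using par B by presburger+
      then have "(t + x)^2 \<ge> 1" "(t + y)^2 \<ge> 1" "(t + z)^2 \<ge> 1" using o by (simp_all add: odd_sq)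
      then show False using sum' zero_le_power2[of t] by linarith
    qed
    then have "even (t + y)" "even (t + z)" using par B by presburger+
    moreover have "(t + x)^2 \<le> 3" "(t + y)^2 \<le> 3" "(t + z)^2 \<le> 3"
      using sum' zero_le_power2[of t] zero_le_power2[of "t + x"] zero_le_power2[of "t + y"] zero_le_power2[of "t + z"] by linarith+
    ultimately have 0: "t + x = 0" "t + y = 0" "t + z = 0" using ev by (simp_all add: even_sq)
    then have "t^2 = 1" using sum' by simp
    then have "t = 1 \<or> t = - 1" by (simp add: power2_eq_1_iff)
    moreover have "x = - t" "y = - t" "z = - t" using 0 by linarith+
    ultimately show "q \<in> {1, - 1}" unfolding e Oq_one Oq_uminus by (auto simp: B n t)
  qed
qed

lemma not_sqrt2_zdvd_one: "\<not> sqrt2 zdvd 1"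
  using zprime_sqrt2 by (simp add: zprime_def)

lemma card_reps_one: "card (reps 1) = 48"
proof -
  have "(1 :: qsqrt2 quat) \<noteq> - 1" unfolding Oq_one Oq_uminus by simp
  then have "card (reps 1 \<inter> Eichler4) = 2" by (simp add: reps_one_Eichler4)
  then show ?thesis
    using card_reps_Eichler2[OF not_sqrt2_zdvd_one] card_Eichler2_Eichler4[OF not_sqrt2_zdvd_one] by simp
qed

section \<open>The count in the maximal order for odd norm\<close>

lemma zdvd_unit_mult_left:
  assumes "u \<in> Z2" "v \<in> Z2" "u * v = 1" shows "u * p zdvd x \<longleftrightarrow> p zdvd x"
proof
  assume "u * p zdvd x"
  then obtain c where "c \<in> Z2" "x = p * (u * c)" by (auto simp: zdvd_def ac_simps)
  then show "p zdvd x" using assms by simp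
next
  assume "p zdvd x"
  then obtain c where c: "c \<in> Z2" "x = p * c" by (auto simp: zdvd_def)
  then have "x = (u * v) * (p * c)" by (simp add: assms(3))
  then have "x = u * p * (v * c)" by (simp only: ac_simps)
  then show "u * p zdvd x" using assms c(1) by (intro zdvdI[of "v * c"]) simp_all
qed

lemma zprime_unit_mult:
  assumes "zprime p" "u \<in> Z2" "v \<in> Z2" "u * v = 1" shows "zprime (u * p)"
  using assms(1,2) assms(4) unfolding zprime_def zdvd_unit_mult_left[OF assms(2-4)] by auto

text \<open>Induction on the norm, splitting off a prime that is first made totally positive, as the
  Hecke relation requires. Both sides obey the same recursion, of first or second order according to
  whether the prime divides the cofactor. A unit is a square here and reduces to norm 1.\<close>

lemma card_reps_odd:
  assumes "x \<in> Z2" "tpos x" "\<not> sqrt2 zdvd x"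
  shows "card (reps x) = 48 * odd_sigma x"
  using assms
proof (induction "inm x" arbitrary: x rule: less_induct)
  case less
  show ?case
  proof (cases "x zdvd 1")
    case True
    then obtain v w where v: "v \<in> Z2" "w \<in> Z2" "x = v * v" "v * w = 1"
      using tpos_unit_square less.prems by blast
    have "card (reps x) = card (reps 1)" using reps_unit_square[OF v(1,2,4), of 1] v(3) by simp
    moreover have "(v * v) * (w * w) = (v * w) * (v * w)" by (simp only: ac_simps)
    then have "odd_sigma (v * v * 1) = odd_sigma 1" using v by (intro odd_sigma_unit_mult[of _ _ "w * w"]) simp_all
    ultimately show ?thesis using v(3) by (simp add: card_reps_one odd_sigma_one)
  next
    case False
    then obtain p0 where p0: "zprime p0" "p0 zdvd x"
      using zprime_divisor_ex[OF less.prems(1)] tpos_nonzero[OF less.prems(2)] by blast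
    then have "p0 \<in> Z2" "p0 \<noteq> 0" by (simp_all add: zprime_def)
    then obtain u v where u: "u \<in> Z2" "v \<in> Z2" "u * v = 1" "tpos (u * p0)" using tpos_associate by blast
    define p where "p = u * p0"
    have p: "zprime p" "p zdvd x" "tpos p"
      using zprime_unit_mult[OF p0(1) u(1-3)] zdvd_unit_mult_left[OF u(1-3)] p0(2) u(4) by (simp_all add: p_def)
    have pZ: "p \<in> Z2" "\<not> p zdvd 1" "p \<noteq> 0" using p(1) by (simp_all add: zprime_def)
    have odd: "\<not> sqrt2 zdvd p" using less.prems(3) p(2) zdvd_trans by blast
    have N: "inm p \<ge> 2" using unit_iff_inm[OF pZ(1)] inm_eq_zero[OF pZ(1)] pZ by linarith
    obtain y where y: "y \<in> Z2" "x = p * y" using p(2) by (auto simp: zdvd_def)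
    have ty: "tpos y" using less.prems(2) tpos_cancel[OF p(3)] y(2) by simp
    have smaller: "inm z < inm (p * z)" if "z \<in> Z2" "tpos z" for z
    proof -
      have "inm z > 0" using inm_eq_zero[OF that(1)] tpos_nonzero[OF that(2)] by simp
      then show ?thesis using N inm_mult[OF pZ(1) that(1)] by simp
    qed
    have oy: "\<not> sqrt2 zdvd y" using less.prems(3) y zdvd_mult2[OF _ pZ(1)] by blast
    have fy: "card (reps y) = 48 * odd_sigma y"
      using smaller[OF y(1) ty] by (intro less.hyps y(1) ty oy) (simp add: y(2))
    show ?thesis
    proof (cases "p zdvd y")
      case False
      then show ?thesis
        using card_reps_odd_prime_not_dvd[OF p(1) odd p(3) y(1)] odd_sigma_prime_not_dvd[OF p(1) odd y(1)]
          fy tpos_nonzero[OF ty] by (simp add: y(2))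
    next
      case True
      then obtain z where z: "z \<in> Z2" "y = p * z" by (auto simp: zdvd_def)
      have tz: "tpos z" using ty tpos_cancel[OF p(3)] z(2) by simp
      have oz: "\<not> sqrt2 zdvd z" using oy z zdvd_mult2[OF _ pZ(1)] by blast
      have "inm z < inm x" using smaller[OF z(1) tz] smaller[OF y(1) ty] y(2) z(2) by simp
      then have fz: "card (reps z) = 48 * odd_sigma z" by (intro less.hyps z(1) tz oz)
      have "card (reps x) + inm p * (48 * odd_sigma z) = (inm p + 1) * (48 * odd_sigma y)"
        using card_reps_odd_prime_dvd[OF p(1) odd p(3) z(1)] fy fz by (simp only: y(2) z(2))
      moreover have "odd_sigma x + inm p * odd_sigma z = (inm p + 1) * odd_sigma y"
        using odd_sigma_prime_dvd[OF p(1) odd z(1) tpos_nonzero[OF tz]] by (simp only: y(2) z(2))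
      then have "48 * (odd_sigma x + inm p * odd_sigma z) = 48 * ((inm p + 1) * odd_sigma y)" by simp
      ultimately show ?thesis by (simp add: algebra_simps)
    qed
  qed
qed

text \<open>The exponent is raised by the totally positive \<open>lambda2\<close>; the compensating
  unit sqrt 2 - 1 moves into the odd part, where it leaves \<open>odd_sigma\<close> unchanged. The
  inductions on the exponent therefore let y vary.\<close>

lemma sqrt2_power_Suc_lambda2: "sqrt2 ^ Suc e * y = lambda2 * (sqrt2 ^ e * (qs (- 1) 1 * y))"
proof -
  have "lambda2 * (sqrt2 ^ e * (qs (- 1) 1 * y)) = sqrt2 ^ Suc e * ((qs 1 1 * qs (- 1) 1) * y)"
    unfolding lambda2_eq by (simp only: power_Suc ac_simps)
  then show ?thesis unfolding unit_inverse mult_1_left by (rule sym)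
qed

lemma unit_mult_facts:
  assumes "y \<in> Z2" "\<not> sqrt2 zdvd y"
  shows "qs (- 1) 1 * y \<in> Z2" "\<not> sqrt2 zdvd qs (- 1) 1 * y" "odd_sigma (qs (- 1) 1 * y) = odd_sigma y"
proof -
  have u: "qs (- 1) 1 * qs 1 1 = 1" using unit_inverse by (simp only: mult.commute)
  show "qs (- 1) 1 * y \<in> Z2" using assms(1) by simp
  show "odd_sigma (qs (- 1) 1 * y) = odd_sigma y" by (rule odd_sigma_unit_mult[OF assms(1) unit_Z2(2,1) u])
  show "\<not> sqrt2 zdvd qs (- 1) 1 * y"
  proof
    assume "sqrt2 zdvd qs (- 1) 1 * y"
    then have "sqrt2 zdvd qs 1 1 * (qs (- 1) 1 * y)" by (rule zdvd_mult2) simp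
    moreover have "qs 1 1 * (qs (- 1) 1 * y) = y" unfolding mult.assoc[symmetric] unit_inverse by (rule mult_1_left)
    ultimately show False using assms(2) by simp
  qed
qed

lemma tpos_power_Suc:
  "tpos (sqrt2 ^ Suc e * y) \<longleftrightarrow> tpos (sqrt2 ^ e * (qs (- 1) 1 * y))"
  unfolding sqrt2_power_Suc_lambda2 by (rule tpos_cancel[OF tpos_lambda2])

lemma tpos_power_Suc_Suc:
  "tpos (sqrt2 ^ Suc (Suc e) * y) \<longleftrightarrow> tpos (sqrt2 ^ e * y)"
proof -
  have "sqrt2 ^ Suc (Suc e) * y = (sqrt2 * sqrt2) * (sqrt2 ^ e * y)" by (simp only: power_Suc ac_simps)
  then show ?thesis by (simp only: tpos_cancel[OF tpos_square[OF sqrt2_nonzero]])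
qed

lemma power_Suc_Suc_eq: "sqrt2 ^ Suc (Suc e) * y = sqrt2^2 * (sqrt2 ^ e * y)"
  by (simp only: power_Suc power2_eq_square ac_simps)

lemma not_sqrt2_square_zdvd: "y \<in> Z2 \<Longrightarrow> \<not> sqrt2 zdvd y \<Longrightarrow> \<not> sqrt2^2 zdvd sqrt2 ^ Suc 0 * y"
  using zdvd_mult_cancel[OF sqrt2_nonzero, of sqrt2 y] by (simp add: power2_eq_square)

text \<open>Solves r(e + 1) = 3 r(e) - 2 r(e - 1) with r(-1) = 0 and r(0) = 48 sigma by 48 (2^(e +
  1) - 1) sigma, written without subtraction of natural numbers.\<close>

lemma card_reps_val:
  assumes "y \<in> Z2" "\<not> sqrt2 zdvd y" "tpos (sqrt2 ^ e * y)"
  shows "card (reps (sqrt2 ^ e * y)) + 48 * odd_sigma y = 96 * 2 ^ e * odd_sigma y"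
  using assms
proof (induction e arbitrary: y rule: less_induct)
  case (less e)
  show ?case
  proof (cases e)
    case 0
    then show ?thesis using card_reps_odd less.prems by simp
  next
    case (Suc k)
    let ?y = "qs (- 1) 1 * y" and ?x = "sqrt2 ^ Suc k * y"
    note y' = unit_mult_facts[OF less.prems(1,2)]
    define m where "m = card {q \<in> reps ?x. q \<in> scaled_Omax sqrt2}"
    have t: "tpos (sqrt2 ^ k * ?y)" using less.prems(3) unfolding Suc tpos_power_Suc .
    have f: "card (reps (sqrt2 ^ k * ?y)) + 48 * odd_sigma y = 96 * 2 ^ k * odd_sigma y"
      using less.IH[of k ?y] y' t Suc by simp
    have "sqrt2 ^ k * ?y \<in> Z2" by (rule Z2_closed(2)[OF Z2_power[OF Z2_consts(3)] y'(1)])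
    then have H: "3 * card (reps (sqrt2 ^ k * ?y)) + m = card (reps ?x) + 3 * m"
      using hecke_lambda2[of "sqrt2 ^ k * ?y"] unfolding m_def sqrt2_power_Suc_lambda2 by blast
    \<comment> \<open>The number m is the count at exponent k - 1; for k = 0 it is 0, which fits the
      same formula.\<close>
    have m: "m + 48 * odd_sigma y = 48 * 2 ^ k * odd_sigma y"
    proof (cases k)
      case 0
      then have "m = 0" unfolding m_def
        using card_scaled_reps_empty[OF Z2_consts(3) sqrt2_nonzero] not_sqrt2_square_zdvd[OF less.prems(1,2)] by simp
      then show ?thesis using 0 by simp
    next
      case (Suc j)
      have "m = card (reps (sqrt2 ^ j * y))"
        unfolding m_def Suc power_Suc_Suc_eq by (rule card_scaled_reps[OF Z2_consts(3) sqrt2_nonzero])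
      moreover have "tpos (sqrt2 ^ j * y)" using less.prems(3) unfolding \<open>e = Suc k\<close> Suc tpos_power_Suc_Suc .
      ultimately show ?thesis using less.IH[of j y] less.prems \<open>e = Suc k\<close> Suc by simp
    qed
    show ?thesis using f H m unfolding Suc by simp
  qed
qed

text \<open>At exponent 0 every element is in \<open>Corner\<close>, so the initial factors 2 and 8
  are 48 / 24 and 48 / 6; each further \<open>lambda2\<close> doubles them.\<close>

lemma card_corner_val:
  assumes "y \<in> Z2" "\<not> sqrt2 zdvd y" "tpos (sqrt2 ^ e * y)"
  shows "card (reps (sqrt2 ^ e * y) \<inter> Eichler4 \<inter> Corner) = 2 * 2 ^ e * odd_sigma y"
    and "card (reps (sqrt2 ^ e * y) \<inter> Eichler2 \<inter> Corner) = 8 * 2 ^ e * odd_sigma y"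
proof -
  have "card (reps (sqrt2 ^ e * y) \<inter> Eichler4 \<inter> Corner) = 2 * 2 ^ e * odd_sigma y \<and>
    card (reps (sqrt2 ^ e * y) \<inter> Eichler2 \<inter> Corner) = 8 * 2 ^ e * odd_sigma y"
    using assms
  proof (induction e arbitrary: y)
    case 0
    then show ?case
      using card_reps_odd[of y] card_reps_Eichler2[of y] card_Eichler2_Eichler4[of y]
      by (simp add: odd_subset_Corner Eichler_subset)
  next
    case (Suc e)
    let ?y = "qs (- 1) 1 * y"
    note y' = unit_mult_facts[OF Suc.prems(1,2)]
    have t: "tpos (sqrt2 ^ e * ?y)" using Suc.prems(3) unfolding tpos_power_Suc .
    have Z: "sqrt2 ^ e * ?y \<in> Z2" by (rule Z2_closed(2)[OF Z2_power[OF Z2_consts(3)] y'(1)])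
    show ?case
      using Suc.IH[OF y'(1,2) t] y'(3) unfolding sqrt2_power_Suc_lambda2 card_corner_Eichler4[OF Z] card_corner_Eichler2[OF Z]
      by simp
  qed
  then show "card (reps (sqrt2 ^ e * y) \<inter> Eichler4 \<inter> Corner) = 2 * 2 ^ e * odd_sigma y"
    "card (reps (sqrt2 ^ e * y) \<inter> Eichler2 \<inter> Corner) = 8 * 2 ^ e * odd_sigma y" by blast+
qed

lemma sqrt2_zdvd_power_Suc: "y \<in> Z2 \<Longrightarrow> sqrt2 zdvd sqrt2 ^ Suc e * y"
  unfolding power_Suc mult.assoc by (rule zdvd_triv(1)) simp

text \<open>Divides by \<open>sqrt2\<close> where possible, which leads to the next larger order. At
  e = 1 nothing is divisible, since the norm is no multiple of \<open>sqrt2^2\<close>, and the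
  difference \<open>e - 2\<close> is taken only for e \<ge> 2.\<close>

lemma card_reps_Eichler_val:
  assumes y: "y \<in> Z2" "\<not> sqrt2 zdvd y" and t: "tpos (sqrt2 ^ e * y)" and E: "E = Eichler2 \<or> E = Eichler4"
  shows "card (reps (sqrt2 ^ e * y) \<inter> E) =
    (if e = 0 then 1 else 2) * card (reps (sqrt2 ^ e * y) \<inter> E \<inter> Corner)
    + (if e < 2 then 0 else if E = Eichler2 then card (reps (sqrt2 ^ (e - 2) * y)) else card (reps (sqrt2 ^ (e - 2) * y) \<inter> Eichler2))"
proof -
  have EE: "E \<subseteq> Eichler2" "\<And>q. q \<in> E \<Longrightarrow> qconj q \<in> E" using E Eichler_subset Eichler_qconj by blast+
  have ev: "card (reps x \<inter> E) = 2 * card (reps x \<inter> E \<inter> Corner) + card (reps x \<inter> E \<inter> scaled_Omax sqrt2)"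
    if "sqrt2 zdvd x" for x using EE that by (intro card_Eichler_even)
  consider "e = 0" | "e = 1" | k where "e = Suc (Suc k)" by (metis One_nat_def not0_implies_Suc)
  then show ?thesis
  proof cases
    case 1
    then show ?thesis using odd_subset_Corner[OF y(2) EE(1)] by simp
  next
    case 2
    then show ?thesis
      using ev[OF sqrt2_zdvd_power_Suc[OF y(1), of 0]] sqrt2_multiples_empty[OF not_sqrt2_square_zdvd[OF y]]
      by simp
  next
    case 3
    have "card (reps (sqrt2 ^ e * y) \<inter> E) = 2 * card (reps (sqrt2 ^ e * y) \<inter> E \<inter> Corner)
        + card (reps (sqrt2^2 * (sqrt2 ^ k * y)) \<inter> E \<inter> scaled_Omax sqrt2)"
      unfolding 3 using ev[OF sqrt2_zdvd_power_Suc[OF y(1), of "Suc k"]] unfolding power_Suc_Suc_eq .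
    then show ?thesis
      using E Eichler4_neq_Eichler2 card_sqrt2_multiples_Eichler[of "sqrt2 ^ k * y"] 3 by (elim disjE) simp_all
  qed
qed

theorem theorem3p35:
  fixes \<alpha> :: qsqrt2 and e :: nat
  assumes "\<alpha> \<in> carrier OK"
    and "totally_positive \<alpha>"
    and "\<alpha> \<in> PIdl\<^bsub>OK\<^esub> (sqrt2 ^ e) - PIdl\<^bsub>OK\<^esub> (sqrt2 ^ (e + 1))"
  shows "int (r_G \<alpha>) =
    2 * (\<Sum>I | ideal I OK
              \<and> I divides\<^bsub>ideals_set OK\<^esub> (PIdl\<^bsub>OK\<^esub> \<alpha>)
              \<and> \<not> (PIdl\<^bsub>OK\<^esub> sqrt2) divides\<^bsub>ideals_set OK\<^esub> I.
           int (absolute_norm I)) *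
    (if e = 0 then 1
     else if e = 1 then 2 * 2
     else if e = 2 then 3 * 2 ^ 2
     else if e = 3 then 4 * 2 ^ 3
     else 2 * (\<Sum>m = 3..e. 2 ^ m) + 3 * 2 ^ e - 2 ^ 3)"
proof -
  have sZ: "sqrt2 ^ k \<in> Z2" for k by simp
  obtain y where y: "y \<in> Z2" "\<alpha> = sqrt2 ^ e * y"
    using assms(3) unfolding zideal_eq[OF sZ] zdvd_def by blast
  have odd: "\<not> sqrt2 zdvd y"
  proof
    assume "sqrt2 zdvd y"
    then have "sqrt2 ^ e * sqrt2 zdvd sqrt2 ^ e * y" by (simp add: zdvd_mult_cancel sqrt2_nonzero)
    then show False using assms(3) unfolding zideal_eq[OF sZ] y(2) by (simp add: mult.commute)
  qed
  have t: "tpos (sqrt2 ^ e * y)" using totally_positive_tpos[OF assms(2)] y(2) by simp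
  \<comment> \<open>All ideals are principal, so the divisibility of ideals in the statement becomes
    \<open>zdvd\<close> of generators.\<close>
  have "{I. ideal I OK \<and> I divides\<^bsub>ideals_set OK\<^esub> (zideal \<alpha>) \<and> \<not> (zideal sqrt2) divides\<^bsub>ideals_set OK\<^esub> I}
      = odd_ideal_divisors \<alpha>"
    using assms(1) unfolding ideal_OK_iff odd_ideal_divisors_def by (auto simp: zideal_divides_iff)
  then have S: "(\<Sum>I | ideal I OK \<and> I divides\<^bsub>ideals_set OK\<^esub> (zideal \<alpha>) \<and> \<not> (zideal sqrt2) divides\<^bsub>ideals_set OK\<^esub> I.
      int (absolute_norm I)) = int (odd_sigma y)"
  proof -
    have "odd_sigma (sqrt2 ^ k * y) = odd_sigma y" for k
      by (induction k) (use y(1) in \<open>simp_all add: mult.assoc odd_sigma_sqrt2\<close>)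
    then have "odd_sigma \<alpha> = odd_sigma y" by (simp add: y(2))
    then show ?thesis using \<open>_ = odd_ideal_divisors \<alpha>\<close>
      by (simp add: odd_sigma_def flip: of_nat_sum)
  qed
  let ?n = "int (odd_sigma y)"
  have r4: "r_G \<alpha> = (if e = 0 then 1 else 2) * (2 * 2 ^ e * odd_sigma y)
      + (if e < 2 then 0 else card (reps (sqrt2 ^ (e - 2) * y) \<inter> Eichler2))"
    unfolding r_G_eq y(2)
    using card_reps_Eichler_val[OF y(1) odd t, of Eichler4] card_corner_val(1)[OF y(1) odd t] Eichler4_neq_Eichler2
    by simp
  have t2: "tpos (sqrt2 ^ (k - 2) * y)" if "k \<ge> 2" "tpos (sqrt2 ^ k * y)" for k
    using that tpos_power_Suc_Suc[of "k - 2" y] by (simp add: numeral_2_eq_2 Suc_diff_Suc del: power_Suc)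
  have r2: "card (reps (sqrt2 ^ k * y) \<inter> Eichler2) = (if k = 0 then 1 else 2) * (8 * 2 ^ k * odd_sigma y)
      + (if k < 2 then 0 else card (reps (sqrt2 ^ (k - 2) * y)))" if "tpos (sqrt2 ^ k * y)" for k
    using card_reps_Eichler_val[OF y(1) odd that, of Eichler2] card_corner_val(2)[OF y(1) odd that] by simp
  consider "e = 0" | "e = 1" | "e = 2" | "e = 3" | k where "e = k + 4"
  proof -
    have "e = 0 \<or> e = 1 \<or> e = 2 \<or> e = 3 \<or> (\<exists>k. e = k + 4)" by presburger
    then show thesis using that by blast
  qed
  then show ?thesis
  proof cases
    case 1
    then show ?thesis using r4 unfolding S by simp
  next
    case 2
    then show ?thesis using r4 unfolding S by simp
  next
    case 3
    then show ?thesis using r4 r2[of 0] t2[OF _ t] unfolding S by simp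
  next
    case 4
    then show ?thesis using r4 r2[of 1] t2[OF _ t] unfolding S by simp
  next
    case 5
    have tk: "tpos (sqrt2 ^ (k + 2) * y)" "tpos (sqrt2 ^ k * y)"
      using t2[of e] t2[of "k + 2"] t 5 by simp_all
    have "r_G \<alpha> = 4 * 2 ^ e * odd_sigma y + (16 * 2 ^ (k + 2) * odd_sigma y + card (reps (sqrt2 ^ k * y)))"
      using r4 r2[OF tk(1)] 5 by simp
    moreover have "card (reps (sqrt2 ^ k * y)) + 48 * odd_sigma y = 96 * 2 ^ k * odd_sigma y"
      by (rule card_reps_val[OF y(1) odd tk(2)])
    \<comment> \<open>With e = k + 4 the coefficient is 4 * 16 + 16 * 4 + 96 = 224, from
      \<open>Eichler4\<close>, \<open>Eichler2\<close> and \<open>Omax\<close> in turn.\<close>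
    ultimately have "r_G \<alpha> + 48 * odd_sigma y = 224 * 2 ^ k * odd_sigma y"
      by (simp add: 5 power_add)
    then have r: "int (r_G \<alpha>) = 224 * 2 ^ k * ?n - 48 * ?n" by (simp flip: of_nat_eq_iff[where 'a = int])
    \<comment> \<open>The geometric sum turns the bracket of the statement into 7 * 2^e - 24, which
      is half of \<open>224 * 2 ^ k - 48\<close>.\<close>
    have "(\<Sum>m = 3..k + 4. 2 ^ m) = (2 ^ (k + 5) - 8 :: int)"
      by (induction k) (simp_all add: sum.atLeast_Suc_atMost numeral_eq_Suc)
    then have v: "2 * (\<Sum>m = 3..e. 2 ^ m) + 3 * 2 ^ e - 2 ^ 3 = (112 * 2 ^ k - 24 :: int)"
      unfolding 5 by (simp add: power_add)
    have "e \<noteq> 0" "e \<noteq> 1" "e \<noteq> 2" "e \<noteq> 3" using 5 by simp_all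
    then show ?thesis unfolding S r by (simp only: if_False v) (simp add: algebra_simps)
  qed
qed

end
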